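(* (In $ZFC$.) $IFS(L(\mathbb{R}))$ holds if and only if every partial order $P$ definable in $L(\mathbb{R})$ such that $r.o.(P)$ is $(\omega,\omega)$-distributive has an $L(\mathbb{R})$-generic subset.
   Context: $L(\mathbb{R})$ is the class of sets constructible from $\mathbb{R}$. An element $x$ of $L(\mathbb{R})$ is definable in $L(\mathbb{R})$ if for some formula $\varphi(v)$ without parameters, $L(\mathbb{R})\models\exists!v\,\varphi(v)\wedge\varphi(x)$. For a partial order $P\in L(\mathbb{R})$, $G\subseteq P$ is $L(\mathbb{R})$-generic if $G$ meets every dense subset of $P$ belonging to $L(\mathbb{R})$. $r.o.(P)$ is the complete Boolean algebra of regular open subsets of the (separative) partial order $P$; a Boolean algebra $B$ is $(\kappa,\lambda)$-distributive if every collection of $\kappa$ partitions of $B$, each of size at most $\lambda$, has a common refinement. $IFS(L(\mathbb{R}))$ is the schema: if $P$ is a partial order definable in $L(\mathbb{R})$ such that $\Vdash_P\mathbb{R}=\mathbb{R}^{V^P}$ (forcing with $P$ adds no new reals), then there is an $L(\mathbb{R})$-generic subset of $P$ in $V$. *)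

theory Defs
  imports Main
begin

(* First-order formulas in the language of set theory, with de Bruijn indices:
   under "Forall" index 0 is the bound variable and all other indices are shifted by one. *)

datatype fm = Mem nat nat | Eq nat nat | Neg fm | Conj fm fm | Forall fm

abbreviation Imp :: "fm \<Rightarrow> fm \<Rightarrow> fm" where
  "Imp \<phi> \<psi> \<equiv> Neg (Conj \<phi> (Neg \<psi>))"

abbreviation Iff :: "fm \<Rightarrow> fm \<Rightarrow> fm" where
  "Iff \<phi> \<psi> \<equiv> Conj (Imp \<phi> \<psi>) (Imp \<psi> \<phi>)"

primrec fv :: "fm \<Rightarrow> nat set" where
  "fv (Mem i j) = {i, j}"
| "fv (Eq i j) = {i, j}"
| "fv (Neg \<phi>) = fv \<phi>"
| "fv (Conj \<phi> \<psi>) = fv \<phi> \<union> fv \<psi>"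
| "fv (Forall \<phi>) = {n. Suc n \<in> fv \<phi>}"

(* A structure for the language of set theory: a type 'v with an arbitrary binary relation.
   It is not assumed to be well-founded or to have standard natural numbers. Hence the set
   theory below is developed inside the structure: "set", "function", "omega" etc. always
   mean elements of 'v. "Class" means a predicate on 'v. *)

locale set_structure =
  fixes mem :: "'v \<Rightarrow> 'v \<Rightarrow> bool" (infix "\<epsilon>" 50)
begin

(* Truth in the substructure given by the class C. *)

primrec sat :: "('v \<Rightarrow> bool) \<Rightarrow> (nat \<Rightarrow> 'v) \<Rightarrow> fm \<Rightarrow> bool" where
  "sat C \<rho> (Mem i j) \<longleftrightarrow> \<rho> i \<epsilon> \<rho> j"
| "sat C \<rho> (Eq i j) \<longleftrightarrow> \<rho> i = \<rho> j"
| "sat C \<rho> (Neg \<phi>) \<longleftrightarrow> \<not> sat C \<rho> \<phi>"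
| "sat C \<rho> (Conj \<phi> \<psi>) \<longleftrightarrow> sat C \<rho> \<phi> \<and> sat C \<rho> \<psi>"
| "sat C \<rho> (Forall \<phi>) \<longleftrightarrow> (\<forall>x. C x \<longrightarrow> sat C (case_nat x \<rho>) \<phi>)"

abbreviation el :: "'v \<Rightarrow> 'v set" where
  "el a \<equiv> {x. x \<epsilon> a}"

(* In the two schemas the values of \<rho> at the remaining indices are the parameters. *)

definition ZFC :: bool where
  "ZFC \<longleftrightarrow>
     \<comment> \<open>extensionality\<close>
     (\<forall>a b. el a = el b \<longrightarrow> a = b) \<and>
     \<comment> \<open>foundation\<close>
     (\<forall>a. el a \<noteq> {} \<longrightarrow> (\<exists>x\<in>el a. el x \<inter> el a = {})) \<and>
     \<comment> \<open>pairing\<close>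
     (\<forall>a b. \<exists>c. el c = {a, b}) \<and>
     \<comment> \<open>union\<close>
     (\<forall>a. \<exists>b. el b = (\<Union>y\<in>el a. el y)) \<and>
     \<comment> \<open>power set\<close>
     (\<forall>a. \<exists>b. el b = {x. el x \<subseteq> el a}) \<and>
     \<comment> \<open>infinity\<close>
     (\<exists>a. (\<exists>z\<in>el a. el z = {}) \<and> (\<forall>x\<in>el a. \<exists>y\<in>el a. el y = insert x (el x))) \<and>
     \<comment> \<open>separation\<close>
     (\<forall>\<phi> \<rho> a. \<exists>b. el b = {x \<in> el a. sat (\<lambda>_. True) (case_nat x \<rho>) \<phi>}) \<and>
     \<comment> \<open>replacement\<close>
     (\<forall>\<phi> \<rho> a. (\<forall>x\<in>el a. \<exists>!y. sat (\<lambda>_. True) (case_nat x (case_nat y \<rho>)) \<phi>) \<longrightarrow>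
        (\<exists>b. \<forall>x\<in>el a. \<exists>y\<in>el b. sat (\<lambda>_. True) (case_nat x (case_nat y \<rho>)) \<phi>)) \<and>
     \<comment> \<open>choice\<close>
     (\<forall>a. (\<forall>x\<in>el a. el x \<noteq> {}) \<and> (\<forall>x\<in>el a. \<forall>y\<in>el a. x \<noteq> y \<longrightarrow> el x \<inter> el y = {}) \<longrightarrow>
        (\<exists>c. \<forall>x\<in>el a. \<exists>!y. y \<in> el c \<inter> el x))"


(* The element with extension A; only used where ZFC provides such an element. *)

definition setof :: "'v set \<Rightarrow> 'v" where
  "setof A = (THE z. el z = A)"

definition empty :: 'v where
  "empty = setof {}"

definition upair :: "'v \<Rightarrow> 'v \<Rightarrow> 'v" where
  "upair x y = setof {x, y}"

definition opair :: "'v \<Rightarrow> 'v \<Rightarrow> 'v" ("\<langle>_,/ _\<rangle>") where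
  "\<langle>x, y\<rangle> = upair (upair x x) (upair x y)"

definition first :: "'v \<Rightarrow> 'v" where
  "first z = (THE x. \<exists>y. z = \<langle>x, y\<rangle>)"

definition second :: "'v \<Rightarrow> 'v" where
  "second z = (THE y. \<exists>x. z = \<langle>x, y\<rangle>)"

definition succ :: "'v \<Rightarrow> 'v" where
  "succ x = setof (insert x (el x))"

definition powerset :: "'v \<Rightarrow> 'v" where
  "powerset a = setof {x. el x \<subseteq> el a}"

definition succ_closed :: "'v \<Rightarrow> bool" where
  "succ_closed a \<longleftrightarrow> empty \<epsilon> a \<and> (\<forall>x\<in>el a. succ x \<epsilon> a)"

definition omega :: 'v where
  "omega = setof {n. \<forall>a. succ_closed a \<longrightarrow> n \<epsilon> a}"

(* Reals are subsets of omega. *)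

definition reals :: 'v where
  "reals = powerset omega"

definition fun_on :: "'v \<Rightarrow> 'v \<Rightarrow> bool" where
  "fun_on f a \<longleftrightarrow>
     (\<forall>z\<in>el f. \<exists>x\<in>el a. \<exists>y. z = \<langle>x, y\<rangle>) \<and> (\<forall>x\<in>el a. \<exists>!y. \<langle>x, y\<rangle> \<epsilon> f)"

definition app :: "'v \<Rightarrow> 'v \<Rightarrow> 'v" where
  "app f x = (THE y. \<langle>x, y\<rangle> \<epsilon> f)"

definition card_le :: "'v \<Rightarrow> 'v \<Rightarrow> bool" where
  "card_le a b \<longleftrightarrow> (\<exists>f. fun_on f a \<and> app f ` el a \<subseteq> el b \<and> inj_on (app f) (el a))"

definition transitive_set :: "'v \<Rightarrow> bool" where
  "transitive_set t \<longleftrightarrow> (\<forall>x\<in>el t. el x \<subseteq> el t)"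

definition trcl :: "'v \<Rightarrow> 'v" where
  "trcl a = setof {x. \<forall>t. transitive_set t \<and> el a \<subseteq> el t \<longrightarrow> x \<epsilon> t}"

definition ordinal :: "'v \<Rightarrow> bool" where
  "ordinal \<alpha> \<longleftrightarrow> transitive_set \<alpha> \<and> (\<forall>x\<in>el \<alpha>. transitive_set x)"


(* The definable power set Def A: subsets of A first-order definable over (A, \<epsilon>) with
   parameters from A. Formulas are coded by sets and quantified over inside the structure.
   Assignments are functions from omega into A. *)

definition cMem :: "'v \<Rightarrow> 'v \<Rightarrow> 'v" where
  "cMem i j = \<langle>empty, \<langle>i, j\<rangle>\<rangle>"

definition cEq :: "'v \<Rightarrow> 'v \<Rightarrow> 'v" where
  "cEq i j = \<langle>succ empty, \<langle>i, j\<rangle>\<rangle>"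

definition cNeg :: "'v \<Rightarrow> 'v" where
  "cNeg x = \<langle>succ (succ empty), x\<rangle>"

definition cConj :: "'v \<Rightarrow> 'v \<Rightarrow> 'v" where
  "cConj x y = \<langle>succ (succ (succ empty)), \<langle>x, y\<rangle>\<rangle>"

definition cAll :: "'v \<Rightarrow> 'v" where
  "cAll x = \<langle>succ (succ (succ (succ empty))), x\<rangle>"

definition formula_closed :: "'v \<Rightarrow> bool" where
  "formula_closed F \<longleftrightarrow>
     (\<forall>i\<in>el omega. \<forall>j\<in>el omega. cMem i j \<epsilon> F \<and> cEq i j \<epsilon> F) \<and>
     (\<forall>x\<in>el F. cNeg x \<epsilon> F \<and> cAll x \<epsilon> F) \<and>
     (\<forall>x\<in>el F. \<forall>y\<in>el F. cConj x y \<epsilon> F)"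

definition formulas :: 'v where
  "formulas = setof {x. \<forall>F. formula_closed F \<longrightarrow> x \<epsilon> F}"

definition assigns :: "'v \<Rightarrow> 'v \<Rightarrow> bool" where
  "assigns A s \<longleftrightarrow> fun_on s omega \<and> (\<forall>n\<in>el omega. app s n \<epsilon> A)"

definition scons :: "'v \<Rightarrow> 'v \<Rightarrow> 'v" where
  "scons a s = setof (insert \<langle>empty, a\<rangle> {\<langle>succ n, app s n\<rangle> | n. n \<epsilon> omega})"

definition satisfaction :: "'v \<Rightarrow> 'v \<Rightarrow> bool" where
  "satisfaction A S \<longleftrightarrow> (\<forall>s. assigns A s \<longrightarrow>
     (\<forall>i\<in>el omega. \<forall>j\<in>el omega.
        (\<langle>cMem i j, s\<rangle> \<epsilon> S \<longleftrightarrow> app s i \<epsilon> app s j) \<and>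
        (\<langle>cEq i j, s\<rangle> \<epsilon> S \<longleftrightarrow> app s i = app s j)) \<and>
     (\<forall>x\<in>el formulas.
        (\<langle>cNeg x, s\<rangle> \<epsilon> S \<longleftrightarrow> \<not> \<langle>x, s\<rangle> \<epsilon> S) \<and>
        (\<langle>cAll x, s\<rangle> \<epsilon> S \<longleftrightarrow> (\<forall>a\<in>el A. \<langle>x, scons a s\<rangle> \<epsilon> S))) \<and>
     (\<forall>x\<in>el formulas. \<forall>y\<in>el formulas.
        \<langle>cConj x y, s\<rangle> \<epsilon> S \<longleftrightarrow> \<langle>x, s\<rangle> \<epsilon> S \<and> \<langle>y, s\<rangle> \<epsilon> S))"

definition Def :: "'v \<Rightarrow> 'v" where
  "Def A = setof {X. \<exists>S x s. satisfaction A S \<and> x \<epsilon> formulas \<and> assigns A s \<and>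
                       el X = {a \<in> el A. \<langle>x, scons a s\<rangle> \<epsilon> S}}"

(* f is the sequence of the L_\<beta>(R) for \<beta> < \<alpha>, where L_0(R) is the transitive closure of {R}. *)

definition LR_hierarchy :: "'v \<Rightarrow> 'v \<Rightarrow> bool" where
  "LR_hierarchy f \<alpha> \<longleftrightarrow> ordinal \<alpha> \<and> fun_on f \<alpha> \<and>
     (\<forall>\<beta>\<in>el \<alpha>.
        (\<beta> = empty \<longrightarrow> app f \<beta> = trcl (upair reals reals)) \<and>
        (\<forall>\<gamma>. \<beta> = succ \<gamma> \<longrightarrow> app f \<beta> = Def (app f \<gamma>)) \<and>
        (\<beta> \<noteq> empty \<and> (\<nexists>\<gamma>. \<beta> = succ \<gamma>) \<longrightarrow> app f \<beta> = setof (\<Union>\<gamma>\<in>el \<beta>. el (app f \<gamma>))))"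

definition LR :: "'v \<Rightarrow> bool" where
  "LR x \<longleftrightarrow> (\<exists>f \<alpha>. LR_hierarchy f \<alpha> \<and> (\<exists>\<beta>\<in>el \<alpha>. x \<epsilon> app f \<beta>))"

definition definable_LR :: "'v \<Rightarrow> bool" where
  "definable_LR x \<longleftrightarrow> LR x \<and>
     (\<exists>\<phi>. fv \<phi> \<subseteq> {0} \<and> (\<forall>y. LR y \<longrightarrow> (sat LR (\<lambda>_. y) \<phi> \<longleftrightarrow> y = x)))"


(* A partial order is a pair of a nonempty carrier and an order relation; smaller elements
   are stronger conditions. The empty order is excluded as usual in forcing: it has no
   generic subset at all. *)

abbreviation carrier :: "'v \<Rightarrow> 'v set" where
  "carrier P \<equiv> el (first P)"

definition le :: "'v \<Rightarrow> 'v \<Rightarrow> 'v \<Rightarrow> bool" where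
  "le P p q \<longleftrightarrow> \<langle>p, q\<rangle> \<epsilon> second P"

definition partial_order :: "'v \<Rightarrow> bool" where
  "partial_order P \<longleftrightarrow>
     (\<exists>c r. P = \<langle>c, r\<rangle>) \<and> carrier P \<noteq> {} \<and>
     (\<forall>z\<in>el (second P). \<exists>p\<in>carrier P. \<exists>q\<in>carrier P. z = \<langle>p, q\<rangle>) \<and>
     (\<forall>p\<in>carrier P. le P p p) \<and>
     (\<forall>p\<in>carrier P. \<forall>q\<in>carrier P. le P p q \<and> le P q p \<longrightarrow> p = q) \<and>
     (\<forall>p\<in>carrier P. \<forall>q\<in>carrier P. \<forall>r\<in>carrier P. le P p q \<and> le P q r \<longrightarrow> le P p r)"

definition dense :: "'v \<Rightarrow> 'v \<Rightarrow> bool" where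
  "dense P D \<longleftrightarrow> el D \<subseteq> carrier P \<and> (\<forall>p\<in>carrier P. \<exists>d\<in>el D. le P d p)"

(* As always for generic sets, G is required to be a filter. *)

definition is_filter :: "'v \<Rightarrow> 'v \<Rightarrow> bool" where
  "is_filter P G \<longleftrightarrow> el G \<subseteq> carrier P \<and> el G \<noteq> {} \<and>
     (\<forall>p\<in>el G. \<forall>q\<in>carrier P. le P p q \<longrightarrow> q \<epsilon> G) \<and>
     (\<forall>p\<in>el G. \<forall>q\<in>el G. \<exists>r\<in>el G. le P r p \<and> le P r q)"

definition LR_generic :: "'v \<Rightarrow> 'v \<Rightarrow> bool" where
  "LR_generic P G \<longleftrightarrow> is_filter P G \<and> (\<forall>D. LR D \<and> dense P D \<longrightarrow> (\<exists>p. p \<epsilon> G \<and> p \<epsilon> D))"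


(* r.o.(P): regular open sets in the topology on P whose open sets are the downward closed
   sets, ordered by inclusion. *)

definition open_in :: "'v \<Rightarrow> 'v \<Rightarrow> bool" where
  "open_in P u \<longleftrightarrow> el u \<subseteq> carrier P \<and> (\<forall>p\<in>el u. \<forall>q\<in>carrier P. le P q p \<longrightarrow> q \<epsilon> u)"

definition interior :: "'v \<Rightarrow> 'v \<Rightarrow> 'v" where
  "interior P a = setof {p \<in> carrier P. \<exists>u. open_in P u \<and> p \<epsilon> u \<and> el u \<subseteq> el a}"

definition closure :: "'v \<Rightarrow> 'v \<Rightarrow> 'v" where
  "closure P a = setof {p \<in> carrier P. \<forall>u. open_in P u \<and> p \<epsilon> u \<longrightarrow> el u \<inter> el a \<noteq> {}}"

definition regular_opens :: "'v \<Rightarrow> 'v" where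
  "regular_opens P = setof {u. el u \<subseteq> carrier P \<and> interior P (closure P u) = u}"

definition ro :: "'v \<Rightarrow> 'v" where
  "ro P = \<langle>regular_opens P,
           setof {\<langle>u, v\<rangle> | u v. u \<epsilon> regular_opens P \<and> v \<epsilon> regular_opens P \<and> el u \<subseteq> el v}\<rangle>"

(* Boolean algebras are given by their orders. *)

definition is_bot :: "'v \<Rightarrow> 'v \<Rightarrow> bool" where
  "is_bot B x \<longleftrightarrow> x \<in> carrier B \<and> (\<forall>y\<in>carrier B. le B x y)"

definition is_top :: "'v \<Rightarrow> 'v \<Rightarrow> bool" where
  "is_top B x \<longleftrightarrow> x \<in> carrier B \<and> (\<forall>y\<in>carrier B. le B y x)"

definition is_inf :: "'v \<Rightarrow> 'v \<Rightarrow> 'v \<Rightarrow> 'v \<Rightarrow> bool" where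
  "is_inf B x y z \<longleftrightarrow> z \<in> carrier B \<and> le B z x \<and> le B z y \<and>
     (\<forall>w\<in>carrier B. le B w x \<and> le B w y \<longrightarrow> le B w z)"

definition is_Sup :: "'v \<Rightarrow> 'v \<Rightarrow> 'v \<Rightarrow> bool" where
  "is_Sup B W z \<longleftrightarrow> z \<in> carrier B \<and> (\<forall>w\<in>el W. le B w z) \<and>
     (\<forall>u\<in>carrier B. (\<forall>w\<in>el W. le B w u) \<longrightarrow> le B z u)"

definition is_partition :: "'v \<Rightarrow> 'v \<Rightarrow> bool" where
  "is_partition B W \<longleftrightarrow> el W \<subseteq> carrier B \<and> (\<forall>x\<in>el W. \<not> is_bot B x) \<and>
     (\<forall>x\<in>el W. \<forall>y\<in>el W. x \<noteq> y \<longrightarrow> (\<exists>z. is_inf B x y z \<and> is_bot B z)) \<and>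
     (\<exists>z. is_Sup B W z \<and> is_top B z)"

definition refines :: "'v \<Rightarrow> 'v \<Rightarrow> 'v \<Rightarrow> bool" where
  "refines B V W \<longleftrightarrow> (\<forall>v\<in>el V. \<exists>w\<in>el W. le B v w)"

definition distributive :: "'v \<Rightarrow> 'v \<Rightarrow> 'v \<Rightarrow> bool" where
  "distributive \<kappa> \<mu> B \<longleftrightarrow>
     (\<forall>W. fun_on W \<kappa> \<and> (\<forall>i\<in>el \<kappa>. is_partition B (app W i) \<and> card_le (app W i) \<mu>) \<longrightarrow>
        (\<exists>V. is_partition B V \<and> (\<forall>i\<in>el \<kappa>. refines B V (app W i))))"


(* P-names are the hereditary sets of pairs \<langle>\<sigma>, p\<rangle> with \<sigma> a P-name and p in P. *)

definition name_closed :: "'v \<Rightarrow> 'v \<Rightarrow> bool" where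
  "name_closed P T \<longleftrightarrow>
     (\<forall>x\<in>el T. \<forall>z\<in>el x. \<exists>\<sigma>\<in>el T. \<exists>p\<in>carrier P. z = \<langle>\<sigma>, p\<rangle>)"

definition is_name :: "'v \<Rightarrow> 'v \<Rightarrow> bool" where
  "is_name P x \<longleftrightarrow> (\<exists>T. name_closed P T \<and> x \<epsilon> T)"

definition dense_below :: "'v \<Rightarrow> 'v \<Rightarrow> ('v \<Rightarrow> bool) \<Rightarrow> bool" where
  "dense_below P p D \<longleftrightarrow> (\<forall>q\<in>carrier P. le P q p \<longrightarrow> (\<exists>r\<in>carrier P. le P r q \<and> D r))"

(* The forcing relation for x = y is defined by recursion on names. In an arbitrary model
   the recursion has to be carried out inside the model: F is the set of all triples (p, x, y)
   with p forcing x = y for names x, y in T. *)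

definition eq_recursion :: "'v \<Rightarrow> 'v \<Rightarrow> 'v \<Rightarrow> bool" where
  "eq_recursion P T F \<longleftrightarrow> name_closed P T \<and>
     (\<forall>p\<in>carrier P. \<forall>x\<in>el T. \<forall>y\<in>el T.
        \<langle>p, \<langle>x, y\<rangle>\<rangle> \<epsilon> F \<longleftrightarrow>
          (\<forall>\<sigma> s. \<langle>\<sigma>, s\<rangle> \<epsilon> x \<longrightarrow> dense_below P p (\<lambda>q. le P q s \<longrightarrow>
             (\<exists>\<tau> t. \<langle>\<tau>, t\<rangle> \<epsilon> y \<and> le P q t \<and> \<langle>q, \<langle>\<sigma>, \<tau>\<rangle>\<rangle> \<epsilon> F))) \<and>
          (\<forall>\<tau> t. \<langle>\<tau>, t\<rangle> \<epsilon> y \<longrightarrow> dense_below P p (\<lambda>q. le P q t \<longrightarrow>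
             (\<exists>\<sigma> s. \<langle>\<sigma>, s\<rangle> \<epsilon> x \<and> le P q s \<and> \<langle>q, \<langle>\<sigma>, \<tau>\<rangle>\<rangle> \<epsilon> F))))"

definition forces_eq :: "'v \<Rightarrow> 'v \<Rightarrow> 'v \<Rightarrow> 'v \<Rightarrow> bool" where
  "forces_eq P p x y \<longleftrightarrow>
     (\<exists>T F. eq_recursion P T F \<and> x \<epsilon> T \<and> y \<epsilon> T \<and> \<langle>p, \<langle>x, y\<rangle>\<rangle> \<epsilon> F)"

definition forces_mem :: "'v \<Rightarrow> 'v \<Rightarrow> 'v \<Rightarrow> 'v \<Rightarrow> bool" where
  "forces_mem P p x y \<longleftrightarrow>
     dense_below P p (\<lambda>q. \<exists>\<tau> t. \<langle>\<tau>, t\<rangle> \<epsilon> y \<and> le P q t \<and> forces_eq P q x \<tau>)"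

primrec forces :: "'v \<Rightarrow> 'v \<Rightarrow> (nat \<Rightarrow> 'v) \<Rightarrow> fm \<Rightarrow> bool" where
  "forces P p \<rho> (Mem i j) \<longleftrightarrow> forces_mem P p (\<rho> i) (\<rho> j)"
| "forces P p \<rho> (Eq i j) \<longleftrightarrow> forces_eq P p (\<rho> i) (\<rho> j)"
| "forces P p \<rho> (Neg \<phi>) \<longleftrightarrow> (\<forall>q\<in>carrier P. le P q p \<longrightarrow> \<not> forces P q \<rho> \<phi>)"
| "forces P p \<rho> (Conj \<phi> \<psi>) \<longleftrightarrow> forces P p \<rho> \<phi> \<and> forces P p \<rho> \<psi>"
| "forces P p \<rho> (Forall \<phi>) \<longleftrightarrow> (\<forall>\<tau>. is_name P \<tau> \<longrightarrow> forces P p (case_nat \<tau> \<rho>) \<phi>)"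

(* The canonical name of x is { (canonical name of y, p) | y in x, p in P }; P need not
   have a largest element. *)

definition check_recursion :: "'v \<Rightarrow> 'v \<Rightarrow> 'v \<Rightarrow> bool" where
  "check_recursion P t f \<longleftrightarrow> transitive_set t \<and> fun_on f t \<and>
     (\<forall>x\<in>el t. app f x = setof {\<langle>app f y, p\<rangle> | y p. y \<epsilon> x \<and> p \<in> carrier P})"

definition check :: "'v \<Rightarrow> 'v \<Rightarrow> 'v" where
  "check P x = (THE c. \<exists>t f. check_recursion P t f \<and> x \<epsilon> t \<and> c = app f x)"

(* The formula says that variable 0 is the set of all subsets of variable 1. It is forced for
   the canonical names of the ground model reals and of omega; the latter denotes the omega
   of the extension. *)

definition no_new_reals :: "'v \<Rightarrow> bool" where
  "no_new_reals P \<longleftrightarrow> (\<forall>p\<in>carrier P.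
     forces P p (case_nat (check P reals) (\<lambda>_. check P omega))
       (Forall (Iff (Mem 0 1) (Forall (Imp (Mem 0 1) (Mem 0 3))))))"

definition IFS_LR :: bool where
  "IFS_LR \<longleftrightarrow> (\<forall>P. partial_order P \<and> definable_LR P \<and> no_new_reals P \<longrightarrow> (\<exists>G. LR_generic P G))"

end

end

theory Submission
  imports Defs
begin

text \<open>
  A partial order \<open>P\<close> adds no new reals if and only if \<open>r.o.(P)\<close> is \<open>(\<omega>, \<omega>)\<close>-distributive.
  If \<open>r.o.(P)\<close> is distributive and \<open>\<tau>\<close> is a name for a subset of \<open>\<omega>\<close>, then a common refinement of
  the partitions consisting of the truth values of \<open>n \<in> \<tau>\<close> and \<open>n \<notin> \<tau>\<close> provides densely many
  conditions that decide all of \<open>\<tau>\<close>. Conversely, given \<open>\<omega>\<close> many countable partitions, enumerate all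
  their members as \<open>b\<^sub>i\<close> with \<open>i \<in> \<omega>\<close>. The generic real \<open>{i. b\<^sub>i \<in> G}\<close> lies in the ground model, so
  densely many conditions decide it; such a condition lies in a member of each partition, and
  conditions making the same choices are collected to a member of the common refinement.

  The model need not be well-founded, so every set and every induction has to be obtained from
  the axioms inside it.
\<close>

section \<open>Definable relations\<close>

text \<open>The axiom schemas of the model speak about formulas only, whereas the arguments are
  written with HOL predicates. Every appeal to separation, replacement, choice or induction
  therefore has to show that the predicate involved is definable with parameters. The predicate
  \<open>definable\<close> is closed under the logical operations, so that \<open>intro\<close>
  discharges these obligations. Notions such as \<open>app\<close>, \<open>check\<close> and
  \<open>forces_eq\<close> do not fit this scheme directly; they are replaced by membership in a set
  that serves as a parameter, for instance a graph of canonical names or a solution of the recursion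
  for forced equality.

  No generic extension is formed. The generic real is present only through its name and through the
  conditions that decide it, and since implication is encoded by negations, its forced form yields
  conclusions at stronger conditions only. Countably many countable partitions have to become a
  single real; this is the reason for the choice of numberings and for the coding of pairs of
  natural numbers.\<close>

primrec ren :: "(nat \<Rightarrow> nat) \<Rightarrow> fm \<Rightarrow> fm" where
  "ren r (Mem i j) = Mem (r i) (r j)"
| "ren r (Eq i j) = Eq (r i) (r j)"
| "ren r (Neg \<phi>) = Neg (ren r \<phi>)"
| "ren r (Conj \<phi> \<psi>) = Conj (ren r \<phi>) (ren r \<psi>)"
| "ren r (Forall \<phi>) = Forall (ren (case_nat 0 (\<lambda>n. Suc (r n))) \<phi>)"

context set_structure
begin

lemma sat_ren: "sat C \<rho> (ren r \<phi>) \<longleftrightarrow> sat C (\<lambda>n. \<rho> (r n)) \<phi>"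
proof (induction \<phi> arbitrary: r \<rho>)
  case (Forall \<phi>)
  have "(\<lambda>n. case_nat x \<rho> (case_nat 0 (\<lambda>n. Suc (r n)) n)) = case_nat x (\<lambda>n. \<rho> (r n))" for x
    by (auto split: nat.split)
  then show ?case using Forall by simp
qed simp_all

text \<open>\<open>\<iota>\<close> interprets each index of the formula either as an argument or as a parameter.\<close>

definition definable :: "((nat \<Rightarrow> 'v) \<Rightarrow> bool) \<Rightarrow> bool" where
  "definable R \<longleftrightarrow>
     (\<exists>\<phi> \<iota>. \<forall>\<rho>. R \<rho> \<longleftrightarrow> sat (\<lambda>_. True) (\<lambda>n. case_sum \<rho> id (\<iota> n)) \<phi>)"

text \<open>Only the graph has to be definable, with the value at index 0. Substituting a term into
  a relation then amounts to one existential quantifier.\<close>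

definition definable_term :: "((nat \<Rightarrow> 'v) \<Rightarrow> 'v) \<Rightarrow> bool" where
  "definable_term t \<longleftrightarrow> definable (\<lambda>\<rho>. \<rho> 0 = t (\<lambda>n. \<rho> (Suc n)))"

lemma definableI:
  assumes "\<And>\<rho>. R \<rho> \<longleftrightarrow> sat (\<lambda>_. True) (\<lambda>n. case_sum \<rho> id (\<iota> n)) \<phi>"
  shows "definable R"
  unfolding definable_def using assms by blast

lemma definable_not: "definable R \<Longrightarrow> definable (\<lambda>\<rho>. \<not> R \<rho>)"
  unfolding definable_def by (metis sat.simps(3))

lemma definable_conj:
  assumes "definable R" "definable S"
  shows "definable (\<lambda>\<rho>. R \<rho> \<and> S \<rho>)"
proof -
  obtain \<phi> \<iota> where R: "\<And>\<rho>. R \<rho> \<longleftrightarrow> sat (\<lambda>_. True) (\<lambda>n. case_sum \<rho> id (\<iota> n)) \<phi>"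
    using assms(1) unfolding definable_def by auto
  obtain \<psi> \<kappa> where S: "\<And>\<rho>. S \<rho> \<longleftrightarrow> sat (\<lambda>_. True) (\<lambda>n. case_sum \<rho> id (\<kappa> n)) \<psi>"
    using assms(2) unfolding definable_def by auto
  show ?thesis
    \<comment> \<open>The two formulas interpret their indices independently; moving one to the even
      and the other to the odd indices lets a single interpretation serve both.\<close>
    by (rule definableI[where \<iota> = "\<lambda>n. if even n then \<iota> (n div 2) else \<kappa> (n div 2)"
          and \<phi> = "Conj (ren (\<lambda>n. 2 * n) \<phi>) (ren (\<lambda>n. Suc (2 * n)) \<psi>)"])
      (simp add: R S sat_ren)
qed

lemma definable_all:
  assumes "definable (\<lambda>\<rho>. R (\<rho> 0) (\<lambda>n. \<rho> (Suc n)))"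
  shows "definable (\<lambda>\<rho>. \<forall>x. R x \<rho>)"
proof -
  obtain \<phi> \<iota> where R: "\<And>\<rho>. R (\<rho> 0) (\<lambda>n. \<rho> (Suc n)) \<longleftrightarrow>
      sat (\<lambda>_. True) (\<lambda>n. case_sum \<rho> id (\<iota> n)) \<phi>"
    using assms unfolding definable_def by auto
  \<comment> \<open>Several indices may read argument 0, which is about to be bound; all of them
    become the bound variable. For these indices the value \<open>Inl 0\<close> of
    \<open>?\<kappa>\<close> is a dummy that is never read.\<close>
  let ?r = "\<lambda>n. if \<iota> n = Inl 0 then 0 else Suc n"
  let ?\<kappa> = "\<lambda>n. case \<iota> n of Inl 0 \<Rightarrow> Inl 0 | Inl (Suc i) \<Rightarrow> Inl i | Inr c \<Rightarrow> Inr c"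
  have eq: "(\<lambda>n. case_nat x (\<lambda>n. case_sum \<rho> id (?\<kappa> n)) (?r n)) =
      (\<lambda>n. case_sum (case_nat x \<rho>) id (\<iota> n))" for x \<rho>
    by (auto split: sum.split nat.split)
  have "R x \<rho> \<longleftrightarrow> sat (\<lambda>_. True) (case_nat x (\<lambda>n. case_sum \<rho> id (?\<kappa> n))) (ren ?r \<phi>)" for x \<rho>
    unfolding sat_ren eq using R[of "case_nat x \<rho>"] by simp
  then show ?thesis
    by (intro definableI[where \<iota> = ?\<kappa> and \<phi> = "Forall (ren ?r \<phi>)"]) simp
qed

text \<open>Acts on the interpretation alone and leaves the formula as it is. It supplies the
  weakening needed when a predicate is moved under a further quantifier.\<close>

lemma definable_reindex:
  assumes "definable R"
  shows "definable (\<lambda>\<rho>. R (\<lambda>n. \<rho> (r n)))"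
proof -
  obtain \<phi> \<iota> where R: "\<And>\<rho>. R \<rho> \<longleftrightarrow> sat (\<lambda>_. True) (\<lambda>n. case_sum \<rho> id (\<iota> n)) \<phi>"
    using assms unfolding definable_def by auto
  have eq: "case_sum (\<lambda>n. \<rho> (r n)) id s = case_sum \<rho> id (map_sum r id s)" for \<rho> and s :: "nat + 'v"
    by (cases s) auto
  show ?thesis
    by (rule definableI[where \<iota> = "\<lambda>n. map_sum r id (\<iota> n)" and \<phi> = \<phi>]) (simp add: R eq)
qed

lemma definable_imp: "definable R \<Longrightarrow> definable S \<Longrightarrow> definable (\<lambda>\<rho>. R \<rho> \<longrightarrow> S \<rho>)"
  using definable_not[OF definable_conj[OF _ definable_not[of S]], of R] by simp

lemma definable_disj: "definable R \<Longrightarrow> definable S \<Longrightarrow> definable (\<lambda>\<rho>. R \<rho> \<or> S \<rho>)"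
  using definable_imp[OF definable_not[of R], of S] by (simp add: disj_imp)

lemma definable_iff: "definable R \<Longrightarrow> definable S \<Longrightarrow> definable (\<lambda>\<rho>. R \<rho> \<longleftrightarrow> S \<rho>)"
  using definable_conj[OF definable_imp definable_imp, of R S S R] by (simp add: iff_conv_conj_imp)

lemma definable_ex:
  "definable (\<lambda>\<rho>. R (\<rho> 0) (\<lambda>n. \<rho> (Suc n))) \<Longrightarrow> definable (\<lambda>\<rho>. \<exists>x. R x \<rho>)"
  using definable_not[OF definable_all[of "\<lambda>x \<rho>. \<not> R x \<rho>"]] definable_not by auto

lemma definable_ex1:
  assumes "definable (\<lambda>\<rho>. R (\<rho> 0) (\<lambda>n. \<rho> (Suc n)))"
  shows "definable (\<lambda>\<rho>. \<exists>!x. R x \<rho>)"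
proof -
  have 1: "definable (\<lambda>\<rho>. R (\<rho> 0) (\<lambda>n. \<rho> (Suc (Suc n))))"
    using definable_reindex[OF assms, of "case_nat 0 (\<lambda>n. Suc (Suc n))"] by simp
  have 2: "definable (\<lambda>\<rho>. \<rho> 0 = \<rho> (Suc 0))"
    by (rule definableI[where \<iota> = Inl and \<phi> = "Eq 0 1"]) simp
  have "definable (\<lambda>\<rho>. \<exists>x. R x \<rho> \<and> (\<forall>y. R y \<rho> \<longrightarrow> y = x))"
    using 1 2 by (intro definable_ex definable_all definable_conj definable_imp assms) simp_all
  then show ?thesis
    by (simp add: Ex1_def)
qed

lemma definable_comp:
  assumes "definable (\<lambda>\<rho>. R (\<rho> 0) (\<lambda>n. \<rho> (Suc n)))" "definable_term t"
  shows "definable (\<lambda>\<rho>. R (t \<rho>) \<rho>)"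
proof -
  have "definable (\<lambda>\<rho>. \<exists>x. x = t \<rho> \<and> R x \<rho>)"
    using assms unfolding definable_term_def by (intro definable_ex definable_conj)
  then show ?thesis by simp
qed

lemma definable_term_shift: "definable_term t \<Longrightarrow> definable_term (\<lambda>\<rho>. t (\<lambda>n. \<rho> (Suc n)))"
  unfolding definable_term_def
  using definable_reindex[of "\<lambda>\<rho>. \<rho> 0 = t (\<lambda>n. \<rho> (Suc n))" "case_nat 0 (\<lambda>n. Suc (Suc n))"]
  by simp

lemma definable_comp2:
  assumes "definable (\<lambda>\<rho>. Q (\<rho> 0) (\<rho> (Suc 0)))" "definable_term t" "definable_term u"
  shows "definable (\<lambda>\<rho>. Q (t \<rho>) (u \<rho>))"
proof (rule definable_comp[OF _ assms(2)])
  have "definable (\<lambda>\<rho>. Q (\<rho> (Suc 0)) (\<rho> 0))"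
    using definable_reindex[OF assms(1), of "\<lambda>n. 1 - n"] by simp
  then show "definable (\<lambda>\<rho>. Q (\<rho> 0) (u (\<lambda>n. \<rho> (Suc n))))"
    using definable_comp[of "\<lambda>y \<rho>. Q (\<rho> 0) y", OF _ definable_term_shift[OF assms(3)]] by simp
qed

lemma definable_comp3:
  assumes "definable (\<lambda>\<rho>. Q (\<rho> 0) (\<rho> (Suc 0)) (\<rho> (Suc (Suc 0))))"
    "definable_term t" "definable_term u" "definable_term v"
  shows "definable (\<lambda>\<rho>. Q (t \<rho>) (u \<rho>) (v \<rho>))"
proof (rule definable_comp[OF _ assms(2)], rule definable_comp[OF _ definable_term_shift[OF assms(3)]])
  have "definable (\<lambda>\<rho>. Q (\<rho> (Suc (Suc 0))) (\<rho> (Suc 0)) (\<rho> 0))"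
    using definable_reindex[OF assms(1), of "\<lambda>n. Suc (Suc 0) - n"] by simp
  then show "definable (\<lambda>\<rho>. Q (\<rho> (Suc 0)) (\<rho> 0) (v (\<lambda>n. \<rho> (Suc (Suc n)))))"
    using definable_comp[of "\<lambda>y \<rho>. Q (\<rho> (Suc 0)) (\<rho> 0) y",
        OF _ definable_term_shift[OF definable_term_shift[OF assms(4)]]]
    by simp
qed

lemma definable_term_var: "definable_term (\<lambda>\<rho>. \<rho> n)"
  unfolding definable_term_def
  by (rule definableI[where \<iota> = Inl and \<phi> = "Eq 0 (Suc n)"]) simp

lemma definable_term_const: "definable_term (\<lambda>\<rho>. c)"
  unfolding definable_term_def
  by (rule definableI[where \<iota> = "case_nat (Inl 0) (\<lambda>_. Inr c)" and \<phi> = "Eq 0 1"]) simp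

lemma definable_mem:
  "definable_term t \<Longrightarrow> definable_term u \<Longrightarrow> definable (\<lambda>\<rho>. t \<rho> \<epsilon> u \<rho>)"
  by (rule definable_comp2[where Q = "\<lambda>x y. x \<epsilon> y"],
      rule definableI[where \<iota> = Inl and \<phi> = "Mem 0 1"]) simp_all

lemma definable_eq:
  "definable_term t \<Longrightarrow> definable_term u \<Longrightarrow> definable (\<lambda>\<rho>. t \<rho> = u \<rho>)"
  by (rule definable_comp2[where Q = "\<lambda>x y. x = y"],
      rule definableI[where \<iota> = Inl and \<phi> = "Eq 0 1"]) simp_all

lemma definable_fun1:
  assumes "definable (\<lambda>\<rho>. \<rho> 0 = f (\<rho> (Suc 0)))" "definable_term t"
  shows "definable_term (\<lambda>\<rho>. f (t \<rho>))"
  unfolding definable_term_def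
  by (rule definable_comp2[where Q = "\<lambda>x y. x = f y"])
    (simp_all add: assms definable_term_var definable_term_shift)

lemma definable_fun2:
  assumes "definable (\<lambda>\<rho>. \<rho> 0 = f (\<rho> (Suc 0)) (\<rho> (Suc (Suc 0))))" "definable_term t" "definable_term u"
  shows "definable_term (\<lambda>\<rho>. f (t \<rho>) (u \<rho>))"
  unfolding definable_term_def
  by (rule definable_comp3[where Q = "\<lambda>x y z. x = f y z"])
    (simp_all add: assms definable_term_var definable_term_shift)

lemma definable_ball_el:
  assumes "definable_term t" "definable (\<lambda>\<rho>. R (\<rho> 0) (\<lambda>n. \<rho> (Suc n)))"
  shows "definable (\<lambda>\<rho>. \<forall>x\<in>el (t \<rho>). R x \<rho>)"
proof -
  have "definable (\<lambda>\<rho>. \<forall>x. x \<epsilon> t \<rho> \<longrightarrow> R x \<rho>)"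
    by (intro definable_all definable_imp definable_mem definable_term_var
        definable_term_shift assms)
  then show ?thesis by simp
qed

lemma definable_bex_el:
  assumes "definable_term t" "definable (\<lambda>\<rho>. R (\<rho> 0) (\<lambda>n. \<rho> (Suc n)))"
  shows "definable (\<lambda>\<rho>. \<exists>x\<in>el (t \<rho>). R x \<rho>)"
proof -
  have "definable (\<lambda>\<rho>. \<exists>x. x \<epsilon> t \<rho> \<and> R x \<rho>)"
    by (intro definable_ex definable_conj definable_mem definable_term_var
        definable_term_shift assms)
  then show ?thesis by simp
qed

lemma definable_subset_el:
  assumes "definable_term t" "definable_term u"
  shows "definable (\<lambda>\<rho>. el (t \<rho>) \<subseteq> el (u \<rho>))"
proof -
  have "definable (\<lambda>\<rho>. \<forall>x\<in>el (t \<rho>). x \<epsilon> u \<rho>)"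
    by (intro definable_ball_el definable_mem definable_term_var
        definable_term_shift assms)
  then show ?thesis by (simp add: subset_eq)
qed

lemmas definable_intros =
  definable_not definable_conj definable_disj definable_imp definable_iff
  definable_all definable_ex definable_ex1 definable_ball_el definable_bex_el definable_subset_el
  definable_mem definable_eq definable_term_var definable_term_const

text \<open>Brings a definable relation into the shape of the axiom schemas, where the arguments
  occupy the indices 0 and 1 and the parameters come after them.\<close>

lemma definable_two_variables:
  assumes "definable (\<lambda>\<rho>. Q (\<rho> 0) (\<rho> (Suc 0)))"
  shows "\<exists>\<psi> \<sigma>. \<forall>x y. Q x y \<longleftrightarrow> sat (\<lambda>_. True) (case_nat x (case_nat y \<sigma>)) \<psi>"
proof -
  obtain \<phi> \<iota> where Q: "\<And>\<rho>. Q (\<rho> 0) (\<rho> (Suc 0)) \<longleftrightarrow> sat (\<lambda>_. True) (\<lambda>n. case_sum \<rho> id (\<iota> n)) \<phi>"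
    using assms unfolding definable_def by auto
  \<comment> \<open>An index that reads any argument beyond the first two receives
    \<open>undefined\<close> on both sides of \<open>eq\<close>. This is harmless because
    \<open>Q\<close> sees only the first two.\<close>
  define r where "r = (\<lambda>n. case \<iota> n of Inl 0 \<Rightarrow> 0 | Inl (Suc 0) \<Rightarrow> 1 | _ \<Rightarrow> Suc (Suc n))"
  define \<sigma> where "\<sigma> = (\<lambda>n. case \<iota> n of Inl i \<Rightarrow> undefined | Inr c \<Rightarrow> c)"
  have eq: "(\<lambda>n. case_nat x (case_nat y \<sigma>) (r n)) =
      (\<lambda>n. case_sum (case_nat x (case_nat y (\<lambda>_. undefined))) id (\<iota> n))" for x y
    by (auto simp: r_def \<sigma>_def split: sum.split nat.split)
  have "Q x y \<longleftrightarrow> sat (\<lambda>_. True) (case_nat x (case_nat y \<sigma>)) (ren r \<phi>)" for x y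
    unfolding sat_ren eq using Q[of "case_nat x (case_nat y (\<lambda>_. undefined))"] by simp
  then show ?thesis by blast
qed

end

section \<open>Set theory inside a model\<close>

locale zfc = set_structure mem for mem :: "'v \<Rightarrow> 'v \<Rightarrow> bool" (infix "\<epsilon>" 50) +
  assumes ZFC: ZFC
begin

text \<open>HOL sets over \<open>'v\<close> are classes of the model. Exactly for those with this
  property does \<open>setof\<close> return an element with the given extension.\<close>

definition isset :: "'v set \<Rightarrow> bool" where
  "isset A \<longleftrightarrow> (\<exists>a. el a = A)"

lemma extensionality: "el a = el b \<Longrightarrow> a = b"
proof -
  have "\<forall>a b. el a = el b \<longrightarrow> a = b"
    using ZFC unfolding ZFC_def by (elim conjE)
  then show "el a = el b \<Longrightarrow> a = b" by simp
qed

lemma extI: "(\<And>x. x \<epsilon> a \<longleftrightarrow> x \<epsilon> b) \<Longrightarrow> a = b"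
  by (rule extensionality, rule Collect_cong)

lemma el_setof:
  assumes "isset A" shows "el (setof A) = A"
proof -
  obtain a where "el a = A" using assms unfolding isset_def by auto
  then have "setof A = a"
    unfolding setof_def by (intro the_equality extensionality) simp_all
  then show ?thesis using \<open>el a = A\<close> by simp
qed

lemma mem_setof: "isset A \<Longrightarrow> x \<epsilon> setof A \<longleftrightarrow> x \<in> A"
  using el_setof by blast

lemma setof_el [simp]: "setof (el a) = a"
  by (rule extensionality) (rule el_setof, auto simp: isset_def)

lemma eq_setof_iff:
  assumes "isset A" shows "z = setof A \<longleftrightarrow> (\<forall>w. w \<epsilon> z \<longleftrightarrow> w \<in> A)"
proof
  show "z = setof A \<Longrightarrow> \<forall>w. w \<epsilon> z \<longleftrightarrow> w \<in> A" using mem_setof[OF assms] by simp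
  show "\<forall>w. w \<epsilon> z \<longleftrightarrow> w \<in> A \<Longrightarrow> z = setof A" by (intro extI) (simp add: mem_setof[OF assms])
qed

lemma issetE:
  assumes "isset A" obtains a where "\<And>x. x \<epsilon> a \<longleftrightarrow> x \<in> A"
  using assms unfolding isset_def by blast

lemma isset_el [simp, intro]: "isset (el a)"
  by (auto simp: isset_def)

text \<open>Applied to set comprehensions to obtain minimal counterexamples; it takes the place of
  well-founded induction, which an ill-founded model does not admit.\<close>

lemma foundation: "isset A \<Longrightarrow> A \<noteq> {} \<Longrightarrow> \<exists>x\<in>A. el x \<inter> A = {}"
proof -
  have "\<forall>a. el a \<noteq> {} \<longrightarrow> (\<exists>x\<in>el a. el x \<inter> el a = {})"
    using ZFC unfolding ZFC_def by (elim conjE)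
  then show "isset A \<Longrightarrow> A \<noteq> {} \<Longrightarrow> ?thesis" unfolding isset_def by metis
qed

lemma isset_pair [simp, intro]: "isset {a, b}"
proof -
  have "\<forall>a b. \<exists>c. el c = {a, b}"
    using ZFC unfolding ZFC_def by (elim conjE)
  then show ?thesis unfolding isset_def by blast
qed

lemma isset_singleton [simp, intro]: "isset {a}"
  using isset_pair[of a a] by simp

lemma isset_UN_el: "isset A \<Longrightarrow> isset (\<Union>y\<in>A. el y)"
proof -
  have "\<forall>a. \<exists>b. el b = (\<Union>y\<in>el a. el y)"
    using ZFC unfolding ZFC_def by (elim conjE)
  then show "isset A \<Longrightarrow> ?thesis" unfolding isset_def by metis
qed

lemma isset_Un [intro]:
  assumes "isset A" "isset B" shows "isset (A \<union> B)"
  using isset_UN_el[OF isset_pair[of "setof A" "setof B"]] assms by (simp add: el_setof)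

lemma isset_insert [intro]: "isset A \<Longrightarrow> isset (insert a A)"
  using isset_Un[of "{a}" A] by simp

lemma isset_Pow: "isset A \<Longrightarrow> isset {x. el x \<subseteq> A}"
proof -
  have "\<forall>a. \<exists>b. el b = {x. el x \<subseteq> el a}"
    using ZFC unfolding ZFC_def by (elim conjE)
  then show "isset A \<Longrightarrow> ?thesis" unfolding isset_def by metis
qed

lemma isset_sep:
  assumes "isset A" "definable (\<lambda>\<rho>. Q (\<rho> 0))"
  shows "isset {x \<in> A. Q x}"
proof -
  have *: "\<forall>\<phi> \<rho> a. \<exists>b. el b = {x \<in> el a. sat (\<lambda>_. True) (case_nat x \<rho>) \<phi>}"
    using ZFC unfolding ZFC_def by (elim conjE)
  obtain \<psi> \<sigma> where Q: "\<forall>x y. Q x \<longleftrightarrow> sat (\<lambda>_. True) (case_nat x (case_nat y \<sigma>)) \<psi>"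
    using definable_two_variables[of "\<lambda>x y. Q x"] assms(2) by auto
  obtain a where "A = el a" using assms(1) unfolding isset_def by auto
  then show ?thesis
    using *[rule_format, of a "case_nat undefined \<sigma>" \<psi>] Q unfolding isset_def by simp
qed

lemma isset_subset:
  assumes "isset A" "B \<subseteq> A" "definable (\<lambda>\<rho>. \<rho> 0 \<in> B)"
  shows "isset B"
proof -
  have "B = {x \<in> A. x \<in> B}" using assms by auto
  then show ?thesis using isset_sep[of A "\<lambda>x. x \<in> B"] assms by simp
qed

lemma isset_replacement:
  assumes "isset A" "definable (\<lambda>\<rho>. Q (\<rho> 0) (\<rho> (Suc 0)))" "\<And>x. x \<in> A \<Longrightarrow> \<exists>!y. Q x y"
  shows "isset {y. \<exists>x\<in>A. Q x y}"
proof -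
  have *: "\<forall>\<phi> \<rho> a. (\<forall>x\<in>el a. \<exists>!y. sat (\<lambda>_. True) (case_nat x (case_nat y \<rho>)) \<phi>) \<longrightarrow>
        (\<exists>b. \<forall>x\<in>el a. \<exists>y\<in>el b. sat (\<lambda>_. True) (case_nat x (case_nat y \<rho>)) \<phi>)"
    using ZFC unfolding ZFC_def by (elim conjE)
  obtain \<psi> \<sigma> where Q: "\<forall>x y. Q x y \<longleftrightarrow> sat (\<lambda>_. True) (case_nat x (case_nat y \<sigma>)) \<psi>"
    using definable_two_variables[OF assms(2)] by auto
  obtain a where a: "A = el a" using assms(1) unfolding isset_def by auto
  \<comment> \<open>The axiom provides only a set that contains the images; separation then cuts it
    down to the image itself.\<close>
  obtain b where b: "\<forall>x\<in>A. \<exists>y\<in>el b. Q x y"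
    using *[rule_format, of a \<sigma> \<psi>] Q assms(3) unfolding a by auto
  have "isset {y \<in> el b. \<exists>x\<in>el a. Q x y}"
    by (intro isset_sep isset_el definable_intros definable_comp2[OF assms(2)])
  also have "{y \<in> el b. \<exists>x\<in>el a. Q x y} = {y. \<exists>x\<in>A. Q x y}"
    using b assms(3) a by fast
  finally show ?thesis .
qed

section \<open>Pairs and products\<close>

lemma mem_upair [simp]: "z \<epsilon> upair x y \<longleftrightarrow> z = x \<or> z = y"
  by (simp add: upair_def mem_setof)

lemma upair_eq_iff: "z = upair x y \<longleftrightarrow> (\<forall>w. w \<epsilon> z \<longleftrightarrow> w = x \<or> w = y)"
  by (auto intro: extI)

lemma opair_inject [simp]: "\<langle>a, b\<rangle> = \<langle>c, d\<rangle> \<longleftrightarrow> a = c \<and> b = d"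
proof
  have inj: "upair x y = upair u v \<Longrightarrow> (x = u \<and> y = v) \<or> (x = v \<and> y = u)" for x y u v
    by (metis mem_upair)
  assume "\<langle>a, b\<rangle> = \<langle>c, d\<rangle>"
  then show "a = c \<and> b = d"
    unfolding opair_def using inj by metis
qed simp

lemma first_opair [simp]: "first \<langle>x, y\<rangle> = x"
  by (auto simp: first_def)

lemma second_opair [simp]: "second \<langle>x, y\<rangle> = y"
  by (auto simp: second_def)

lemma definable_upair:
  "definable_term t \<Longrightarrow> definable_term u \<Longrightarrow> definable_term (\<lambda>\<rho>. upair (t \<rho>) (u \<rho>))"
  by (rule definable_fun2) (simp_all only: upair_eq_iff, intro definable_intros)

lemma definable_opair:
  "definable_term t \<Longrightarrow> definable_term u \<Longrightarrow> definable_term (\<lambda>\<rho>. \<langle>t \<rho>, u \<rho>\<rangle>)"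
  unfolding opair_def by (intro definable_upair)

text \<open>A Kuratowski pair consists of subsets of \<open>A \<union> B\<close>, so all pairs lie
  in a double power set and separation applies.\<close>

lemma isset_Times:
  assumes "isset A" "isset B"
  shows "isset {\<langle>x, y\<rangle> | x y. x \<in> A \<and> y \<in> B}"
proof (rule isset_subset)
  obtain a b where ab: "A = el a" "B = el b" using assms unfolding isset_def by auto
  show "isset {z. el z \<subseteq> {x. el x \<subseteq> A \<union> B}}"
    by (intro isset_Pow isset_Un assms)
  show "{\<langle>x, y\<rangle> | x y. x \<in> A \<and> y \<in> B} \<subseteq> {z. el z \<subseteq> {x. el x \<subseteq> A \<union> B}}"
    by (auto simp: opair_def)
  show "definable (\<lambda>\<rho>. \<rho> 0 \<in> {\<langle>x, y\<rangle> | x y. x \<in> A \<and> y \<in> B})"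
    unfolding ab mem_Collect_eq by (intro definable_intros definable_opair)
qed

section \<open>The empty set, successors and the natural numbers of the model\<close>

lemma isset_empty [simp, intro]: "isset {}"
proof -
  have "isset {x \<in> {undefined}. x \<noteq> x}"
    by (intro isset_sep isset_singleton definable_intros)
  then show ?thesis by simp
qed

lemma not_mem_empty [simp]: "\<not> x \<epsilon> empty"
  by (simp add: empty_def mem_setof)

lemma eq_empty_iff: "a = empty \<longleftrightarrow> (\<forall>x. \<not> x \<epsilon> a)"
  by (auto intro: extI)

lemma mem_succ [simp]: "y \<epsilon> succ x \<longleftrightarrow> y = x \<or> y \<epsilon> x"
  by (simp add: succ_def mem_setof isset_insert)

lemma succ_eq_iff: "z = succ x \<longleftrightarrow> (\<forall>w. w \<epsilon> z \<longleftrightarrow> w = x \<or> w \<epsilon> x)"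
  by (auto intro: extI)

lemma definable_succ: "definable_term t \<Longrightarrow> definable_term (\<lambda>\<rho>. succ (t \<rho>))"
  by (rule definable_fun1) (simp_all only: succ_eq_iff, intro definable_intros)

lemma mem_irrefl [simp]: "\<not> x \<epsilon> x"
  using foundation[of "{x}"] by auto

lemma mem_asym: "x \<epsilon> y \<Longrightarrow> \<not> y \<epsilon> x"
  using foundation[of "{x, y}"] by auto

lemma succ_inject [simp]: "succ x = succ y \<longleftrightarrow> x = y"
  by (metis mem_asym mem_succ)

lemma succ_neq_empty [simp]: "succ x \<noteq> empty" "empty \<noteq> succ x"
  by (metis mem_succ not_mem_empty)+

lemma isset_omega: "isset {n. \<forall>a. succ_closed a \<longrightarrow> n \<epsilon> a}"
proof -
  have "\<exists>a. (\<exists>z\<in>el a. el z = {}) \<and> (\<forall>x\<in>el a. \<exists>y\<in>el a. el y = insert x (el x))"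
    using ZFC unfolding ZFC_def by (elim conjE)
  then obtain a where a: "\<exists>z\<in>el a. el z = {}" "\<forall>x\<in>el a. \<exists>y\<in>el a. el y = insert x (el x)"
    by (elim exE conjE) (rule that)
  obtain z where z: "z \<epsilon> a" "el z = {}"
    using a(1) by (elim bexE) (simp add: that)
  have "z = empty" using z(2) by (intro extI) auto
  moreover have "succ x \<epsilon> a" if "x \<epsilon> a" for x
  proof -
    have "\<exists>y\<in>el a. el y = insert x (el x)" by (rule bspec[OF a(2)]) (simp add: that)
    then obtain y where "y \<epsilon> a" "el y = insert x (el x)" by (elim bexE) simp
    moreover from this have "y = succ x" by (intro extI) auto
    ultimately show ?thesis by simp
  qed
  ultimately have "succ_closed a" using z(1) unfolding succ_closed_def by auto
  then show ?thesis
    unfolding succ_closed_def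
    by (intro isset_subset[OF isset_el[of a]])
      (auto intro!: definable_intros definable_succ simp del: Ball_Collect simp: mem_Collect_eq)
qed

lemma mem_omega: "n \<epsilon> omega \<longleftrightarrow> (\<forall>a. succ_closed a \<longrightarrow> n \<epsilon> a)"
  unfolding omega_def by (simp add: mem_setof isset_omega)

lemma empty_omega [simp]: "empty \<epsilon> omega"
  by (simp add: mem_omega succ_closed_def)

lemma succ_omega [simp]: "n \<epsilon> omega \<Longrightarrow> succ n \<epsilon> omega"
  by (simp add: mem_omega succ_closed_def)

text \<open>The natural numbers of the model may be nonstandard. Definability of \<open>Q\<close>
  turns its truth set inside \<open>omega\<close> into a set of the model, which is closed under
  successor and hence all of \<open>omega\<close>.\<close>

lemma omega_induct [consumes 1, case_names definable empty succ]:
  assumes "n \<epsilon> omega" "definable (\<lambda>\<rho>. Q (\<rho> 0))" "Q empty"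
    "\<And>n. n \<epsilon> omega \<Longrightarrow> Q n \<Longrightarrow> Q (succ n)"
  shows "Q n"
proof -
  have "isset {n \<in> el omega. Q n}" by (intro isset_sep isset_el assms)
  then obtain S where S: "\<And>n. n \<epsilon> S \<longleftrightarrow> n \<epsilon> omega \<and> Q n"
    unfolding isset_def by blast
  have "succ_closed S"
    unfolding succ_closed_def by (simp add: S assms)
  then have "n \<epsilon> S" using assms(1) by (simp add: mem_omega)
  then show ?thesis by (simp add: S)
qed

lemma omega_transitive: "n \<epsilon> omega \<Longrightarrow> m \<epsilon> n \<Longrightarrow> m \<epsilon> omega"
proof -
  assume "n \<epsilon> omega"
  then have "el n \<subseteq> el omega"
  proof (induction rule: omega_induct)
    case definable show ?case by (intro definable_intros)
  qed auto
  then show "m \<epsilon> n \<Longrightarrow> m \<epsilon> omega" by auto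
qed

lemma nat_transitive: "n \<epsilon> omega \<Longrightarrow> m \<epsilon> n \<Longrightarrow> k \<epsilon> m \<Longrightarrow> k \<epsilon> n"
proof -
  assume "n \<epsilon> omega"
  then have "\<forall>m\<in>el n. el m \<subseteq> el n"
  proof (induction rule: omega_induct)
    case definable show ?case by (intro definable_intros)
  qed auto
  then show "m \<epsilon> n \<Longrightarrow> k \<epsilon> m \<Longrightarrow> k \<epsilon> n" by auto
qed

lemma nat_cases: "n \<epsilon> omega \<Longrightarrow> n = empty \<or> (\<exists>m. m \<epsilon> omega \<and> n = succ m)"
proof (induction rule: omega_induct)
  case definable show ?case by (intro definable_intros definable_succ)
qed auto

lemma succ_mem_succ:
  assumes "m \<epsilon> omega" "n \<epsilon> m" shows "succ n \<epsilon> succ m"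
proof -
  have "\<forall>n\<in>el m. succ n \<epsilon> succ m"
    using assms(1)
  proof (induction rule: omega_induct)
    case definable show ?case by (intro definable_intros definable_succ)
  qed auto
  then show ?thesis using assms by simp
qed

lemma nat_linear:
  assumes "n \<epsilon> omega" "m \<epsilon> omega" shows "n \<epsilon> m \<or> n = m \<or> m \<epsilon> n"
proof -
  have 0: "k = empty \<or> empty \<epsilon> k" if "k \<epsilon> omega" for k
    using that
  proof (induction rule: omega_induct)
    case definable show ?case by (intro definable_intros)
  qed auto
  have "\<forall>m\<in>el omega. n \<epsilon> m \<or> n = m \<or> m \<epsilon> n"
    using assms(1)
  proof (induction rule: omega_induct)
    case definable show ?case by (intro definable_intros)
  next
    case empty show ?case using 0 by auto
  next
    case (succ n) then show ?case using succ_mem_succ by fastforce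
  qed
  then show ?thesis using assms by simp
qed

section \<open>Functions, reals and choice\<close>

lemma fun_onI:
  assumes "\<And>z. z \<epsilon> f \<Longrightarrow> \<exists>x y. z = \<langle>x, y\<rangle>" "\<And>x y. \<langle>x, y\<rangle> \<epsilon> f \<Longrightarrow> x \<epsilon> a"
    "\<And>x. x \<epsilon> a \<Longrightarrow> \<exists>!y. \<langle>x, y\<rangle> \<epsilon> f"
  shows "fun_on f a"
  unfolding fun_on_def
proof (intro conjI ballI)
  fix z assume "z \<in> el f"
  then obtain x y where "z = \<langle>x, y\<rangle>" using assms(1) by blast
  then show "\<exists>x\<in>el a. \<exists>y. z = \<langle>x, y\<rangle>" using assms(2) \<open>z \<in> el f\<close> by blast
qed (simp add: assms(3))

lemma fun_on_domain: "fun_on f a \<Longrightarrow> \<langle>x, y\<rangle> \<epsilon> f \<Longrightarrow> x \<epsilon> a"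
  unfolding fun_on_def by fastforce

lemma fun_on_ex1: "fun_on f a \<Longrightarrow> x \<epsilon> a \<Longrightarrow> \<exists>!y. \<langle>x, y\<rangle> \<epsilon> f"
  unfolding fun_on_def by simp

lemma fun_on_mem_iff:
  assumes "fun_on f a"
  shows "\<langle>x, y\<rangle> \<epsilon> f \<longleftrightarrow> x \<epsilon> a \<and> y = app f x"
proof (cases "x \<epsilon> a")
  case True
  then have ex1: "\<exists>!y. \<langle>x, y\<rangle> \<epsilon> f" using assms fun_on_ex1 by blast
  then have "\<langle>x, app f x\<rangle> \<epsilon> f" unfolding app_def by (rule theI')
  then show ?thesis using True ex1 by blast
next
  case False
  then show ?thesis using fun_on_domain[OF assms] by blast
qed

lemma app_eq: "fun_on f a \<Longrightarrow> x \<epsilon> a \<Longrightarrow> app f x = y \<longleftrightarrow> \<langle>x, y\<rangle> \<epsilon> f"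
  by (auto simp: fun_on_mem_iff)

text \<open>\<open>h\<close> is an arbitrary HOL function, and \<open>Q\<close> has to describe its
  graph only on \<open>a\<close> and within the bound \<open>B\<close>. The bound makes separation
  sufficient.\<close>

lemma ex_fun:
  assumes "isset B" "\<And>x. x \<epsilon> a \<Longrightarrow> h x \<in> B" "definable (\<lambda>\<rho>. Q (\<rho> 0) (\<rho> (Suc 0)))"
    "\<And>x y. x \<epsilon> a \<Longrightarrow> y \<in> B \<Longrightarrow> Q x y \<longleftrightarrow> y = h x"
  shows "\<exists>f. fun_on f a \<and> (\<forall>x\<in>el a. app f x = h x)"
proof -
  let ?F = "{z \<in> {\<langle>x, y\<rangle> | x y. x \<in> el a \<and> y \<in> B}. \<exists>x y. z = \<langle>x, y\<rangle> \<and> Q x y}"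
  have F: "isset ?F"
    by (intro isset_sep isset_Times isset_el assms(1) definable_intros definable_opair
        definable_comp2[OF assms(3)])
  then obtain f where "el f = ?F" unfolding isset_def by blast
  then have f: "z \<epsilon> f \<longleftrightarrow> (\<exists>x. x \<epsilon> a \<and> z = \<langle>x, h x\<rangle>)" for z
    using assms(2,4) by (auto simp: set_eq_iff)
  then have "fun_on f a"
    unfolding fun_on_def by auto
  then show ?thesis using app_eq f by auto
qed

lemma mem_reals: "x \<epsilon> reals \<longleftrightarrow> el x \<subseteq> el omega"
  unfolding reals_def powerset_def by (simp add: mem_setof isset_Pow)

text \<open>This set contains \<open>omega\<close>, \<open>reals\<close> and the elements of both;
  it is the domain over which canonical names are needed.\<close>

lemma transitive_succ_reals: "transitive_set (succ reals)"
  unfolding transitive_set_def by (auto simp: mem_reals intro: omega_transitive)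

lemma mem_succ_reals: "n \<epsilon> omega \<Longrightarrow> n \<epsilon> succ reals" "omega \<epsilon> succ reals"
  by (auto simp: mem_reals intro: omega_transitive)

lemma isset_range: "isset {c. \<exists>x. \<langle>x, c\<rangle> \<epsilon> f}"
proof (rule isset_subset)
  show "isset (\<Union>w\<in>(\<Union>z\<in>el f. el z). el w)" by (intro isset_UN_el isset_el)
  show "{c. \<exists>x. \<langle>x, c\<rangle> \<epsilon> f} \<subseteq> (\<Union>w\<in>(\<Union>z\<in>el f. el z). el w)"
  proof safe
    fix c x assume "\<langle>x, c\<rangle> \<epsilon> f"
    moreover have "upair x c \<epsilon> \<langle>x, c\<rangle>" "c \<epsilon> upair x c" by (simp_all add: opair_def)
    ultimately show "c \<in> (\<Union>w\<in>(\<Union>z\<in>el f. el z). el w)" by blast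
  qed
  show "definable (\<lambda>\<rho>. \<rho> 0 \<in> {c. \<exists>x. \<langle>x, c\<rangle> \<epsilon> f})"
    unfolding mem_Collect_eq by (intro definable_intros definable_opair)
qed

text \<open>The axiom of choice selects from disjoint families. Tagging the candidates for
  \<open>x\<close> with \<open>x\<close> itself makes the fibres disjoint, and the selected pair
  reveals the chosen value.\<close>

lemma choice_function:
  assumes B: "isset B" and Q: "definable (\<lambda>\<rho>. Q (\<rho> 0) (\<rho> (Suc 0)))"
    and ex: "\<And>x. x \<epsilon> a \<Longrightarrow> \<exists>y\<in>B. Q x y"
  shows "\<exists>f. fun_on f a \<and> (\<forall>x\<in>el a. Q x (app f x))"
proof -
  obtain b where b: "el b = B" using B unfolding isset_def by (elim exE)
  define fibre where "fibre Y x \<longleftrightarrow> (\<forall>z. z \<epsilon> Y \<longleftrightarrow> (\<exists>y\<in>el b. z = \<langle>x, y\<rangle> \<and> Q x y))" for Y x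
  define K where "K = {\<langle>x, y\<rangle> | x y. x \<in> el a \<and> y \<in> el b}"
  have K: "isset K" unfolding K_def by (intro isset_Times isset_el)
  have "isset {Y \<in> {Y. el Y \<subseteq> K}. \<exists>x\<in>el a. fibre Y x}"
    unfolding fibre_def
    by (intro isset_sep isset_Pow K definable_intros definable_opair definable_comp2[OF Q])
  moreover have "el Y \<subseteq> K" if "x \<in> el a" "fibre Y x" for x Y
    using that unfolding fibre_def K_def by blast
  then have "{Y \<in> {Y. el Y \<subseteq> K}. \<exists>x\<in>el a. fibre Y x} = {Y. \<exists>x\<in>el a. fibre Y x}"
    by blast
  ultimately obtain S where "el S = {Y. \<exists>x\<in>el a. fibre Y x}"
    unfolding isset_def by auto
  then have S: "Y \<epsilon> S \<longleftrightarrow> (\<exists>x. x \<epsilon> a \<and> fibre Y x)" for Y by blast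
  have AC: "\<forall>a. (\<forall>x\<in>el a. el x \<noteq> {}) \<and> (\<forall>x\<in>el a. \<forall>y\<in>el a. x \<noteq> y \<longrightarrow> el x \<inter> el y = {}) \<longrightarrow>
        (\<exists>c. \<forall>x\<in>el a. \<exists>!y. y \<in> el c \<inter> el x)"
    using ZFC unfolding ZFC_def by (elim conjE)
  have ne: "el Y \<noteq> {}" if YS: "Y \<in> el S" for Y
  proof -
    obtain x where x: "x \<epsilon> a" "fibre Y x" using YS S by blast
    then obtain y where "y \<epsilon> b" "Q x y" using ex b by blast
    then have "\<langle>x, y\<rangle> \<epsilon> Y" using x(2) unfolding fibre_def by blast
    then show ?thesis by blast
  qed
  have disj: "el Y \<inter> el Y' = {}" if YY': "Y \<in> el S" "Y' \<in> el S" "Y \<noteq> Y'" for Y Y'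
  proof (rule ccontr)
    obtain x x' where x: "fibre Y x" "fibre Y' x'" using YY' S by blast
    assume "el Y \<inter> el Y' \<noteq> {}"
    then obtain z where "z \<epsilon> Y" "z \<epsilon> Y'" by blast
    then have "x = x'" using x unfolding fibre_def by (metis opair_inject)
    then have "Y = Y'" using x unfolding fibre_def by (intro extI) simp
    then show False using YY' by blast
  qed
  obtain c where c: "\<forall>Y\<in>el S. \<exists>!z. z \<in> el c \<inter> el Y"
    using AC[rule_format, of S] ne disj by blast
  \<comment> \<open>The pairs over \<open>x\<close> that satisfy \<open>Q\<close> form one fibre,
    which \<open>c\<close> meets exactly once. Hence the choice becomes definable with parameter
    \<open>c\<close>.\<close>
  have uniq: "\<exists>!y. y \<epsilon> b \<and> Q x y \<and> \<langle>x, y\<rangle> \<epsilon> c" if "x \<epsilon> a" for x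
  proof -
    have "isset {z \<in> K. \<exists>y\<in>el b. z = \<langle>x, y\<rangle> \<and> Q x y}"
      by (intro isset_sep K definable_intros definable_opair definable_comp2[OF Q])
    moreover have "{z \<in> K. \<exists>y\<in>el b. z = \<langle>x, y\<rangle> \<and> Q x y} = {z. \<exists>y\<in>el b. z = \<langle>x, y\<rangle> \<and> Q x y}"
      using \<open>x \<epsilon> a\<close> unfolding K_def by blast
    ultimately obtain Y where "el Y = {z. \<exists>y\<in>el b. z = \<langle>x, y\<rangle> \<and> Q x y}"
      unfolding isset_def by auto
    then have Y: "z \<epsilon> Y \<longleftrightarrow> (\<exists>y\<in>el b. z = \<langle>x, y\<rangle> \<and> Q x y)" for z by blast
    then have "fibre Y x" unfolding fibre_def by blast
    then have "Y \<in> el S" using S that by blast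
    then obtain z where z: "z \<epsilon> c" "z \<epsilon> Y" "\<And>z'. z' \<epsilon> c \<Longrightarrow> z' \<epsilon> Y \<Longrightarrow> z' = z"
      using c by blast
    then obtain y where y: "y \<epsilon> b" "Q x y" "z = \<langle>x, y\<rangle>" using Y by blast
    show ?thesis
    proof (rule ex1I[of _ y])
      show "y \<epsilon> b \<and> Q x y \<and> \<langle>x, y\<rangle> \<epsilon> c" using y z by blast
      fix y' assume "y' \<epsilon> b \<and> Q x y' \<and> \<langle>x, y'\<rangle> \<epsilon> c"
      then have "\<langle>x, y'\<rangle> = z" using z(3)[of "\<langle>x, y'\<rangle>"] Y by blast
      then show "y' = y" using y by simp
    qed
  qed
  define h where "h x = (THE y. y \<epsilon> b \<and> Q x y \<and> \<langle>x, y\<rangle> \<epsilon> c)" for x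
  have h: "h x \<epsilon> b \<and> Q x (h x) \<and> \<langle>x, h x\<rangle> \<epsilon> c" if "x \<epsilon> a" for x
    unfolding h_def by (rule theI'[OF uniq[OF that]])
  have "\<exists>f. fun_on f a \<and> (\<forall>x\<in>el a. app f x = h x)"
  proof (rule ex_fun[OF B])
    show "definable (\<lambda>\<rho>. Q (\<rho> 0) (\<rho> (Suc 0)) \<and> \<langle>\<rho> 0, \<rho> (Suc 0)\<rangle> \<epsilon> c)"
      by (intro definable_intros Q definable_opair)
  qed (use h b uniq in blast)+
  then show ?thesis using h by auto
qed

lemma card_le_omega_pair:
  assumes "el a \<subseteq> {u, v}"
  shows "card_le a omega"
proof -
  let ?h = "\<lambda>x. if x = u then empty else succ empty"
  have "\<exists>f. fun_on f a \<and> (\<forall>x\<in>el a. app f x = ?h x)"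
  proof (rule ex_fun)
    show "isset (el omega)" by (rule isset_el)
    show "definable (\<lambda>\<rho>. \<rho> 0 = u \<and> \<rho> (Suc 0) = empty \<or> \<rho> 0 \<noteq> u \<and> \<rho> (Suc 0) = succ empty)"
      by (intro definable_intros definable_succ)
  qed auto
  then obtain f where "fun_on f a" "\<forall>x\<in>el a. app f x = ?h x" by blast
  then show ?thesis
    unfolding card_le_def using assms by (intro exI[of _ f]) (auto simp: inj_on_def)
qed

subsection \<open>An enumeration of pairs of natural numbers\<close>

text \<open>The walk runs through the squares \<open>{0..m} \<times> {0..m}\<close> by traversing the row \<open>(0, m), \<dots>, (m, m)\<close> and
  then the column \<open>(m + 1, 0), \<dots>, (m + 1, m)\<close>. Unlike the usual pairing functions, it is described
  without arithmetic.\<close>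

definition walk_step :: "'v \<Rightarrow> 'v \<Rightarrow> 'v \<Rightarrow> 'v \<Rightarrow> bool" where
  "walk_step n m n' m' \<longleftrightarrow>
     n \<epsilon> m \<and> n' = succ n \<and> m' = m \<or>
     n = m \<and> n' = succ n \<and> m' = empty \<or>
     m \<epsilon> n \<and> succ m \<noteq> n \<and> n' = n \<and> m' = succ m \<or>
     succ m = n \<and> n' = empty \<and> m' = n"

lemma walk_step_functional:
  "walk_step n m a b \<Longrightarrow> walk_step n m c d \<Longrightarrow> a = c \<and> b = d"
  unfolding walk_step_def using mem_asym mem_irrefl mem_succ by metis

lemma walk_step_omega:
  "walk_step n m a b \<Longrightarrow> n \<epsilon> omega \<Longrightarrow> m \<epsilon> omega \<Longrightarrow> a \<epsilon> omega \<and> b \<epsilon> omega"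
  unfolding walk_step_def by auto

text \<open>The walk is the least set that contains the start and is closed under steps, obtained as
  an intersection. Minimality yields inversion, and inversion yields determinism by induction on the
  time \<open>i\<close>.\<close>

lemma ex_walk:
  "\<exists>Z. (\<forall>i n m n' m'. \<langle>i, \<langle>n, m\<rangle>\<rangle> \<epsilon> Z \<longrightarrow> \<langle>i, \<langle>n', m'\<rangle>\<rangle> \<epsilon> Z \<longrightarrow> n = n' \<and> m = m') \<and>
       (\<forall>i n m. \<langle>i, \<langle>n, m\<rangle>\<rangle> \<epsilon> Z \<longrightarrow> i \<epsilon> omega \<and> n \<epsilon> omega \<and> m \<epsilon> omega) \<and>
       \<langle>empty, \<langle>empty, empty\<rangle>\<rangle> \<epsilon> Z \<and>
       (\<forall>i n m n' m'. \<langle>i, \<langle>n, m\<rangle>\<rangle> \<epsilon> Z \<longrightarrow> walk_step n m n' m' \<longrightarrow> \<langle>succ i, \<langle>n', m'\<rangle>\<rangle> \<epsilon> Z)"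
proof -
  define K where "K = {\<langle>i, p\<rangle> | i p. i \<in> el omega \<and>
    p \<in> {\<langle>n, m\<rangle> | n m. n \<in> el omega \<and> m \<in> el omega}}"
  have K: "isset K" unfolding K_def by (intro isset_Times isset_el)
  have memK: "\<langle>i, \<langle>n, m\<rangle>\<rangle> \<in> K \<longleftrightarrow> i \<epsilon> omega \<and> n \<epsilon> omega \<and> m \<epsilon> omega" for i n m
    unfolding K_def by simp
  define closed where "closed Y \<longleftrightarrow> \<langle>empty, \<langle>empty, empty\<rangle>\<rangle> \<epsilon> Y \<and>
    (\<forall>i n m n' m'. i \<epsilon> omega \<longrightarrow> n \<epsilon> omega \<longrightarrow> m \<epsilon> omega \<longrightarrow>
       \<langle>i, \<langle>n, m\<rangle>\<rangle> \<epsilon> Y \<longrightarrow> walk_step n m n' m' \<longrightarrow> \<langle>succ i, \<langle>n', m'\<rangle>\<rangle> \<epsilon> Y)" for Y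
  have "isset {z \<in> K. \<forall>Y. closed Y \<longrightarrow> z \<epsilon> Y}"
    unfolding closed_def walk_step_def
    by (intro isset_sep K definable_intros definable_opair definable_succ)
  then obtain Z where "el Z = {z \<in> K. \<forall>Y. closed Y \<longrightarrow> z \<epsilon> Y}"
    unfolding isset_def by blast
  then have Z: "z \<epsilon> Z \<longleftrightarrow> z \<in> K \<and> (\<forall>Y. closed Y \<longrightarrow> z \<epsilon> Y)" for z by blast
  have start: "\<langle>empty, \<langle>empty, empty\<rangle>\<rangle> \<epsilon> Z"
    unfolding Z memK by (simp add: closed_def)
  have step: "\<langle>succ i, \<langle>n', m'\<rangle>\<rangle> \<epsilon> Z" if "\<langle>i, \<langle>n, m\<rangle>\<rangle> \<epsilon> Z" "walk_step n m n' m'" for i n m n' m'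
  proof -
    have "i \<epsilon> omega" "n \<epsilon> omega" "m \<epsilon> omega" using that unfolding Z memK by auto
    moreover from this have "n' \<epsilon> omega" "m' \<epsilon> omega" using walk_step_omega that by blast+
    ultimately show ?thesis
      using that unfolding Z memK closed_def by auto
  qed
  have min: "z \<epsilon> Y" if "closed Y" "z \<epsilon> Z" for z Y using that Z by blast
  have inv: "i = empty \<and> n = empty \<and> m = empty \<or>
      (\<exists>j k l. i = succ j \<and> \<langle>j, \<langle>k, l\<rangle>\<rangle> \<epsilon> Z \<and> walk_step k l n m)" if "\<langle>i, \<langle>n, m\<rangle>\<rangle> \<epsilon> Z" for i n m
  proof -
    let ?Q = "\<lambda>z. \<exists>i n m. z = \<langle>i, \<langle>n, m\<rangle>\<rangle> \<and> (i = empty \<and> n = empty \<and> m = empty \<or>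
      (\<exists>j k l. i = succ j \<and> \<langle>j, \<langle>k, l\<rangle>\<rangle> \<epsilon> Z \<and> walk_step k l n m))"
    have "isset {z \<in> el Z. ?Q z}"
      unfolding walk_step_def
      by (intro isset_sep isset_el definable_intros definable_opair definable_succ)
    then obtain Y where "el Y = {z \<in> el Z. ?Q z}" unfolding isset_def by blast
    then have Y: "z \<epsilon> Y \<longleftrightarrow> z \<epsilon> Z \<and> ?Q z" for z by blast
    \<comment> \<open>The start and the elements with a predecessor form a closed set, so by
      minimality nothing else is in \<open>Z\<close>.\<close>
    have "closed Y"
      unfolding closed_def Y using start step by (metis opair_inject)
    then have "\<langle>i, \<langle>n, m\<rangle>\<rangle> \<epsilon> Y" using that min by blast
    then show ?thesis unfolding Y by simp
  qed
  have "\<forall>n m n' m'. \<langle>i, \<langle>n, m\<rangle>\<rangle> \<epsilon> Z \<longrightarrow> \<langle>i, \<langle>n', m'\<rangle>\<rangle> \<epsilon> Z \<longrightarrow> n = n' \<and> m = m'"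
    if "i \<epsilon> omega" for i
    using that
  proof (induction rule: omega_induct)
    case definable show ?case by (intro definable_intros definable_opair)
  next
    case empty show ?case using inv by (metis succ_neq_empty(1))
  next
    case (succ i)
    show ?case
    proof (intro allI impI)
      fix n m n' m'
      assume "\<langle>succ i, \<langle>n, m\<rangle>\<rangle> \<epsilon> Z" "\<langle>succ i, \<langle>n', m'\<rangle>\<rangle> \<epsilon> Z"
      then obtain k l k' l' where *: "\<langle>i, \<langle>k, l\<rangle>\<rangle> \<epsilon> Z" "walk_step k l n m"
          "\<langle>i, \<langle>k', l'\<rangle>\<rangle> \<epsilon> Z" "walk_step k' l' n' m'"
        using inv by (metis succ_neq_empty(1) succ_inject)
      then have "k = k' \<and> l = l'" using succ.IH by blast
      then show "n = n' \<and> m = m'" using * walk_step_functional by blast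
    qed
  qed
  moreover have "i \<epsilon> omega \<and> n \<epsilon> omega \<and> m \<epsilon> omega" if "\<langle>i, \<langle>n, m\<rangle>\<rangle> \<epsilon> Z" for i n m
    using that unfolding Z memK by simp
  ultimately show ?thesis using start step by (intro exI[of _ Z]) blast
qed

text \<open>Each index codes at most one pair because the walk is deterministic. Every pair is coded
  because the walk, once at the start of row \<open>m\<close>, completes this row and the column of
  \<open>succ m\<close>.\<close>

lemma ex_enumeration_of_pairs:
  "\<exists>Z. (\<forall>i n m n' m'. \<langle>i, \<langle>n, m\<rangle>\<rangle> \<epsilon> Z \<longrightarrow> \<langle>i, \<langle>n', m'\<rangle>\<rangle> \<epsilon> Z \<longrightarrow> n = n' \<and> m = m') \<and>
       (\<forall>n\<in>el omega. \<forall>m\<in>el omega. \<exists>i\<in>el omega. \<langle>i, \<langle>n, m\<rangle>\<rangle> \<epsilon> Z)"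
proof -
  obtain Z where fnl: "\<forall>i n m n' m'. \<langle>i, \<langle>n, m\<rangle>\<rangle> \<epsilon> Z \<longrightarrow> \<langle>i, \<langle>n', m'\<rangle>\<rangle> \<epsilon> Z \<longrightarrow> n = n' \<and> m = m'"
    and Zomega: "\<And>i n m. \<langle>i, \<langle>n, m\<rangle>\<rangle> \<epsilon> Z \<Longrightarrow> i \<epsilon> omega \<and> n \<epsilon> omega \<and> m \<epsilon> omega"
    and start: "\<langle>empty, \<langle>empty, empty\<rangle>\<rangle> \<epsilon> Z"
    and step: "\<And>i n m n' m'. \<langle>i, \<langle>n, m\<rangle>\<rangle> \<epsilon> Z \<Longrightarrow> walk_step n m n' m' \<Longrightarrow> \<langle>succ i, \<langle>n', m'\<rangle>\<rangle> \<epsilon> Z"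
    using ex_walk by (elim exE conjE) (rule that, blast+)
  define reached where "reached n m \<longleftrightarrow> (\<exists>i. \<langle>i, \<langle>n, m\<rangle>\<rangle> \<epsilon> Z)" for n m
  have r_step: "reached n m \<Longrightarrow> walk_step n m n' m' \<Longrightarrow> reached n' m'" for n m n' m'
    unfolding reached_def using step by blast
  have row: "\<forall>n\<in>el omega. n \<epsilon> succ m \<longrightarrow> reached n m" if m: "m \<epsilon> omega" "reached empty m" for m
  proof safe
    fix n assume "n \<epsilon> omega" "n \<epsilon> succ m"
    from \<open>n \<epsilon> omega\<close> have "n \<epsilon> succ m \<longrightarrow> reached n m"
    proof (induction rule: omega_induct)
      case definable show ?case unfolding reached_def by (intro definable_intros definable_opair)
    next
      case empty show ?case using m by simp
    next
      case (succ n)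
      have "reached (succ n) m" if "succ n \<epsilon> succ m"
      proof -
        have "n \<epsilon> m" using that m(1) nat_transitive by (metis mem_succ)
        then show ?thesis
          using r_step succ.IH unfolding walk_step_def by auto
      qed
      then show ?case by simp
    qed
    then show "reached n m" using \<open>n \<epsilon> succ m\<close> by blast
  qed
  have column: "\<forall>n\<in>el omega. n \<epsilon> succ m \<longrightarrow> reached (succ m) n"
    if m: "m \<epsilon> omega" "reached empty m" for m
  proof safe
    fix n assume "n \<epsilon> omega" "n \<epsilon> succ m"
    from \<open>n \<epsilon> omega\<close> have "n \<epsilon> succ m \<longrightarrow> reached (succ m) n"
    proof (induction rule: omega_induct)
      case definable show ?case unfolding reached_def by (intro definable_intros definable_opair)
    next
      case empty
      have "reached m m" using row[OF m] m(1) by simp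
      then show ?case using r_step unfolding walk_step_def by auto
    next
      case (succ n)
      have "reached (succ m) (succ n)" if "succ n \<epsilon> succ m"
      proof -
        have "n \<epsilon> succ m" using nat_transitive[OF succ_omega[OF m(1)] that] by simp
        moreover have "succ n \<noteq> succ m" using that mem_irrefl by metis
        ultimately show ?thesis
          using r_step succ.IH unfolding walk_step_def by blast
      qed
      then show ?case by simp
    qed
    then show "reached (succ m) n" using \<open>n \<epsilon> succ m\<close> by blast
  qed
  have bottom: "reached empty m" if "m \<epsilon> omega" for m
    using that
  proof (induction rule: omega_induct)
    case definable show ?case unfolding reached_def by (intro definable_intros definable_opair)
  next
    case empty show ?case using start reached_def by blast
  next
    case (succ m)
    \<comment> \<open>The column of \<open>succ m\<close> ends here, and the next step leads to the
      start of the following row.\<close>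
    then have "reached (succ m) m" using column[of m] by simp
    then show ?case using r_step unfolding walk_step_def by blast
  qed
  have "reached n m" if nm: "n \<epsilon> omega" "m \<epsilon> omega" for n m
  \<comment> \<open>A pair with \<open>n\<close> at most \<open>m\<close> lies in row
    \<open>m\<close>; any other has \<open>n = succ k\<close> with \<open>m\<close> at most
    \<open>k\<close> and lies in the column of \<open>n\<close>.\<close>
  proof (cases "n \<epsilon> succ m")
    case True
    then show ?thesis using row[OF nm(2) bottom[OF nm(2)]] nm(1) by blast
  next
    case False
    then have "m \<epsilon> n" using nat_linear nm by auto
    then obtain k where "k \<epsilon> omega" "n = succ k" using nat_cases[OF nm(1)] by auto
    then show ?thesis using column[of k] bottom[of k] \<open>m \<epsilon> n\<close> nm(2) by blast
  qed
  then show ?thesis using fnl Zomega unfolding reached_def by (metis mem_Collect_eq)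
qed

end

section \<open>Forcing\<close>

locale forcing_order = zfc +
  fixes P
  assumes partial_order: "partial_order P"
begin

abbreviation cond :: "'a set" where "cond \<equiv> carrier P"

abbreviation stronger :: "'a \<Rightarrow> 'a \<Rightarrow> bool" (infix "\<preceq>" 50) where "p \<preceq> q \<equiv> le P p q"

lemma stronger_refl [simp]: "p \<epsilon> first P \<Longrightarrow> p \<preceq> p"
  using partial_order unfolding partial_order_def by blast

lemma stronger_trans: "p \<preceq> q \<Longrightarrow> q \<preceq> r \<Longrightarrow> p \<preceq> r"
  using partial_order unfolding partial_order_def le_def
  by (metis mem_Collect_eq opair_inject)

lemma stronger_cond: "p \<preceq> q \<Longrightarrow> p \<epsilon> first P" "p \<preceq> q \<Longrightarrow> q \<epsilon> first P"
  using partial_order unfolding partial_order_def le_def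
  by (metis mem_Collect_eq opair_inject)+

lemma definable_stronger:
  "definable_term t \<Longrightarrow> definable_term u \<Longrightarrow> definable (\<lambda>\<rho>. t \<rho> \<preceq> u \<rho>)"
  unfolding le_def by (intro definable_intros definable_opair)

lemma dense_below_iff: "dense_below P p D \<longleftrightarrow> (\<forall>q. q \<preceq> p \<longrightarrow> (\<exists>r. r \<preceq> q \<and> D r))"
  unfolding dense_below_def using stronger_cond by blast

text \<open>The property passed to \<open>dense_below\<close> is a HOL function, so the substitution
  rules do not cover it. Unfolding yields two quantifiers: the condition tested by \<open>D\<close>
  is at index 0, and one more condition precedes the parameters.\<close>

lemma definable_dense_below:
  assumes "definable_term t" "definable (\<lambda>\<rho>. D (\<rho> 0) (\<lambda>n. \<rho> (Suc n)))"
  shows "definable (\<lambda>\<rho>. dense_below P (t \<rho>) (\<lambda>q. D q \<rho>))"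
proof -
  have "definable (\<lambda>\<rho>. D (\<rho> 0) (\<lambda>n. \<rho> (Suc (Suc n))))"
    using definable_reindex[OF assms(2), of "case_nat 0 (\<lambda>n. Suc (Suc n))"] by simp
  then show ?thesis
    unfolding dense_below_iff
    by (intro definable_intros definable_stronger definable_term_shift assms)
qed

lemma dense_below_stronger: "dense_below P p D \<Longrightarrow> q \<preceq> p \<Longrightarrow> dense_below P q D"
  unfolding dense_below_iff using stronger_trans by blast

lemma dense_below_idem:
  assumes "p \<epsilon> first P"
  shows "dense_below P p (\<lambda>q. dense_below P q D) \<longleftrightarrow> dense_below P p D"
  unfolding dense_below_iff using stronger_trans stronger_refl stronger_cond by meson

subsection \<open>Regular open sets and partitions\<close>

text \<open>The interior of the closure of \<open>U\<close> consists of the conditions below which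
  \<open>U\<close> is dense, so the equivalence expresses that \<open>U\<close> is its own
  regularisation. Downward closure is a consequence of it.\<close>

definition regular_open :: "'a set \<Rightarrow> bool" where
  "regular_open U \<longleftrightarrow> U \<subseteq> cond \<and> (\<forall>p\<in>cond. p \<in> U \<longleftrightarrow> dense_below P p (\<lambda>q. q \<in> U))"

lemma regular_openI:
  assumes "U \<subseteq> cond" "\<And>p q. p \<in> U \<Longrightarrow> q \<preceq> p \<Longrightarrow> q \<in> U"
    "\<And>p. p \<in> cond \<Longrightarrow> dense_below P p (\<lambda>q. q \<in> U) \<Longrightarrow> p \<in> U"
  shows "regular_open U"
  unfolding regular_open_def using assms
  by (metis dense_below_iff mem_Collect_eq stronger_cond(1) stronger_refl)

text \<open>The regularisation of an arbitrary property of conditions. The truth value of a forced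
  membership has this form.\<close>

lemma regular_open_dense_below:
  "regular_open {p \<in> cond. dense_below P p D}"
proof -
  have "dense_below P p (\<lambda>q. q \<in> {p \<in> cond. dense_below P p D}) \<longleftrightarrow>
      dense_below P p (\<lambda>q. dense_below P q D)" for p
    unfolding dense_below_iff[of p] using stronger_cond by blast
  then show ?thesis
    unfolding regular_open_def by (auto simp: dense_below_idem)
qed

lemma regular_open_stronger: "regular_open U \<Longrightarrow> p \<in> U \<Longrightarrow> q \<preceq> p \<Longrightarrow> q \<in> U"
  unfolding regular_open_def by (metis dense_below_stronger stronger_cond(1) mem_Collect_eq subsetD)

text \<open>This is the Boolean complement of \<open>U\<close>: the conditions incompatible with
  every member of \<open>U\<close>.\<close>

lemma regular_open_incompatible:
  assumes "\<And>p q. p \<in> U \<Longrightarrow> q \<preceq> p \<Longrightarrow> q \<in> U"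
  shows "regular_open {p \<in> cond. \<forall>q. q \<preceq> p \<longrightarrow> q \<notin> U}"
proof (rule regular_openI)
  fix p assume "p \<in> cond"
    "dense_below P p (\<lambda>q. q \<in> {p \<in> cond. \<forall>q. q \<preceq> p \<longrightarrow> q \<notin> U})"
  then show "p \<in> {p \<in> cond. \<forall>q. q \<preceq> p \<longrightarrow> q \<notin> U}"
    unfolding dense_below_iff using assms stronger_refl stronger_cond by blast
qed (use stronger_trans stronger_cond in blast)+

text \<open>The cone below \<open>p\<close> is the smallest open set that contains \<open>p\<close>,
  so \<open>closure\<close> and \<open>interior\<close> need only be tested on cones.\<close>

lemma interior_closure:
  assumes "el u \<subseteq> cond"
  shows "el (interior P (closure P u)) = {p \<in> cond. dense_below P p (\<lambda>q. q \<epsilon> u)}"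
proof -
  have "isset {q \<in> cond. q \<preceq> p}" for p
    by (intro isset_sep isset_el definable_stronger definable_intros)
  then have "\<exists>d. \<forall>q. q \<epsilon> d \<longleftrightarrow> q \<preceq> p" for p
    by (rule issetE) (use stronger_cond in auto)
  then have below: "\<exists>d. open_in P d \<and> (\<forall>q. q \<epsilon> d \<longleftrightarrow> q \<preceq> p)" for p
    unfolding open_in_def using stronger_trans stronger_cond by (metis mem_Collect_eq subsetI)
  have c: "{p \<in> cond. \<forall>w. open_in P w \<and> p \<epsilon> w \<longrightarrow> el w \<inter> el u \<noteq> {}} =
      {p \<in> cond. \<exists>q. q \<preceq> p \<and> q \<epsilon> u}" (is "?C = ?C'")
  proof (intro Collect_cong conj_cong refl iffI)
    fix p assume "p \<in> cond" "\<forall>w. open_in P w \<and> p \<epsilon> w \<longrightarrow> el w \<inter> el u \<noteq> {}"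
    then show "\<exists>q. q \<preceq> p \<and> q \<epsilon> u" using below[of p] stronger_refl by blast
  next
    fix p assume "\<exists>q. q \<preceq> p \<and> q \<epsilon> u"
    then show "\<forall>w. open_in P w \<and> p \<epsilon> w \<longrightarrow> el w \<inter> el u \<noteq> {}"
      unfolding open_in_def using stronger_cond by blast
  qed
  have "isset ?C'" by (intro isset_sep isset_el definable_stronger definable_intros)
  then have c': "el (closure P u) = ?C'"
    unfolding closure_def c by (rule el_setof)
  have i: "{p \<in> cond. \<exists>w. open_in P w \<and> p \<epsilon> w \<and> el w \<subseteq> ?C'} =
      {p \<in> cond. dense_below P p (\<lambda>q. q \<epsilon> u)}" (is "?I = ?I'")
  proof (intro Collect_cong conj_cong refl iffI)
    fix p assume "\<exists>w. open_in P w \<and> p \<epsilon> w \<and> el w \<subseteq> ?C'"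
    then show "dense_below P p (\<lambda>q. q \<epsilon> u)"
      unfolding open_in_def dense_below_iff using stronger_cond by blast
  next
    fix p assume "p \<in> cond" "dense_below P p (\<lambda>q. q \<epsilon> u)"
    moreover obtain d where "open_in P d" "\<And>q. q \<epsilon> d \<longleftrightarrow> q \<preceq> p" using below by blast
    ultimately show "\<exists>w. open_in P w \<and> p \<epsilon> w \<and> el w \<subseteq> ?C'"
      unfolding dense_below_iff using stronger_cond by (intro exI[of _ d]) auto
  qed
  have "isset ?I'" by (intro isset_sep isset_el definable_dense_below definable_intros)
  then show ?thesis
    unfolding interior_def c' i by (rule el_setof)
qed

lemma mem_regular_opens: "u \<epsilon> regular_opens P \<longleftrightarrow> regular_open (el u)"
proof -
  have *: "{u. el u \<subseteq> cond \<and> interior P (closure P u) = u} = {u. regular_open (el u)}"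
  proof (intro Collect_cong)
    fix u
    have "interior P (closure P u) = u \<longleftrightarrow> el (interior P (closure P u)) = el u"
      using extensionality by metis
    then show "el u \<subseteq> cond \<and> interior P (closure P u) = u \<longleftrightarrow> regular_open (el u)"
      unfolding regular_open_def using interior_closure[of u]
      by (auto simp: set_eq_iff)
  qed
  have "isset {u \<in> {u. el u \<subseteq> cond}. \<forall>p\<in>cond. p \<epsilon> u \<longleftrightarrow> dense_below P p (\<lambda>q. q \<epsilon> u)}"
    by (intro isset_sep isset_Pow isset_el definable_dense_below definable_intros)
  then have "isset {u. regular_open (el u)}"
    unfolding regular_open_def by simp
  then show ?thesis
    unfolding regular_opens_def * by (simp add: mem_setof)
qed

lemma carrier_ro [simp]: "first (ro P) = regular_opens P"
  by (simp add: ro_def)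

lemma le_ro: "le (ro P) u v \<longleftrightarrow> u \<epsilon> regular_opens P \<and> v \<epsilon> regular_opens P \<and> el u \<subseteq> el v"
proof -
  let ?R = "{\<langle>u, v\<rangle> | u v. u \<epsilon> regular_opens P \<and> v \<epsilon> regular_opens P \<and> el u \<subseteq> el v}"
  have "isset ?R"
  proof (rule isset_subset)
    show "isset {\<langle>u, v\<rangle> | u v. u \<in> el (regular_opens P) \<and> v \<in> el (regular_opens P)}"
      by (intro isset_Times isset_el)
    show "definable (\<lambda>\<rho>. \<rho> 0 \<in> ?R)"
      unfolding mem_Collect_eq by (intro definable_intros definable_opair)
  qed auto
  then show ?thesis
    unfolding le_def ro_def by (simp add: mem_setof)
qed

lemma empty_regular_open [simp]: "empty \<epsilon> regular_opens P"
  unfolding mem_regular_opens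
  by (rule regular_openI) (auto simp: dense_below_iff intro: stronger_refl)

lemma first_regular_open [simp]: "first P \<epsilon> regular_opens P"
  unfolding mem_regular_opens
  by (rule regular_openI) (auto intro: stronger_cond)

lemma regular_opens_subset: "u \<epsilon> regular_opens P \<Longrightarrow> el u \<subseteq> cond"
  unfolding mem_regular_opens regular_open_def by blast

lemma is_bot_ro: "is_bot (ro P) x \<longleftrightarrow> x = empty"
proof
  assume "is_bot (ro P) x"
  then have "le (ro P) x empty" unfolding is_bot_def by simp
  then show "x = empty" unfolding le_ro by (simp add: eq_empty_iff)
next
  show "x = empty \<Longrightarrow> is_bot (ro P) x" unfolding is_bot_def le_ro by simp
qed

lemma is_top_ro: "is_top (ro P) x \<longleftrightarrow> x = first P"
proof
  assume x: "is_top (ro P) x"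
  then have "le (ro P) (first P) x" unfolding is_top_def by simp
  then have "el (first P) \<subseteq> el x" unfolding le_ro by blast
  moreover have "el x \<subseteq> cond" using x regular_opens_subset unfolding is_top_def by simp
  ultimately show "x = first P" by (intro extensionality) blast
next
  show "x = first P \<Longrightarrow> is_top (ro P) x"
    unfolding is_top_def le_ro using regular_opens_subset by simp
qed

text \<open>For families of regular open sets, a dense union is the combinatorial form of having the
  supremum one.\<close>

definition predense :: "'a set \<Rightarrow> bool" where
  "predense W \<longleftrightarrow> (\<forall>p\<in>cond. \<exists>q w. q \<preceq> p \<and> w \<in> W \<and> q \<epsilon> w)"

text \<open>The infimum is the intersection. This has to be recognised as a regular open set of the
  model before it can be compared with \<open>empty\<close>.\<close>

lemma ro_disjoint_iff:
  assumes "x \<epsilon> regular_opens P" "y \<epsilon> regular_opens P"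
  shows "(\<exists>z. is_inf (ro P) x y z \<and> is_bot (ro P) z) \<longleftrightarrow> el x \<inter> el y = {}"
proof
  assume "\<exists>z. is_inf (ro P) x y z \<and> is_bot (ro P) z"
  then have inf: "is_inf (ro P) x y empty" unfolding is_bot_ro by blast
  have "isset {p \<in> el x. p \<epsilon> y}" by (intro isset_sep isset_el definable_intros)
  then obtain w where "el w = {p \<in> el x. p \<epsilon> y}" unfolding isset_def by blast
  then have w: "p \<epsilon> w \<longleftrightarrow> p \<epsilon> x \<and> p \<epsilon> y" for p by blast
  have "regular_open (el w)"
  proof (rule regular_openI)
    show "el w \<subseteq> cond" using w regular_opens_subset assms by blast
    show "q \<in> el w" if "p \<in> el w" "q \<preceq> p" for p q
      using that w assms regular_open_stronger unfolding mem_regular_opens by auto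
    show "p \<in> el w" if "p \<in> cond" "dense_below P p (\<lambda>q. q \<in> el w)" for p
      using that w assms unfolding mem_regular_opens regular_open_def
      by (simp add: dense_below_iff) meson
  qed
  then have "le (ro P) w x" "le (ro P) w y" "w \<epsilon> regular_opens P"
    using assms w unfolding le_ro mem_regular_opens by auto
  then have "le (ro P) w empty"
    using inf unfolding is_inf_def by simp
  then show "el x \<inter> el y = {}" using w unfolding le_ro by auto
next
  assume "el x \<inter> el y = {}"
  then have "is_inf (ro P) x y empty"
    using assms unfolding is_inf_def le_ro by auto
  then show "\<exists>z. is_inf (ro P) x y z \<and> is_bot (ro P) z" unfolding is_bot_ro by blast
qed

text \<open>If no member meets the cone below \<open>p\<close>, the conditions incompatible with
  \<open>p\<close> form a regular open upper bound that omits \<open>p\<close>. Conversely, an upper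
  bound of a dense union is dense below every condition and hence contains all of them.\<close>

lemma ro_Sup_top_iff:
  assumes "el W \<subseteq> el (regular_opens P)"
  shows "(\<exists>z. is_Sup (ro P) W z \<and> is_top (ro P) z) \<longleftrightarrow> predense (el W)"
proof
  assume "\<exists>z. is_Sup (ro P) W z \<and> is_top (ro P) z"
  then have sup: "is_Sup (ro P) W (first P)" unfolding is_top_ro by blast
  show "predense (el W)"
    unfolding predense_def
  proof (rule ccontr)
    assume "\<not> (\<forall>p\<in>cond. \<exists>q w. q \<preceq> p \<and> w \<in> el W \<and> q \<epsilon> w)"
    then obtain p where p: "p \<epsilon> first P" "\<And>q w. q \<preceq> p \<Longrightarrow> w \<epsilon> W \<Longrightarrow> \<not> q \<epsilon> w" by blast
    have "isset {q \<in> cond. \<forall>r. r \<preceq> q \<longrightarrow> \<not> r \<preceq> p}"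
      by (intro isset_sep isset_el definable_stronger definable_intros)
    then obtain u where eu: "el u = {q \<in> cond. \<forall>r. r \<preceq> q \<longrightarrow> \<not> r \<preceq> p}"
      unfolding isset_def by (elim exE)
    then have u: "q \<epsilon> u \<longleftrightarrow> q \<epsilon> first P \<and> (\<forall>r. r \<preceq> q \<longrightarrow> \<not> r \<preceq> p)" for q by blast
    have ureg: "u \<epsilon> regular_opens P"
      unfolding mem_regular_opens eu
      using regular_open_incompatible[of "{r. r \<preceq> p}"] stronger_trans by simp
    have "le (ro P) w u" if "w \<epsilon> W" for w
    proof -
      have w: "regular_open (el w)" using assms that mem_regular_opens by blast
      have "q \<epsilon> u" if "q \<epsilon> w" for q
        using u p \<open>w \<epsilon> W\<close> that regular_open_stronger[OF w] w unfolding regular_open_def by blast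
      then show ?thesis using ureg w unfolding le_ro mem_regular_opens by blast
    qed
    then have "le (ro P) (first P) u"
      using sup ureg unfolding is_Sup_def by simp
    then show False using p(1) u stronger_refl unfolding le_ro by blast
  qed
next
  assume W: "predense (el W)"
  have "is_Sup (ro P) W (first P)"
    unfolding is_Sup_def
  proof (intro conjI ballI impI)
    show "first P \<in> carrier (ro P)" by simp
    show "le (ro P) w (first P)" if "w \<in> el W" for w
      using that assms regular_opens_subset unfolding le_ro by auto
    fix u assume u: "u \<in> carrier (ro P)" "\<forall>w\<in>el W. le (ro P) w u"
    have "p \<epsilon> u" if "p \<epsilon> first P" for p
    proof -
      have "dense_below P p (\<lambda>q. q \<epsilon> u)"
        unfolding dense_below_iff
      proof (intro allI impI)
        fix q assume "q \<preceq> p"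
        then obtain r w where "r \<preceq> q" "w \<epsilon> W" "r \<epsilon> w"
          using W stronger_cond unfolding predense_def by blast
        then show "\<exists>r. r \<preceq> q \<and> r \<epsilon> u" using u(2) unfolding le_ro by blast
      qed
      then show ?thesis using that u(1) by (simp add: mem_regular_opens regular_open_def)
    qed
    then show "le (ro P) (first P) u" using u(1) unfolding le_ro by auto
  qed
  then show "\<exists>z. is_Sup (ro P) W z \<and> is_top (ro P) z" unfolding is_top_ro by blast
qed

text \<open>After this translation only the inclusion order is left of the Boolean algebra, and
  partitions are handled as families of sets of conditions.\<close>

lemma is_partition_ro_iff:
  "is_partition (ro P) W \<longleftrightarrow> (\<forall>w\<in>el W. regular_open (el w) \<and> el w \<noteq> {}) \<and>
     (\<forall>v\<in>el W. \<forall>w\<in>el W. v \<noteq> w \<longrightarrow> el v \<inter> el w = {}) \<and> predense (el W)"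
proof (cases "el W \<subseteq> el (regular_opens P)")
  case True
  have "(\<forall>x\<in>el W. \<forall>y\<in>el W. x \<noteq> y \<longrightarrow> (\<exists>z. is_inf (ro P) x y z \<and> is_bot (ro P) z)) \<longleftrightarrow>
      (\<forall>x\<in>el W. \<forall>y\<in>el W. x \<noteq> y \<longrightarrow> el x \<inter> el y = {})"
    using True by (intro ball_cong refl) (simp add: ro_disjoint_iff subset_iff)
  then show ?thesis
    using True unfolding is_partition_def ro_Sup_top_iff[OF True] is_bot_ro
    by (auto simp: eq_empty_iff mem_regular_opens)
next
  case False
  then show ?thesis unfolding is_partition_def by (auto simp: mem_regular_opens)
qed

section \<open>Names and induction on them\<close>

lemma name_closedD:
  assumes "name_closed P T" "x \<epsilon> T" "\<langle>\<sigma>, s\<rangle> \<epsilon> x"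
  shows "\<sigma> \<epsilon> T" "s \<epsilon> first P"
  using assms unfolding name_closed_def by fastforce+

lemma name_closed_Un:
  assumes "name_closed P T" "name_closed P U"
  shows "\<exists>V. name_closed P V \<and> (\<forall>x. x \<epsilon> V \<longleftrightarrow> x \<epsilon> T \<or> x \<epsilon> U)"
proof -
  obtain V where "\<And>x. x \<epsilon> V \<longleftrightarrow> x \<in> el T \<union> el U"
    by (rule issetE[of "el T \<union> el U"]) auto
  then have V: "\<And>x. x \<epsilon> V \<longleftrightarrow> x \<epsilon> T \<or> x \<epsilon> U" by simp
  then have "name_closed P V"
    using assms unfolding name_closed_def V mem_Collect_eq Ball_def Bex_def by metis
  then show ?thesis using V by blast
qed

text \<open>The names in a minimal counterexample \<open>x\<close> lie three memberships below \<open>x\<close>; the set \<open>?M\<close>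
  contains the intermediate sets, so that foundation can be applied to it.\<close>

lemma name_induct [consumes 2, case_names definable step]:
  assumes T: "name_closed P T" "x \<epsilon> T"
    and Q: "definable (\<lambda>\<rho>. Q (\<rho> 0))"
    and step: "\<And>x. x \<epsilon> T \<Longrightarrow> (\<And>\<sigma> s. \<langle>\<sigma>, s\<rangle> \<epsilon> x \<Longrightarrow> Q \<sigma>) \<Longrightarrow> Q x"
  shows "Q x"
proof (rule ccontr)
  assume "\<not> Q x"
  have "isset {x \<in> el T. \<not> Q x}"
    by (intro isset_sep isset_el definable_not Q)
  then obtain S where S: "\<And>x. x \<epsilon> S \<longleftrightarrow> x \<epsilon> T \<and> \<not> Q x"
    by (rule issetE) (rule that, simp)
  let ?M = "el S \<union> {z \<in> {z. el z \<subseteq> el S}. \<exists>\<sigma>\<in>el S. z = upair \<sigma> \<sigma>} \<union>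
    {z \<in> (\<Union>x\<in>el T. el x). \<exists>\<sigma>\<in>el S. \<exists>s. z = \<langle>\<sigma>, s\<rangle>}"
  have "isset ?M"
    by (intro isset_Un isset_sep isset_UN_el isset_Pow isset_el definable_intros
        definable_opair definable_upair)
  moreover have "x \<in> ?M" using S \<open>\<not> Q x\<close> T by simp
  ultimately obtain m where m: "m \<in> ?M" "el m \<inter> ?M = {}"
    using foundation[of ?M] by blast
  have singleton: "upair \<sigma> \<sigma> \<in> ?M" if "\<sigma> \<epsilon> S" for \<sigma> using that by auto
  consider "m \<epsilon> S" | \<sigma> where "\<sigma> \<epsilon> S" "m = upair \<sigma> \<sigma>" | \<sigma> s where "\<sigma> \<epsilon> S" "m = \<langle>\<sigma>, s\<rangle>"
    using m(1) by blast
  then show False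
  proof cases
    case 1
    then obtain \<sigma> s where "\<langle>\<sigma>, s\<rangle> \<epsilon> m" "\<not> Q \<sigma>" using step S by blast
    moreover from this have "\<sigma> \<epsilon> S" using S name_closedD(1)[OF T(1)] 1 by blast
    ultimately have "\<langle>\<sigma>, s\<rangle> \<in> ?M" using 1 S by auto
    then show False using m(2) \<open>\<langle>\<sigma>, s\<rangle> \<epsilon> m\<close> by blast
  next
    case 2
    then have "\<sigma> \<in> el m \<inter> ?M" by simp
    then show False using m(2) by blast
  next
    case 3
    then have "upair \<sigma> \<sigma> \<in> el m \<inter> ?M" using singleton by (simp add: opair_def)
    then show False using m(2) by blast
  qed
qed

subsection \<open>The forcing relation for equality\<close>

text \<open>The clause of the recursion for the inclusion of \<open>x\<close> in \<open>y\<close>.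
  Abstracting the relation \<open>R\<close> between components makes the monotonicity visible and
  covers both membership in a solution \<open>F\<close> and \<open>forces_eq\<close>.\<close>

definition forces_half :: "('a \<Rightarrow> 'a \<Rightarrow> 'a \<Rightarrow> bool) \<Rightarrow> 'a \<Rightarrow> 'a \<Rightarrow> 'a \<Rightarrow> bool" where
  "forces_half R p x y \<longleftrightarrow> (\<forall>\<sigma> s. \<langle>\<sigma>, s\<rangle> \<epsilon> x \<longrightarrow> dense_below P p (\<lambda>q. q \<preceq> s \<longrightarrow>
     (\<exists>\<tau> t. \<langle>\<tau>, t\<rangle> \<epsilon> y \<and> q \<preceq> t \<and> R q \<sigma> \<tau>)))"

text \<open>The relation is transposed in the second half so that \<open>R\<close> always takes a
  component of \<open>x\<close> before one of \<open>y\<close>.\<close>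

definition forces_both :: "('a \<Rightarrow> 'a \<Rightarrow> 'a \<Rightarrow> bool) \<Rightarrow> 'a \<Rightarrow> 'a \<Rightarrow> 'a \<Rightarrow> bool" where
  "forces_both R p x y \<longleftrightarrow> forces_half R p x y \<and> forces_half (\<lambda>q \<tau> \<sigma>. R q \<sigma> \<tau>) p y x"

lemma eq_recursion_iff:
  "eq_recursion P T F \<longleftrightarrow> name_closed P T \<and>
     (\<forall>p x y. p \<epsilon> first P \<longrightarrow> x \<epsilon> T \<longrightarrow> y \<epsilon> T \<longrightarrow>
        (\<langle>p, \<langle>x, y\<rangle>\<rangle> \<epsilon> F \<longleftrightarrow> forces_both (\<lambda>p x y. \<langle>p, \<langle>x, y\<rangle>\<rangle> \<epsilon> F) p x y))"
  unfolding eq_recursion_def forces_both_def forces_half_def by simp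

text \<open>The second hypothesis is confined to components of the two names and conditions below
  \<open>p\<close>, which is what an induction hypothesis on names provides.\<close>

lemma forces_half_mono:
  assumes "forces_half R p x y"
    "\<And>\<sigma> s \<tau> t q. \<langle>\<sigma>, s\<rangle> \<epsilon> x \<Longrightarrow> \<langle>\<tau>, t\<rangle> \<epsilon> y \<Longrightarrow> q \<preceq> p \<Longrightarrow> R q \<sigma> \<tau> \<Longrightarrow> S q \<sigma> \<tau>"
  shows "forces_half S p x y"
  unfolding forces_half_def dense_below_iff
proof (intro allI impI)
  fix \<sigma> s q assume "\<langle>\<sigma>, s\<rangle> \<epsilon> x" "q \<preceq> p"
  then obtain r where r: "r \<preceq> q" "r \<preceq> s \<longrightarrow> (\<exists>\<tau> t. \<langle>\<tau>, t\<rangle> \<epsilon> y \<and> r \<preceq> t \<and> R r \<sigma> \<tau>)"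
    using assms(1) unfolding forces_half_def dense_below_iff by blast
  moreover have "r \<preceq> p" using r \<open>q \<preceq> p\<close> stronger_trans by blast
  ultimately show "\<exists>r. r \<preceq> q \<and> (r \<preceq> s \<longrightarrow> (\<exists>\<tau> t. \<langle>\<tau>, t\<rangle> \<epsilon> y \<and> r \<preceq> t \<and> S r \<sigma> \<tau>))"
    using assms(2) \<open>\<langle>\<sigma>, s\<rangle> \<epsilon> x\<close> by blast
qed

lemma forces_both_mono:
  assumes "forces_both R p x y"
    "\<And>\<sigma> s \<tau> t q. \<langle>\<sigma>, s\<rangle> \<epsilon> x \<Longrightarrow> \<langle>\<tau>, t\<rangle> \<epsilon> y \<Longrightarrow> q \<preceq> p \<Longrightarrow> R q \<sigma> \<tau> \<Longrightarrow> S q \<sigma> \<tau>"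
  shows "forces_both S p x y"
  using assms unfolding forces_both_def by (auto elim!: forces_half_mono)

lemma forces_both_stronger: "forces_both R p x y \<Longrightarrow> q \<preceq> p \<Longrightarrow> forces_both R q x y"
  unfolding forces_both_def forces_half_def using dense_below_stronger by blast

lemma definable_forces_both:
  assumes "definable_term F" "definable_term p" "definable_term x" "definable_term y"
  shows "definable (\<lambda>\<rho>. forces_both (\<lambda>p x y. \<langle>p, \<langle>x, y\<rangle>\<rangle> \<epsilon> F \<rho>) (p \<rho>) (x \<rho>) (y \<rho>))"
  unfolding forces_both_def forces_half_def
  by (intro definable_dense_below definable_stronger definable_intros definable_opair
      definable_term_shift assms)

text \<open>The clauses of the recursion are monotone in \<open>F\<close>, so the union of all post-fixed points
  solves it.\<close>

lemma ex_eq_recursion: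
  assumes T: "name_closed P T"
  shows "\<exists>F. eq_recursion P T F"
proof -
  define K where "K = {\<langle>p, z\<rangle> | p z. p \<in> cond \<and> z \<in> {\<langle>x, y\<rangle> | x y. x \<in> el T \<and> y \<in> el T}}"
  have K: "isset K" unfolding K_def by (intro isset_Times isset_el)
  have memK: "\<langle>p, \<langle>x, y\<rangle>\<rangle> \<in> K \<longleftrightarrow> p \<epsilon> first P \<and> x \<epsilon> T \<and> y \<epsilon> T" for p x y
    unfolding K_def by simp
  let ?R = "\<lambda>F p x y. \<langle>p, \<langle>x, y\<rangle>\<rangle> \<epsilon> F"
  define post where "post X \<longleftrightarrow> (\<forall>p x y. \<langle>p, \<langle>x, y\<rangle>\<rangle> \<epsilon> X \<longrightarrow> forces_both (?R X) p x y)" for X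
  obtain k where k: "el k = K" using K unfolding isset_def by (elim exE)
  have "isset {z \<in> K. \<exists>X. el X \<subseteq> el k \<and> post X \<and> z \<epsilon> X}"
    unfolding post_def
    by (intro isset_sep K definable_forces_both definable_intros definable_opair)
  then obtain F where F: "\<And>z. z \<epsilon> F \<longleftrightarrow> z \<in> K \<and> (\<exists>X. el X \<subseteq> K \<and> post X \<and> z \<epsilon> X)"
    unfolding k by (rule issetE) (rule that, simp)
  have post_F: "forces_both (?R F) p x y" if pxy: "\<langle>p, \<langle>x, y\<rangle>\<rangle> \<epsilon> F" for p x y
  proof -
    obtain X where X: "el X \<subseteq> K" "post X" "\<langle>p, \<langle>x, y\<rangle>\<rangle> \<epsilon> X" using pxy F by blast
    then have "forces_both (?R X) p x y" unfolding post_def by blast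
    then show ?thesis using X F by (elim forces_both_mono) blast
  qed
  \<comment> \<open>A triple that satisfies the clause over \<open>F\<close> can be adjoined to
    \<open>F\<close> without losing the post-fixed property, so it already belongs to the union.
    This is the argument of Knaster and Tarski.\<close>
  have "\<langle>p, \<langle>x, y\<rangle>\<rangle> \<epsilon> F"
    if "p \<epsilon> first P" "x \<epsilon> T" "y \<epsilon> T" and fb: "forces_both (?R F) p x y" for p x y
  proof -
    have "isset (insert \<langle>p, \<langle>x, y\<rangle>\<rangle> (el F))" by (intro isset_insert isset_el)
    then obtain X where X: "\<And>z. z \<epsilon> X \<longleftrightarrow> z = \<langle>p, \<langle>x, y\<rangle>\<rangle> \<or> z \<epsilon> F"
      by (rule issetE) (rule that, simp)
    have "forces_both (?R X) p' x' y'" if "\<langle>p', \<langle>x', y'\<rangle>\<rangle> \<epsilon> X" for p' x' y'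
    proof -
      have "forces_both (?R F) p' x' y'" using that X fb post_F by auto
      then show ?thesis using X by (elim forces_both_mono) simp
    qed
    then have "post X" unfolding post_def by blast
    moreover have "el X \<subseteq> K" using X F that memK by auto
    ultimately show ?thesis using F X that memK by blast
  qed
  then have "eq_recursion P T F"
    unfolding eq_recursion_iff using T post_F by blast
  then show ?thesis by blast
qed

lemma eq_recursion_unfold:
  "eq_recursion P T F \<Longrightarrow> p \<epsilon> first P \<Longrightarrow> x \<epsilon> T \<Longrightarrow> y \<epsilon> T \<Longrightarrow>
     \<langle>p, \<langle>x, y\<rangle>\<rangle> \<epsilon> F \<longleftrightarrow> forces_both (\<lambda>p x y. \<langle>p, \<langle>x, y\<rangle>\<rangle> \<epsilon> F) p x y"
  unfolding eq_recursion_iff by blast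

text \<open>The solutions may live on different sets of names, yet the clause refers only to
  components of \<open>x\<close> and \<open>y\<close>, which belong to both sets.\<close>

lemma eq_recursion_unique:
  assumes F: "eq_recursion P T F" and F': "eq_recursion P T' F'"
    and xy: "x \<epsilon> T" "x \<epsilon> T'" "y \<epsilon> T" "y \<epsilon> T'" and p: "p \<epsilon> first P"
  shows "\<langle>p, \<langle>x, y\<rangle>\<rangle> \<epsilon> F \<longleftrightarrow> \<langle>p, \<langle>x, y\<rangle>\<rangle> \<epsilon> F'"
proof -
  have T: "name_closed P T" "name_closed P T'" using F F' unfolding eq_recursion_iff by auto
  have "x \<epsilon> T' \<longrightarrow> (\<forall>y\<in>el T. y \<epsilon> T' \<longrightarrow> (\<forall>p\<in>cond. \<langle>p, \<langle>x, y\<rangle>\<rangle> \<epsilon> F \<longleftrightarrow> \<langle>p, \<langle>x, y\<rangle>\<rangle> \<epsilon> F'))"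
    using T(1) xy(1)
  proof (induction rule: name_induct)
    case definable show ?case by (intro definable_intros definable_opair)
  next
    case (step x)
    show ?case
    proof (intro impI ballI)
      fix y p assume "x \<epsilon> T'" "y \<in> el T" "y \<epsilon> T'" "p \<in> cond"
      then have *: "\<langle>q, \<langle>\<sigma>, \<tau>\<rangle>\<rangle> \<epsilon> F \<longleftrightarrow> \<langle>q, \<langle>\<sigma>, \<tau>\<rangle>\<rangle> \<epsilon> F'"
        if "\<langle>\<sigma>, s\<rangle> \<epsilon> x" "\<langle>\<tau>, t\<rangle> \<epsilon> y" "q \<preceq> p" for q \<sigma> s \<tau> t
        using that step.IH name_closedD(1)[OF T(1)] name_closedD(1)[OF T(2)] stronger_cond by blast
      show "\<langle>p, \<langle>x, y\<rangle>\<rangle> \<epsilon> F \<longleftrightarrow> \<langle>p, \<langle>x, y\<rangle>\<rangle> \<epsilon> F'"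
        using eq_recursion_unfold[OF F] eq_recursion_unfold[OF F'] step.hyps
          \<open>x \<epsilon> T'\<close> \<open>y \<in> el T\<close> \<open>y \<epsilon> T'\<close> \<open>p \<in> cond\<close>
        by (auto elim!: forces_both_mono simp: *)
    qed
  qed
  then show ?thesis using xy p by simp
qed

text \<open>Any single solution determines \<open>forces_eq\<close> on its names. This allows a
  solution \<open>F\<close> to be fixed as a parameter, so that forced equality becomes membership
  in a set.\<close>

lemma forces_eq_iff:
  assumes "eq_recursion P T F" "x \<epsilon> T" "y \<epsilon> T" "p \<epsilon> first P"
  shows "forces_eq P p x y \<longleftrightarrow> \<langle>p, \<langle>x, y\<rangle>\<rangle> \<epsilon> F"
  unfolding forces_eq_def using assms eq_recursion_unique by blast

lemma is_nameI: "name_closed P T \<Longrightarrow> x \<epsilon> T \<Longrightarrow> is_name P x"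
  unfolding is_name_def by blast

lemma is_name_component: "is_name P x \<Longrightarrow> \<langle>\<sigma>, s\<rangle> \<epsilon> x \<Longrightarrow> is_name P \<sigma>"
  unfolding is_name_def using name_closedD by blast

lemma ex_eq_recursion2:
  assumes "is_name P x" "is_name P y"
  shows "\<exists>T F. eq_recursion P T F \<and> x \<epsilon> T \<and> y \<epsilon> T"
  using assms name_closed_Un ex_eq_recursion unfolding is_name_def by metis

lemma ex_eq_recursion3:
  assumes "is_name P x" "is_name P y" "is_name P z"
  shows "\<exists>T F. eq_recursion P T F \<and> x \<epsilon> T \<and> y \<epsilon> T \<and> z \<epsilon> T"
  using assms name_closed_Un ex_eq_recursion unfolding is_name_def by metis

lemma forces_eq_unfold:
  assumes "is_name P x" "is_name P y" "p \<epsilon> first P"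
  shows "forces_eq P p x y \<longleftrightarrow> forces_both (forces_eq P) p x y"
proof -
  obtain T F where F: "eq_recursion P T F" "x \<epsilon> T" "y \<epsilon> T"
    using ex_eq_recursion2 assms by blast
  then have T: "name_closed P T" unfolding eq_recursion_iff by blast
  have *: "forces_eq P q \<sigma> \<tau> \<longleftrightarrow> \<langle>q, \<langle>\<sigma>, \<tau>\<rangle>\<rangle> \<epsilon> F"
    if "\<langle>\<sigma>, s\<rangle> \<epsilon> x" "\<langle>\<tau>, t\<rangle> \<epsilon> y" "q \<preceq> p" for q \<sigma> s \<tau> t
    using that forces_eq_iff[OF F(1)] name_closedD(1)[OF T] F stronger_cond by blast
  show ?thesis
    unfolding forces_eq_iff[OF F assms(3)] eq_recursion_unfold[OF F(1) assms(3) F(2,3)]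
    by (auto elim!: forces_both_mono simp: *)
qed

lemma forces_eq_stronger:
  "is_name P x \<Longrightarrow> is_name P y \<Longrightarrow> forces_eq P p x y \<Longrightarrow> q \<preceq> p \<Longrightarrow> forces_eq P q x y"
  using forces_eq_unfold forces_both_stronger stronger_cond by metis

text \<open>Induction on names requires a definable statement, so it is carried out for membership
  in a fixed solution and translated back at the end. Symmetry and transitivity follow the same
  pattern.\<close>

lemma forces_eq_refl:
  assumes "is_name P x" "p \<epsilon> first P"
  shows "forces_eq P p x x"
proof -
  obtain T F where F: "eq_recursion P T F" "x \<epsilon> T"
    using ex_eq_recursion2 assms by blast
  then have T: "name_closed P T" unfolding eq_recursion_iff by blast
  have "\<forall>p\<in>cond. \<langle>p, \<langle>x, x\<rangle>\<rangle> \<epsilon> F"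
    using T F(2)
  proof (induction rule: name_induct)
    case definable show ?case by (intro definable_intros definable_opair)
  next
    case (step x)
    show ?case
    proof
      fix p assume "p \<in> cond"
      moreover have "forces_both (\<lambda>p x y. \<langle>p, \<langle>x, y\<rangle>\<rangle> \<epsilon> F) p x x"
        unfolding forces_both_def forces_half_def dense_below_iff
        using step.IH stronger_cond stronger_refl by blast
      ultimately show "\<langle>p, \<langle>x, x\<rangle>\<rangle> \<epsilon> F"
        using eq_recursion_unfold[OF F(1)] step.hyps by blast
    qed
  qed
  then show ?thesis using forces_eq_iff F assms by auto
qed

text \<open>The clause for \<open>y\<close> and \<open>x\<close> is the one for \<open>x\<close> and
  \<open>y\<close> with its halves exchanged and the relation transposed; the induction hypothesis
  undoes the transposition on components.\<close>

lemma forces_eq_sym: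
  assumes "is_name P x" "is_name P y" "p \<epsilon> first P" "forces_eq P p x y"
  shows "forces_eq P p y x"
proof -
  obtain T F where F: "eq_recursion P T F" "x \<epsilon> T" "y \<epsilon> T"
    using ex_eq_recursion2 assms by blast
  then have T: "name_closed P T" unfolding eq_recursion_iff by blast
  have "\<forall>y\<in>el T. \<forall>p\<in>cond. \<langle>p, \<langle>x, y\<rangle>\<rangle> \<epsilon> F \<longleftrightarrow> \<langle>p, \<langle>y, x\<rangle>\<rangle> \<epsilon> F"
    using T F(2)
  proof (induction rule: name_induct)
    case definable show ?case by (intro definable_intros definable_opair)
  next
    case (step x)
    show ?case
    proof (intro ballI)
      fix y p assume yp: "y \<in> el T" "p \<in> cond"
      then have *: "\<langle>q, \<langle>\<sigma>, \<tau>\<rangle>\<rangle> \<epsilon> F \<longleftrightarrow> \<langle>q, \<langle>\<tau>, \<sigma>\<rangle>\<rangle> \<epsilon> F"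
        if "\<langle>\<sigma>, s\<rangle> \<epsilon> x" "\<langle>\<tau>, t\<rangle> \<epsilon> y" "q \<preceq> p" for q \<sigma> s \<tau> t
        using that step.IH name_closedD(1)[OF T] stronger_cond by blast
      have "forces_both (\<lambda>p x y. \<langle>p, \<langle>x, y\<rangle>\<rangle> \<epsilon> F) p x y \<longleftrightarrow>
          forces_both (\<lambda>p x y. \<langle>p, \<langle>y, x\<rangle>\<rangle> \<epsilon> F) p x y"
        by (rule iffI; erule forces_both_mono) (use * in blast)+
      also have "\<dots> \<longleftrightarrow> forces_both (\<lambda>p x y. \<langle>p, \<langle>x, y\<rangle>\<rangle> \<epsilon> F) p y x"
        unfolding forces_both_def by blast
      finally show "\<langle>p, \<langle>x, y\<rangle>\<rangle> \<epsilon> F \<longleftrightarrow> \<langle>p, \<langle>y, x\<rangle>\<rangle> \<epsilon> F"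
        using eq_recursion_unfold[OF F(1)] step.hyps yp by simp
    qed
  qed
  then show ?thesis using forces_eq_iff[OF F(1)] F assms by auto
qed

text \<open>The witness in \<open>y\<close> is found at one condition and the witness in
  \<open>z\<close> only at a stronger one. The third hypothesis therefore combines \<open>R\<close>
  at the weaker condition with \<open>S\<close> at the stronger.\<close>

lemma forces_half_trans:
  assumes "forces_half R p x y" "forces_half S p y z"
    "\<And>\<sigma> s \<tau> t \<upsilon> u q r. \<langle>\<sigma>, s\<rangle> \<epsilon> x \<Longrightarrow> \<langle>\<tau>, t\<rangle> \<epsilon> y \<Longrightarrow> \<langle>\<upsilon>, u\<rangle> \<epsilon> z \<Longrightarrow> q \<preceq> p \<Longrightarrow> r \<preceq> q \<Longrightarrow>
       R q \<sigma> \<tau> \<Longrightarrow> S r \<tau> \<upsilon> \<Longrightarrow> U r \<sigma> \<upsilon>"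
  shows "forces_half U p x z"
  unfolding forces_half_def dense_below_iff
proof (intro allI impI)
  fix \<sigma> s q assume \<sigma>: "\<langle>\<sigma>, s\<rangle> \<epsilon> x" and q: "q \<preceq> p"
  then obtain r where r: "r \<preceq> q" "r \<preceq> s \<longrightarrow> (\<exists>\<tau> t. \<langle>\<tau>, t\<rangle> \<epsilon> y \<and> r \<preceq> t \<and> R r \<sigma> \<tau>)"
    using assms(1) unfolding forces_half_def dense_below_iff by blast
  have rp: "r \<preceq> p" using r q stronger_trans by blast
  show "\<exists>r. r \<preceq> q \<and> (r \<preceq> s \<longrightarrow> (\<exists>\<upsilon> u. \<langle>\<upsilon>, u\<rangle> \<epsilon> z \<and> r \<preceq> u \<and> U r \<sigma> \<upsilon>))"
  proof (cases "r \<preceq> s")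
    case False then show ?thesis using r by blast
  next
    case True
    then obtain \<tau> t where \<tau>: "\<langle>\<tau>, t\<rangle> \<epsilon> y" "r \<preceq> t" "R r \<sigma> \<tau>" using r by blast
    obtain r' where r': "r' \<preceq> r" "r' \<preceq> t \<longrightarrow> (\<exists>\<upsilon> u. \<langle>\<upsilon>, u\<rangle> \<epsilon> z \<and> r' \<preceq> u \<and> S r' \<tau> \<upsilon>)"
      using assms(2) rp \<tau> unfolding forces_half_def dense_below_iff by blast
    then obtain \<upsilon> u where \<upsilon>: "\<langle>\<upsilon>, u\<rangle> \<epsilon> z" "r' \<preceq> u" "S r' \<tau> \<upsilon>" using \<tau> stronger_trans by blast
    then have "U r' \<sigma> \<upsilon>" using assms(3) \<sigma> \<tau> rp r' by blast
    then show ?thesis using \<upsilon> r r' stronger_trans by blast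
  qed
qed

lemma forces_eq_trans:
  assumes names: "is_name P x" "is_name P y" "is_name P z" and p: "p \<epsilon> first P"
    and "forces_eq P p x y" "forces_eq P p y z"
  shows "forces_eq P p x z"
proof -
  obtain T F where F: "eq_recursion P T F" "x \<epsilon> T" "y \<epsilon> T" "z \<epsilon> T"
    using ex_eq_recursion3 names by blast
  then have T: "name_closed P T" unfolding eq_recursion_iff by blast
  let ?R = "\<lambda>p x y. \<langle>p, \<langle>x, y\<rangle>\<rangle> \<epsilon> F"
  have stronger: "?R q u v" if "?R p u v" "q \<preceq> p" "u \<epsilon> T" "v \<epsilon> T" for p q u v
  proof -
    have pq: "p \<epsilon> first P" "q \<epsilon> first P" using that(2) by (rule stronger_cond)+
    have "forces_both ?R p u v" using that eq_recursion_unfold[OF F(1) pq(1)] by simp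
    then have "forces_both ?R q u v" using that(2) by (rule forces_both_stronger)
    then show ?thesis using that eq_recursion_unfold[OF F(1) pq(2)] by simp
  qed
  have "\<forall>y\<in>el T. \<forall>z\<in>el T. \<forall>p\<in>cond. ?R p x y \<longrightarrow> ?R p y z \<longrightarrow> ?R p x z"
    using T F(2)
  proof (induction rule: name_induct)
    case definable show ?case by (intro definable_intros definable_opair)
  next
    case (step x)
    show ?case
    proof (intro ballI impI)
      fix y z p assume *: "y \<in> el T" "z \<in> el T" "p \<in> cond" "?R p x y" "?R p y z"
      then have xy: "forces_both ?R p x y" and yz: "forces_both ?R p y z"
        using eq_recursion_unfold[OF F(1)] step.hyps by auto
      have IH: "?R r \<sigma> \<upsilon>" if "\<langle>\<sigma>, s\<rangle> \<epsilon> x" "\<langle>\<tau>, t\<rangle> \<epsilon> y" "\<langle>\<upsilon>, u\<rangle> \<epsilon> z" "?R r \<sigma> \<tau>" "?R r \<tau> \<upsilon>" "r \<preceq> q"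
        for \<sigma> s \<tau> t \<upsilon> u r q
      proof -
        have "\<tau> \<in> el T" "\<upsilon> \<in> el T" "r \<in> cond"
          using name_closedD(1)[OF T _ that(2)] name_closedD(1)[OF T _ that(3)] *
            stronger_cond(1)[OF that(6)] by auto
        then show ?thesis using step.IH[OF that(1)] that(4,5) by blast
      qed
      have half: "forces_half ?R p x y" "forces_half ?R p y z"
        and half': "forces_half (\<lambda>q \<tau> \<sigma>. ?R q \<sigma> \<tau>) p y x" "forces_half (\<lambda>q \<tau> \<sigma>. ?R q \<sigma> \<tau>) p z y"
        using xy yz unfolding forces_both_def by auto
      have inT: "\<sigma> \<epsilon> T" if "\<langle>\<sigma>, s\<rangle> \<epsilon> x \<or> \<langle>\<sigma>, s\<rangle> \<epsilon> y \<or> \<langle>\<sigma>, s\<rangle> \<epsilon> z" for \<sigma> s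
        using that name_closedD(1)[OF T] step.hyps * by blast
      have "forces_half ?R p x z"
      proof (rule forces_half_trans[OF half])
        fix \<sigma> s \<tau> t \<upsilon> u q r
        assume a: "\<langle>\<sigma>, s\<rangle> \<epsilon> x" "\<langle>\<tau>, t\<rangle> \<epsilon> y" "\<langle>\<upsilon>, u\<rangle> \<epsilon> z" "r \<preceq> q" "?R q \<sigma> \<tau>" "?R r \<tau> \<upsilon>"
        then have "?R r \<sigma> \<tau>" using stronger inT by blast
        then show "?R r \<sigma> \<upsilon>" using IH a by blast
      qed
      \<comment> \<open>The path from \<open>z\<close> through \<open>y\<close> to \<open>x\<close>
        meets the components in the opposite order; the transposed relations lead back to the
        induction hypothesis on a component of \<open>x\<close>.\<close>
      moreover have "forces_half (\<lambda>q \<tau> \<sigma>. ?R q \<sigma> \<tau>) p z x"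
      proof (rule forces_half_trans[OF half'(2,1)])
        fix \<upsilon> u \<tau> t \<sigma> s q r
        assume a: "\<langle>\<upsilon>, u\<rangle> \<epsilon> z" "\<langle>\<tau>, t\<rangle> \<epsilon> y" "\<langle>\<sigma>, s\<rangle> \<epsilon> x" "r \<preceq> q" "?R q \<tau> \<upsilon>" "?R r \<sigma> \<tau>"
        then have "?R r \<tau> \<upsilon>" using stronger inT by blast
        then show "?R r \<sigma> \<upsilon>" using IH a by blast
      qed
      ultimately have "forces_both ?R p x z"
        unfolding forces_both_def by (rule conjI)
      then show "?R p x z"
        by (subst eq_recursion_unfold[OF F(1)]) (use step.hyps *(2,3) in \<open>simp_all only: mem_Collect_eq\<close>)
    qed
  qed
  moreover have "y \<in> el T" "z \<in> el T" "p \<in> cond" using F p by simp_all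
  ultimately have "?R p x y \<longrightarrow> ?R p y z \<longrightarrow> ?R p x z" by (elim ballE) blast+
  then show ?thesis
    using assms(5,6) forces_eq_iff[OF F(1,2,3) p] forces_eq_iff[OF F(1,3,4) p]
      forces_eq_iff[OF F(1,2,4) p] by simp
qed

subsection \<open>Canonical names\<close>

text \<open>A form of \<open>check_recursion\<close> in terms of the pairs in \<open>f\<close>, free
  of \<open>app\<close> and \<open>setof\<close>, so that being a partial recursion is itself a
  definable relation.\<close>

definition check_graph :: "'a \<Rightarrow> 'a \<Rightarrow> bool" where
  "check_graph t f \<longleftrightarrow> transitive_set t \<and> fun_on f t \<and>
     (\<forall>x c. \<langle>x, c\<rangle> \<epsilon> f \<longrightarrow>
        (\<forall>z. z \<epsilon> c \<longleftrightarrow> (\<exists>y d p. y \<epsilon> x \<and> \<langle>y, d\<rangle> \<epsilon> f \<and> p \<epsilon> first P \<and> z = \<langle>d, p\<rangle>)))"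

lemma definable_check_graph:
  "definable_term t \<Longrightarrow> definable_term f \<Longrightarrow> definable (\<lambda>\<rho>. check_graph (t \<rho>) (f \<rho>))"
  unfolding check_graph_def transitive_set_def fun_on_def
  by (intro definable_intros definable_opair definable_term_shift)

lemma isset_check_step:
  "isset {z. \<exists>y d p. y \<epsilon> x \<and> \<langle>y, d\<rangle> \<epsilon> f \<and> p \<epsilon> first P \<and> z = \<langle>d, p\<rangle>}"
proof (rule isset_subset)
  show "isset {\<langle>d, p\<rangle> | d p. d \<in> {c. \<exists>x. \<langle>x, c\<rangle> \<epsilon> f} \<and> p \<in> cond}"
    by (intro isset_Times isset_range isset_el)
  show "definable (\<lambda>\<rho>. \<rho> 0 \<in> {z. \<exists>y d p. y \<epsilon> x \<and> \<langle>y, d\<rangle> \<epsilon> f \<and> p \<epsilon> first P \<and> z = \<langle>d, p\<rangle>})"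
    unfolding mem_Collect_eq by (intro definable_intros definable_opair)
qed blast

lemma check_recursion_iff: "check_recursion P t f \<longleftrightarrow> check_graph t f"
proof -
  have "(\<forall>x\<in>el t. app f x = setof {\<langle>app f y, p\<rangle> |y p. y \<epsilon> x \<and> p \<in> cond}) \<longleftrightarrow>
      (\<forall>x c. \<langle>x, c\<rangle> \<epsilon> f \<longrightarrow>
        (\<forall>z. z \<epsilon> c \<longleftrightarrow> (\<exists>y d p. y \<epsilon> x \<and> \<langle>y, d\<rangle> \<epsilon> f \<and> p \<epsilon> first P \<and> z = \<langle>d, p\<rangle>)))"
    if t: "transitive_set t" and f: "fun_on f t"
  proof -
    have dom: "\<langle>x, c\<rangle> \<epsilon> f \<longleftrightarrow> x \<epsilon> t \<and> c = app f x" for x c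
      using f by (rule fun_on_mem_iff)
    have step: "{\<langle>app f y, p\<rangle> |y p. y \<epsilon> x \<and> p \<in> cond} =
        {z. \<exists>y d p. y \<epsilon> x \<and> \<langle>y, d\<rangle> \<epsilon> f \<and> p \<epsilon> first P \<and> z = \<langle>d, p\<rangle>}" if "x \<epsilon> t" for x
      using t that unfolding dom transitive_set_def by blast
    have "app f x = setof {\<langle>app f y, p\<rangle> |y p. y \<epsilon> x \<and> p \<in> cond} \<longleftrightarrow>
        (\<forall>z. z \<epsilon> app f x \<longleftrightarrow> (\<exists>y d p. y \<epsilon> x \<and> \<langle>y, d\<rangle> \<epsilon> f \<and> p \<epsilon> first P \<and> z = \<langle>d, p\<rangle>))"
      if "x \<epsilon> t" for x
      unfolding step[OF that] unfolding eq_setof_iff[OF isset_check_step] mem_Collect_eq by (rule refl)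
    then show ?thesis unfolding dom by simp
  qed
  then show ?thesis unfolding check_recursion_def check_graph_def by blast
qed

lemma check_graph_domain: "check_graph t f \<Longrightarrow> \<langle>x, c\<rangle> \<epsilon> f \<Longrightarrow> x \<epsilon> t"
  unfolding check_graph_def using fun_on_domain by metis

lemma check_graph_ex1: "check_graph t f \<Longrightarrow> x \<epsilon> t \<Longrightarrow> \<exists>!c. \<langle>x, c\<rangle> \<epsilon> f"
  unfolding check_graph_def using fun_on_ex1 by metis

lemma check_graph_transitive: "check_graph t f \<Longrightarrow> x \<epsilon> t \<Longrightarrow> y \<epsilon> x \<Longrightarrow> y \<epsilon> t"
  unfolding check_graph_def transitive_set_def by blast

lemma check_graph_mem:
  "check_graph t f \<Longrightarrow> \<langle>x, c\<rangle> \<epsilon> f \<Longrightarrow>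
    z \<epsilon> c \<longleftrightarrow> (\<exists>y d p. y \<epsilon> x \<and> \<langle>y, d\<rangle> \<epsilon> f \<and> p \<epsilon> first P \<and> z = \<langle>d, p\<rangle>)"
  unfolding check_graph_def by blast

text \<open>At a minimal point of disagreement the two graphs agree on all elements of this point,
  so the two values have the same members.\<close>

lemma check_graph_unique:
  assumes "check_graph t f" "check_graph t' f'" "\<langle>x, c\<rangle> \<epsilon> f" "\<langle>x, d\<rangle> \<epsilon> f'"
  shows "c = d"
proof (rule ccontr)
  assume "c \<noteq> d"
  let ?B = "{x \<in> el t. x \<epsilon> t' \<and> (\<exists>c d. \<langle>x, c\<rangle> \<epsilon> f \<and> \<langle>x, d\<rangle> \<epsilon> f' \<and> c \<noteq> d)}"
  have dom: "\<langle>x, c\<rangle> \<epsilon> f \<Longrightarrow> x \<epsilon> t" "\<langle>x, c\<rangle> \<epsilon> f' \<Longrightarrow> x \<epsilon> t'" for x c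
    using assms(1,2) check_graph_domain by blast+
  have "isset ?B" by (intro isset_sep isset_el definable_intros definable_opair)
  moreover have "x \<in> ?B" using \<open>c \<noteq> d\<close> assms dom by blast
  ultimately obtain x where x: "x \<in> ?B" "el x \<inter> ?B = {}" using foundation[of ?B] by blast
  then obtain c d where cd: "\<langle>x, c\<rangle> \<epsilon> f" "\<langle>x, d\<rangle> \<epsilon> f'" "c \<noteq> d" by blast
  have agree: "\<langle>y, e\<rangle> \<epsilon> f \<longleftrightarrow> \<langle>y, e\<rangle> \<epsilon> f'" if "y \<epsilon> x" for y e
  proof -
    have "y \<epsilon> t" "y \<epsilon> t'"
      using that x check_graph_transitive[OF assms(1)] check_graph_transitive[OF assms(2)] by blast+
    then obtain u v where uv: "\<langle>y, u\<rangle> \<epsilon> f" "\<langle>y, v\<rangle> \<epsilon> f'"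
        "\<langle>y, e\<rangle> \<epsilon> f \<longrightarrow> e = u" "\<langle>y, e\<rangle> \<epsilon> f' \<longrightarrow> e = v"
      using check_graph_ex1[OF assms(1)] check_graph_ex1[OF assms(2)] by metis
    moreover have "u = v" using x(2) that uv \<open>y \<epsilon> t\<close> \<open>y \<epsilon> t'\<close> by blast
    ultimately show ?thesis by blast
  qed
  have "z \<epsilon> c \<longleftrightarrow> z \<epsilon> d" for z
    unfolding check_graph_mem[OF assms(1) cd(1)] check_graph_mem[OF assms(2) cd(2)]
    using agree by blast
  then show False using cd(3) extI by blast
qed

text \<open>Recursion along membership: the values of all partial graphs are collected on the part
  \<open>u\<close> of \<open>t\<close> where they exist. A minimal point of \<open>t\<close> outside
  \<open>u\<close> cannot exist, since the graph could be extended to it.\<close>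

lemma ex_check_graph:
  assumes t: "transitive_set t"
  shows "\<exists>f. check_graph t f"
proof -
  define val where "val y c \<longleftrightarrow> (\<exists>t f. check_graph t f \<and> \<langle>y, c\<rangle> \<epsilon> f)" for y c
  have val: "definable (\<lambda>\<rho>. val (\<rho> 0) (\<rho> (Suc 0)))"
    unfolding val_def by (intro definable_intros definable_check_graph definable_opair)
  have val_unique: "val y c \<Longrightarrow> val y d \<Longrightarrow> c = d" for y c d
    unfolding val_def using check_graph_unique by blast
  have val_mem: "z \<epsilon> c \<longleftrightarrow> (\<exists>y d p. y \<epsilon> x \<and> val y d \<and> p \<epsilon> first P \<and> z = \<langle>d, p\<rangle>)"
    and val_below: "y \<epsilon> x \<Longrightarrow> \<exists>d. val y d"
    if xc: "val x c" for x y z c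
  proof -
    obtain u f where f: "check_graph u f" "\<langle>x, c\<rangle> \<epsilon> f" using xc unfolding val_def by blast
    have "x \<epsilon> u" using f by (rule check_graph_domain)
    then have below: "\<exists>d. \<langle>y, d\<rangle> \<epsilon> f" if "y \<epsilon> x" for y
      using check_graph_transitive[OF f(1) \<open>x \<epsilon> u\<close> that] check_graph_ex1[OF f(1)] by blast
    have "val y d \<longleftrightarrow> \<langle>y, d\<rangle> \<epsilon> f" if "y \<epsilon> x" for y d
      using below[OF that] val_unique f(1) unfolding val_def by blast
    then show "z \<epsilon> c \<longleftrightarrow> (\<exists>y d p. y \<epsilon> x \<and> val y d \<and> p \<epsilon> first P \<and> z = \<langle>d, p\<rangle>)"
      unfolding check_graph_mem[OF f] by blast
    show "y \<epsilon> x \<Longrightarrow> \<exists>d. val y d" using below f(1) unfolding val_def by blast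
  qed
  have "isset {y \<in> el t. \<exists>c. val y c}"
    by (intro isset_sep isset_el definable_intros definable_comp2[OF val])
  then obtain u where u: "\<And>y. y \<epsilon> u \<longleftrightarrow> y \<epsilon> t \<and> (\<exists>c. val y c)"
    by (rule issetE) (rule that, simp)
  \<comment> \<open>No set that contains the values is known in advance, so the graph comes from
    replacement, which applies because partial graphs agree.\<close>
  have "isset {z. \<exists>y\<in>el u. \<exists>c. z = \<langle>y, c\<rangle> \<and> val y c}"
  proof (rule isset_replacement)
    show "definable (\<lambda>\<rho>. \<exists>c. \<rho> (Suc 0) = \<langle>\<rho> 0, c\<rangle> \<and> val (\<rho> 0) c)"
      by (intro definable_intros definable_opair definable_comp2[OF val])
    fix y assume "y \<in> el u"
    then obtain c where "val y c" unfolding mem_Collect_eq u by (elim conjE exE)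
    then show "\<exists>!z. \<exists>c. z = \<langle>y, c\<rangle> \<and> val y c"
      by (intro ex1I[of _ "\<langle>y, c\<rangle>"]) (auto dest: val_unique[of y c])
  qed (rule isset_el)
  then obtain F where "\<And>z. z \<epsilon> F \<longleftrightarrow> (\<exists>y\<in>el u. \<exists>c. z = \<langle>y, c\<rangle> \<and> val y c)"
    by (rule issetE) (rule that, simp)
  then have F_iff: "z \<epsilon> F \<longleftrightarrow> (\<exists>y c. y \<epsilon> u \<and> z = \<langle>y, c\<rangle> \<and> val y c)" for z by auto
  then have F: "\<langle>y, c\<rangle> \<epsilon> F \<longleftrightarrow> y \<epsilon> u \<and> val y c" for y c by auto
  have utrans: "y \<epsilon> u" if "y \<epsilon> x" "x \<epsilon> u" for x y
    using that u val_below t unfolding transitive_set_def by blast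
  have FG: "check_graph u F"
    unfolding check_graph_def
  proof (intro conjI allI impI)
    show "transitive_set u" unfolding transitive_set_def using utrans by blast
    show "fun_on F u"
    proof (rule fun_onI)
      fix x assume "x \<epsilon> u"
      then obtain c where "val x c" unfolding u by (elim conjE exE)
      then show "\<exists>!c. \<langle>x, c\<rangle> \<epsilon> F"
        unfolding F using \<open>x \<epsilon> u\<close> val_unique[of x] by (intro ex1I[of _ c]) auto
    qed (use F_iff in auto)
    fix x c z assume "\<langle>x, c\<rangle> \<epsilon> F"
    then show "z \<epsilon> c \<longleftrightarrow> (\<exists>y d p. y \<epsilon> x \<and> \<langle>y, d\<rangle> \<epsilon> F \<and> p \<epsilon> first P \<and> z = \<langle>d, p\<rangle>)"
      using val_mem[of x c z] utrans F by blast
  qed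
  have "el t \<subseteq> el u"
  proof (rule ccontr)
    assume "\<not> el t \<subseteq> el u"
    moreover have "isset {x \<in> el t. \<not> x \<epsilon> u}" by (intro isset_sep isset_el definable_intros)
    ultimately obtain x where x: "x \<epsilon> t" "\<not> x \<epsilon> u" "el x \<inter> {x \<in> el t. \<not> x \<epsilon> u} = {}"
      using foundation[of "{x \<in> el t. \<not> x \<epsilon> u}"] by blast
    have xu: "y \<epsilon> u" if "y \<epsilon> x" for y using that x t unfolding transitive_set_def by blast
    obtain c where "\<And>z. z \<epsilon> c \<longleftrightarrow> z \<in> {z. \<exists>y d p. y \<epsilon> x \<and> \<langle>y, d\<rangle> \<epsilon> F \<and> p \<epsilon> first P \<and> z = \<langle>d, p\<rangle>}"
      by (rule issetE[OF isset_check_step]) (rule that)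
    then have c: "z \<epsilon> c \<longleftrightarrow> (\<exists>y d p. y \<epsilon> x \<and> \<langle>y, d\<rangle> \<epsilon> F \<and> p \<epsilon> first P \<and> z = \<langle>d, p\<rangle>)" for z
      by blast
    have "isset (insert x (el u))" by (intro isset_insert isset_el)
    then obtain u' where u': "\<And>y. y \<epsilon> u' \<longleftrightarrow> y = x \<or> y \<epsilon> u"
      by (rule issetE) (rule that, simp)
    have "isset (insert \<langle>x, c\<rangle> (el F))" by (intro isset_insert isset_el)
    then obtain F' where F': "\<And>z. z \<epsilon> F' \<longleftrightarrow> z = \<langle>x, c\<rangle> \<or> z \<epsilon> F"
      by (rule issetE) (rule that, simp)
    have "check_graph u' F'"
      unfolding check_graph_def
    proof (intro conjI allI impI)
      have below: "w \<epsilon> u" if "w \<epsilon> y" "y \<epsilon> u'" for w y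
      proof (cases "y = x")
        case True then show ?thesis using xu \<open>w \<epsilon> y\<close> by simp
      next
        case False
        then have "y \<epsilon> u" using \<open>y \<epsilon> u'\<close> by (simp add: u')
        then show ?thesis by (rule utrans[OF \<open>w \<epsilon> y\<close>])
      qed
      then show "transitive_set u'"
        unfolding transitive_set_def by (intro ballI subsetI) (simp add: u')
      have ex1: "\<exists>!e. \<langle>y, e\<rangle> \<epsilon> F'" if "y \<epsilon> u'" for y
      proof (cases "y = x")
        case True then show ?thesis unfolding F' F using x(2) by auto
      next
        case False
        then have "y \<epsilon> u" using that by (simp add: u')
        then show ?thesis using check_graph_ex1[OF FG] False by (simp add: F')
      qed
      show "fun_on F' u'"
      proof (rule fun_onI)
        show "\<exists>x y. z = \<langle>x, y\<rangle>" if "z \<epsilon> F'" for z using that F_iff F' by blast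
        show "y \<epsilon> u'" if "\<langle>y, e\<rangle> \<epsilon> F'" for y e using that unfolding F' F u' by auto
      qed (rule ex1)
      fix y e z assume ye: "\<langle>y, e\<rangle> \<epsilon> F'"
      have agree: "\<langle>w, d\<rangle> \<epsilon> F' \<longleftrightarrow> \<langle>w, d\<rangle> \<epsilon> F" if "w \<epsilon> y" for w d
      proof -
        have "y \<epsilon> u'" using ye by (auto simp: F' F u')
        then have "w \<noteq> x" using below that x(2) by blast
        then show ?thesis by (simp add: F')
      qed
      show "z \<epsilon> e \<longleftrightarrow> (\<exists>w d p. w \<epsilon> y \<and> \<langle>w, d\<rangle> \<epsilon> F' \<and> p \<epsilon> first P \<and> z = \<langle>d, p\<rangle>)"
      proof (cases "\<langle>y, e\<rangle> \<epsilon> F")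
        case True
        then have "z \<epsilon> e \<longleftrightarrow> (\<exists>w d p. w \<epsilon> y \<and> \<langle>w, d\<rangle> \<epsilon> F \<and> p \<epsilon> first P \<and> z = \<langle>d, p\<rangle>)"
          by (rule check_graph_mem[OF FG])
        then show ?thesis using agree by blast
      next
        case False
        then have "y = x" "e = c" using ye F' by auto
        then show ?thesis using c agree by blast
      qed
    qed
    then have "val x c" unfolding val_def using F' by blast
    then show False using x u by blast
  qed
  then have "t = u" using u by (intro extI) blast
  then show ?thesis using FG by blast
qed

lemma check_eq:
  assumes "check_graph t f" "\<langle>x, c\<rangle> \<epsilon> f" shows "check P x = c"
  unfolding check_def check_recursion_iff
proof (rule the_equality)
  have fx: "\<langle>x, app f x\<rangle> \<epsilon> f" if "check_graph t f" "x \<epsilon> t" for t f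
    using that app_eq unfolding check_graph_def by metis
  have "x \<epsilon> t" using assms by (rule check_graph_domain)
  then show "\<exists>t f. check_graph t f \<and> x \<epsilon> t \<and> c = app f x"
    using assms fx check_graph_unique by blast
  show "\<exists>t f. check_graph t f \<and> x \<epsilon> t \<and> d = app f x \<Longrightarrow> d = c" for d
    using assms fx check_graph_unique by blast
qed

text \<open>Supplies the canonical names over \<open>succ reals\<close> as a set, which stands for
  \<open>check\<close> in definability proofs.\<close>

lemma ex_check_set:
  "\<exists>f. \<forall>x c. \<langle>x, c\<rangle> \<epsilon> f \<longleftrightarrow> x \<epsilon> succ reals \<and> c = check P x"
proof -
  obtain f where f: "check_graph (succ reals) f"
    using ex_check_graph transitive_succ_reals by blast
  have "\<langle>x, c\<rangle> \<epsilon> f \<longleftrightarrow> x \<epsilon> succ reals \<and> c = check P x" for x c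
  proof
    assume "\<langle>x, c\<rangle> \<epsilon> f"
    then show "x \<epsilon> succ reals \<and> c = check P x"
      using check_graph_domain[OF f] check_eq[OF f] by blast
  next
    assume x: "x \<epsilon> succ reals \<and> c = check P x"
    then obtain d where "\<langle>x, d\<rangle> \<epsilon> f" using check_graph_ex1[OF f] by blast
    then show "\<langle>x, c\<rangle> \<epsilon> f" using check_eq[OF f] x by blast
  qed
  then show ?thesis by blast
qed

lemma mem_check:
  assumes "x \<epsilon> succ reals"
  shows "z \<epsilon> check P x \<longleftrightarrow> (\<exists>y p. y \<epsilon> x \<and> p \<epsilon> first P \<and> z = \<langle>check P y, p\<rangle>)"
proof -
  obtain f where f: "check_graph (succ reals) f"
    using ex_check_graph transitive_succ_reals by blast
  obtain c where c: "\<langle>x, c\<rangle> \<epsilon> f" using check_graph_ex1[OF f assms] by blast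
  have *: "\<exists>d. \<langle>y, d\<rangle> \<epsilon> f" if "y \<epsilon> x" for y
    using check_graph_ex1[OF f check_graph_transitive[OF f assms that]] by blast
  have "z \<epsilon> c \<longleftrightarrow> (\<exists>y d p. y \<epsilon> x \<and> \<langle>y, d\<rangle> \<epsilon> f \<and> p \<epsilon> first P \<and> z = \<langle>d, p\<rangle>)"
    by (rule check_graph_mem[OF f c])
  then show ?thesis using * check_eq[OF f] c by metis
qed

lemma pair_mem_check:
  "x \<epsilon> succ reals \<Longrightarrow> \<langle>\<sigma>, p\<rangle> \<epsilon> check P x \<longleftrightarrow> p \<epsilon> first P \<and> (\<exists>y. y \<epsilon> x \<and> \<sigma> = check P y)"
  unfolding mem_check by auto

lemma succ_reals_below: "y \<epsilon> x \<Longrightarrow> x \<epsilon> succ reals \<Longrightarrow> y \<epsilon> succ reals"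
  using transitive_succ_reals unfolding transitive_set_def by blast

lemma ex_check_names:
  "\<exists>T. name_closed P T \<and> (\<forall>x. x \<epsilon> succ reals \<longrightarrow> check P x \<epsilon> T)"
proof -
  obtain f where f: "\<And>x c. \<langle>x, c\<rangle> \<epsilon> f \<longleftrightarrow> x \<epsilon> succ reals \<and> c = check P x"
    using ex_check_set by blast
  obtain T where T: "\<And>c. c \<epsilon> T \<longleftrightarrow> (\<exists>x. \<langle>x, c\<rangle> \<epsilon> f)"
    by (rule issetE[OF isset_range[of f]]) (rule that, simp)
  have "name_closed P T"
    unfolding name_closed_def
  proof (intro ballI)
    fix c z assume "c \<in> el T" "z \<in> el c"
    then obtain x where x: "x \<epsilon> succ reals" "c = check P x" using T f by blast
    then obtain y p where "y \<epsilon> x" "p \<in> cond" "z = \<langle>check P y, p\<rangle>"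
      using \<open>z \<in> el c\<close> mem_check by blast
    moreover from this have "check P y \<in> el T" using T f succ_reals_below x(1) by blast
    ultimately show "\<exists>\<sigma>\<in>el T. \<exists>p\<in>cond. z = \<langle>\<sigma>, p\<rangle>" by blast
  qed
  then show ?thesis using T f by blast
qed

lemma is_name_check: "x \<epsilon> succ reals \<Longrightarrow> is_name P (check P x)"
  using ex_check_names is_nameI by blast

lemma forces_eq_check_half:
  assumes "x \<epsilon> succ reals" "y \<epsilon> succ reals" "p \<epsilon> first P"
    and "forces_eq P p (check P x) (check P y)" "z \<epsilon> x"
  shows "\<exists>w q. w \<epsilon> y \<and> q \<preceq> p \<and> forces_eq P q (check P z) (check P w)"
proof -
  have "forces_half (forces_eq P) p (check P x) (check P y)"
    using assms forces_eq_unfold is_name_check unfolding forces_both_def by blast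
  moreover have "\<langle>check P z, p\<rangle> \<epsilon> check P x" using assms pair_mem_check by blast
  ultimately obtain q where "q \<preceq> p"
      "q \<preceq> p \<longrightarrow> (\<exists>\<tau> t. \<langle>\<tau>, t\<rangle> \<epsilon> check P y \<and> q \<preceq> t \<and> forces_eq P q (check P z) \<tau>)"
    unfolding forces_half_def dense_below_iff using stronger_refl[OF assms(3)] by blast
  then obtain \<tau> t where "\<langle>\<tau>, t\<rangle> \<epsilon> check P y" "forces_eq P q (check P z) \<tau>" by blast
  moreover from this obtain w where "w \<epsilon> y" "\<tau> = check P w"
    using pair_mem_check[OF assms(2)] by auto
  ultimately show ?thesis using \<open>q \<preceq> p\<close> by blast
qed

text \<open>Consider a minimal \<open>x\<close> whose name some condition forces to equal the name
  of a different \<open>y\<close>. Elements of \<open>x\<close> and \<open>y\<close> are matched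
  below stronger conditions, so by minimality the two sets have the same elements.\<close>

lemma forces_eq_check_inject:
  assumes "x \<epsilon> succ reals" "y \<epsilon> succ reals" "p \<epsilon> first P"
    and "forces_eq P p (check P x) (check P y)"
  shows "x = y"
proof (rule ccontr)
  assume "x \<noteq> y"
  obtain f where f: "\<And>x c. \<langle>x, c\<rangle> \<epsilon> f \<longleftrightarrow> x \<epsilon> succ reals \<and> c = check P x"
    using ex_check_set by blast
  obtain T F where F: "eq_recursion P T F" "\<And>x. x \<epsilon> succ reals \<Longrightarrow> check P x \<epsilon> T"
    using ex_check_names ex_eq_recursion by metis
  \<comment> \<open>The graph \<open>f\<close> and the solution \<open>F\<close> replace
    \<open>check\<close> and \<open>forces_eq\<close> so that separation applies. The condition is
    quantified inside because the matching of elements passes to stronger ones.\<close>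
  let ?B = "{x \<in> el (succ reals). \<exists>y\<in>el (succ reals). \<exists>p\<in>cond. \<exists>c d. x \<noteq> y \<and>
    \<langle>x, c\<rangle> \<epsilon> f \<and> \<langle>y, d\<rangle> \<epsilon> f \<and> \<langle>p, \<langle>c, d\<rangle>\<rangle> \<epsilon> F}"
  have B: "x \<in> ?B \<longleftrightarrow> x \<epsilon> succ reals \<and> (\<exists>y p. y \<epsilon> succ reals \<and> p \<epsilon> first P \<and> x \<noteq> y \<and>
      forces_eq P p (check P x) (check P y))" for x
    unfolding f using forces_eq_iff[OF F(1) F(2) F(2)] by blast
  have "isset ?B"
    by (intro isset_sep isset_el definable_intros definable_opair)
  moreover have "x \<in> ?B" unfolding B using assms \<open>x \<noteq> y\<close> by blast
  ultimately obtain x where x: "x \<in> ?B" "el x \<inter> ?B = {}" using foundation[of ?B] by blast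
  then obtain y p where yp: "x \<epsilon> succ reals" "y \<epsilon> succ reals" "p \<epsilon> first P" "x \<noteq> y"
    "forces_eq P p (check P x) (check P y)" unfolding B by blast
  have min: "z = w" if "z \<epsilon> x" "w \<epsilon> y" "q \<preceq> p" "forces_eq P q (check P z) (check P w)" for z w q
  proof (rule ccontr)
    assume "z \<noteq> w"
    then have "z \<in> ?B" unfolding B using that succ_reals_below yp stronger_cond by blast
    then show False using x(2) that(1) by blast
  qed
  have "z \<epsilon> x \<longleftrightarrow> z \<epsilon> y" for z
  proof
    assume "z \<epsilon> x"
    then show "z \<epsilon> y" using forces_eq_check_half[OF yp(1,2,3,5)] min by blast
  next
    assume "z \<epsilon> y"
    moreover have "forces_eq P p (check P y) (check P x)"
      using yp forces_eq_sym is_name_check by blast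
    ultimately obtain w q where w: "w \<epsilon> x" "q \<preceq> p" "forces_eq P q (check P z) (check P w)"
      using forces_eq_check_half[OF yp(2,1,3)] by blast
    then have "forces_eq P q (check P w) (check P z)"
      using forces_eq_sym[OF _ _ stronger_cond(1)[OF w(2)] w(3)] is_name_check
        succ_reals_below[OF \<open>z \<epsilon> y\<close> yp(2)] succ_reals_below[OF w(1) yp(1)] by simp
    then show "z \<epsilon> x" using min w \<open>z \<epsilon> y\<close> by blast
  qed
  then show False using yp(4) extI by blast
qed

lemma is_name_subset_check_omega:
  assumes "el \<tau> \<subseteq> el (check P omega)"
  shows "is_name P \<tau>"
proof -
  obtain T where T: "name_closed P T" "\<And>x. x \<epsilon> succ reals \<Longrightarrow> check P x \<epsilon> T"
    using ex_check_names by blast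
  have "isset (insert \<tau> (el T))" by (intro isset_insert isset_el)
  then obtain U where U: "\<And>x. x \<epsilon> U \<longleftrightarrow> x = \<tau> \<or> x \<epsilon> T"
    by (rule issetE) (rule that, simp)
  have "name_closed P U"
    unfolding name_closed_def
  proof (intro ballI)
    fix x z assume x: "x \<in> el U" and z: "z \<in> el x"
    obtain x' where x': "x' \<epsilon> T" "z \<epsilon> x'"
    proof (cases "x = \<tau>")
      case True
      then have "z \<epsilon> check P omega" using z assms by blast
      then show ?thesis using that T(2) mem_succ_reals(2) by blast
    next
      case False
      then show ?thesis using that x z U by simp
    qed
    then obtain \<sigma> p where "\<sigma> \<epsilon> T" "p \<in> cond" "z = \<langle>\<sigma>, p\<rangle>"
      using T(1) unfolding name_closed_def by blast
    then show "\<exists>\<sigma>\<in>el U. \<exists>p\<in>cond. z = \<langle>\<sigma>, p\<rangle>" by (simp add: U)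
  qed
  then show ?thesis by (rule is_nameI) (simp add: U)
qed

subsection \<open>Adding no new reals\<close>

text \<open>This is what the inner universal formula of \<open>no_new_reals\<close> unfolds to when
  \<tau> is the name under consideration.\<close>

definition forces_subset_omega :: "'a \<Rightarrow> 'a \<Rightarrow> bool" where
  "forces_subset_omega p \<tau> \<longleftrightarrow> (\<forall>\<sigma>. is_name P \<sigma> \<longrightarrow> (\<forall>q. q \<preceq> p \<longrightarrow> forces_mem P q \<sigma> \<tau> \<longrightarrow>
     (\<exists>r. r \<preceq> q \<and> forces_mem P r \<sigma> (check P omega))))"

text \<open>Implication abbreviates a combination of negations and conjunction, and the two
  negations cost a passage from \<open>q\<close> to a stronger \<open>r\<close>.\<close>

lemma forces_Imp:
  "forces P p \<rho> (Imp \<phi> \<psi>) \<longleftrightarrow>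
     (\<forall>q. q \<preceq> p \<longrightarrow> forces P q \<rho> \<phi> \<longrightarrow> (\<exists>r. r \<preceq> q \<and> forces P r \<rho> \<psi>))"
  using stronger_cond(1) by (simp add: Ball_def) blast

lemma no_new_reals_iff:
  "no_new_reals P \<longleftrightarrow> (\<forall>p\<in>cond. \<forall>\<tau>. is_name P \<tau> \<longrightarrow>
     (\<forall>q. q \<preceq> p \<longrightarrow> forces_mem P q \<tau> (check P reals) \<longrightarrow> (\<exists>r. r \<preceq> q \<and> forces_subset_omega r \<tau>)) \<and>
     (\<forall>q. q \<preceq> p \<longrightarrow> forces_subset_omega q \<tau> \<longrightarrow> (\<exists>r. r \<preceq> q \<and> forces_mem P r \<tau> (check P reals))))"
  unfolding no_new_reals_def forces_subset_omega_def
  by (simp only: forces_Imp forces.simps(1,4,5) eval_nat_numeral One_nat_def nat.case BitM.simps)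

lemma forces_mem_reals:
  assumes "forces_mem P p \<tau> (check P reals)" "p \<epsilon> first P"
  shows "\<exists>q x. q \<preceq> p \<and> el x \<subseteq> el omega \<and> forces_eq P q \<tau> (check P x)"
proof -
  obtain q \<sigma> t where q: "q \<preceq> p" "\<langle>\<sigma>, t\<rangle> \<epsilon> check P reals" "forces_eq P q \<tau> \<sigma>"
    using assms stronger_refl unfolding forces_mem_def dense_below_iff by blast
  then obtain x where "x \<epsilon> reals" "\<sigma> = check P x"
    using pair_mem_check[of reals] by auto
  then show ?thesis using q mem_reals by blast
qed

lemma forces_mem_check:
  assumes "is_name P \<tau>" "x \<epsilon> succ reals" "y \<epsilon> x" "p \<epsilon> first P" "forces_eq P p \<tau> (check P y)"
  shows "forces_mem P p \<tau> (check P x)"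
  unfolding forces_mem_def dense_below_iff
proof (intro allI impI)
  fix q assume q: "q \<preceq> p"
  have y: "is_name P (check P y)" using is_name_check succ_reals_below assms by blast
  have "\<langle>check P y, q\<rangle> \<epsilon> check P x"
    using pair_mem_check[OF assms(2)] assms(3) stronger_cond(1)[OF q] by blast
  moreover have "q \<preceq> q" using stronger_cond(1)[OF q] by simp
  moreover have "forces_eq P q \<tau> (check P y)"
    using forces_eq_stronger[OF assms(1) y assms(5) q] .
  ultimately show "\<exists>r. r \<preceq> q \<and> (\<exists>\<sigma> t. \<langle>\<sigma>, t\<rangle> \<epsilon> check P x \<and> r \<preceq> t \<and> forces_eq P r \<tau> \<sigma>)"
    by blast
qed

text \<open>Once \<tau> is identified with the name of a ground model set \<open>x\<close>,
  transitivity of forced equality turns any forced element of \<tau> into the name of a natural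
  number. This direction of the forced equivalence holds for every order.\<close>

lemma forces_subset_omega_reals:
  assumes \<tau>: "is_name P \<tau>" and "q \<epsilon> first P" "forces_mem P q \<tau> (check P reals)"
  shows "\<exists>r. r \<preceq> q \<and> forces_subset_omega r \<tau>"
proof -
  obtain r x where r: "r \<preceq> q" "el x \<subseteq> el omega" "forces_eq P r \<tau> (check P x)"
    using forces_mem_reals assms by blast
  have rP: "r \<epsilon> first P" using r(1) by (rule stronger_cond)
  have x: "x \<epsilon> succ reals" using r(2) mem_reals by simp
  have half: "forces_half (forces_eq P) r \<tau> (check P x)"
    using forces_eq_unfold[OF \<tau> is_name_check[OF x] rP] r(3) unfolding forces_both_def by blast
  have "forces_subset_omega r \<tau>"
    unfolding forces_subset_omega_def
  proof (intro allI impI)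
    fix \<sigma> q assume \<sigma>: "is_name P \<sigma>" and q: "q \<preceq> r" "forces_mem P q \<sigma> \<tau>"
    have "q \<preceq> q" using q(1) stronger_cond(1) by simp
    then obtain q1 \<rho> s where q1: "q1 \<preceq> q" "\<langle>\<rho>, s\<rangle> \<epsilon> \<tau>" "q1 \<preceq> s" "forces_eq P q1 \<sigma> \<rho>"
      using q(2) unfolding forces_mem_def dense_below_iff by blast
    have "q1 \<preceq> r" using q1(1) q(1) by (rule stronger_trans)
    then obtain q2 where q2: "q2 \<preceq> q1" "q2 \<preceq> s \<longrightarrow>
        (\<exists>\<upsilon> u. \<langle>\<upsilon>, u\<rangle> \<epsilon> check P x \<and> q2 \<preceq> u \<and> forces_eq P q2 \<rho> \<upsilon>)"
      using half q1(2) unfolding forces_half_def dense_below_iff by blast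
    then obtain \<upsilon> u where \<upsilon>: "\<langle>\<upsilon>, u\<rangle> \<epsilon> check P x" "forces_eq P q2 \<rho> \<upsilon>"
      using stronger_trans[OF q2(1) q1(3)] by blast
    then obtain n where n: "n \<epsilon> x" "\<upsilon> = check P n" using pair_mem_check[OF x] by auto
    have q2P: "q2 \<epsilon> first P" using q2(1) by (rule stronger_cond)
    have \<rho>: "is_name P \<rho>" using is_name_component[OF \<tau> q1(2)] .
    have \<upsilon>_name: "is_name P \<upsilon>" using is_name_component[OF is_name_check[OF x] \<upsilon>(1)] .
    have "forces_eq P q2 \<sigma> (check P n)"
      using forces_eq_trans[OF \<sigma> \<rho> \<upsilon>_name q2P forces_eq_stronger[OF \<sigma> \<rho> q1(4) q2(1)] \<upsilon>(2)] n by simp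
    moreover have "n \<epsilon> omega" using n r(2) by blast
    ultimately have "forces_mem P q2 \<sigma> (check P omega)"
      using forces_mem_check[OF \<sigma> mem_succ_reals(2) _ q2P] by blast
    moreover have "q2 \<preceq> q" using q2(1) q1(1) by (rule stronger_trans)
    ultimately show "\<exists>r. r \<preceq> q \<and> forces_mem P r \<sigma> (check P omega)" by blast
  qed
  then show ?thesis using r(1) by blast
qed

lemma no_new_realsI:
  assumes "\<And>\<tau> q. is_name P \<tau> \<Longrightarrow> q \<epsilon> first P \<Longrightarrow> forces_subset_omega q \<tau> \<Longrightarrow>
    \<exists>r x. r \<preceq> q \<and> el x \<subseteq> el omega \<and> forces_eq P r \<tau> (check P x)"
  shows "no_new_reals P"
  unfolding no_new_reals_iff
proof (intro ballI allI impI conjI)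
  fix \<tau> q p assume \<tau>: "is_name P \<tau>" and "q \<preceq> p"
  then have q: "q \<epsilon> first P" by (intro stronger_cond)
  show "forces_mem P q \<tau> (check P reals) \<Longrightarrow> \<exists>r. r \<preceq> q \<and> forces_subset_omega r \<tau>"
    using \<tau> q by (rule forces_subset_omega_reals)
  assume "forces_subset_omega q \<tau>"
  then obtain r x where "r \<preceq> q" "el x \<subseteq> el omega" "forces_eq P r \<tau> (check P x)"
    using assms[OF \<tau> q] by blast
  moreover have "reals \<epsilon> succ reals" by simp
  ultimately have "forces_mem P r \<tau> (check P reals)"
    using forces_mem_check[OF \<tau>] stronger_cond(1) mem_reals by blast
  then show "\<exists>r. r \<preceq> q \<and> forces_mem P r \<tau> (check P reals)" using \<open>r \<preceq> q\<close> by blast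
qed

text \<open>One graph of canonical names and one solution on a set of names that includes \<tau> are
  fixed as parameters. The resulting relation has the right truth values on conditions and natural
  numbers, where it is used.\<close>

lemma definable_forces_mem_check:
  assumes "is_name P \<tau>"
  shows "\<exists>R. definable (\<lambda>\<rho>. R (\<rho> 0) (\<rho> (Suc 0))) \<and>
    (\<forall>p n. p \<epsilon> first P \<longrightarrow> n \<epsilon> omega \<longrightarrow> (R p n \<longleftrightarrow> forces_mem P p (check P n) \<tau>))"
proof -
  obtain f where f: "\<And>x c. \<langle>x, c\<rangle> \<epsilon> f \<longleftrightarrow> x \<epsilon> succ reals \<and> c = check P x"
    using ex_check_set by blast
  obtain T where T: "name_closed P T" "\<And>x. x \<epsilon> succ reals \<Longrightarrow> check P x \<epsilon> T" "\<tau> \<epsilon> T"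
    using ex_check_names name_closed_Un assms unfolding is_name_def by metis
  obtain F where F: "eq_recursion P T F" using ex_eq_recursion[OF T(1)] by blast
  let ?R = "\<lambda>p n. \<exists>c. \<langle>n, c\<rangle> \<epsilon> f \<and>
    dense_below P p (\<lambda>q. \<exists>\<sigma> s. \<langle>\<sigma>, s\<rangle> \<epsilon> \<tau> \<and> q \<preceq> s \<and> \<langle>q, \<langle>c, \<sigma>\<rangle>\<rangle> \<epsilon> F)"
  have "definable (\<lambda>\<rho>. ?R (\<rho> 0) (\<rho> (Suc 0)))"
    by (intro definable_intros definable_opair definable_dense_below definable_stronger)
  moreover have "?R p n \<longleftrightarrow> forces_mem P p (check P n) \<tau>" if n: "n \<epsilon> omega" for p n
  proof -
    have "(\<exists>\<sigma> s. \<langle>\<sigma>, s\<rangle> \<epsilon> \<tau> \<and> q \<preceq> s \<and> \<langle>q, \<langle>check P n, \<sigma>\<rangle>\<rangle> \<epsilon> F) \<longleftrightarrow>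
        (\<exists>\<sigma> s. \<langle>\<sigma>, s\<rangle> \<epsilon> \<tau> \<and> q \<preceq> s \<and> forces_eq P q (check P n) \<sigma>)" for q
      using forces_eq_iff[OF F T(2)[OF mem_succ_reals(1)[OF n]]] name_closedD(1)[OF T(1,3)]
        stronger_cond(1) by blast
    then show ?thesis
      unfolding f forces_mem_def using mem_succ_reals(1)[OF n] by auto
  qed
  ultimately show ?thesis by (intro exI[of _ ?R]) blast
qed

text \<open>A component of \<tau> is forced, below a stronger condition, to be some
  \<open>n\<close>. Since \<open>p\<close> already decides membership of \<open>n\<close>, that
  condition can only agree with \<open>p\<close>, which puts \<open>n\<close> into \<open>x\<close>.
  Hence \<open>p\<close> itself forces the equality.\<close>

lemma forces_eq_decided:
  assumes \<tau>: "is_name P \<tau>" and p: "p \<epsilon> first P" and sub: "forces_subset_omega p \<tau>"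
    and dec: "\<And>n. n \<epsilon> omega \<Longrightarrow> forces_mem P p (check P n) \<tau> \<or>
      (\<forall>q. q \<preceq> p \<longrightarrow> \<not> forces_mem P q (check P n) \<tau>)"
    and x: "\<And>n. n \<epsilon> x \<longleftrightarrow> n \<epsilon> omega \<and> forces_mem P p (check P n) \<tau>"
  shows "forces_eq P p \<tau> (check P x)"
proof -
  have xr: "x \<epsilon> succ reals" using x mem_reals by auto
  have half1: "forces_half (forces_eq P) p \<tau> (check P x)"
    unfolding forces_half_def dense_below_iff
  proof (intro allI impI)
    fix \<sigma> s q assume \<sigma>: "\<langle>\<sigma>, s\<rangle> \<epsilon> \<tau>" and q: "q \<preceq> p"
    have \<sigma>_name: "is_name P \<sigma>" using is_name_component[OF \<tau> \<sigma>] .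
    show "\<exists>r. r \<preceq> q \<and> (r \<preceq> s \<longrightarrow> (\<exists>\<tau> t. \<langle>\<tau>, t\<rangle> \<epsilon> check P x \<and> r \<preceq> t \<and> forces_eq P r \<sigma> \<tau>))"
    proof (cases "\<exists>q'. q' \<preceq> q \<and> q' \<preceq> s")
      case False
      then show ?thesis using stronger_refl[OF stronger_cond(1)[OF q]] by blast
    next
      case True
      then obtain q1 where q1: "q1 \<preceq> q" "q1 \<preceq> s" by blast
      have q1p: "q1 \<preceq> p" using q1(1) q by (rule stronger_trans)
      have "forces_mem P q1 \<sigma> \<tau>"
        unfolding forces_mem_def dense_below_iff
        using \<sigma> stronger_trans[OF _ q1(2)] forces_eq_refl[OF \<sigma>_name] stronger_refl stronger_cond(1)
        by meson
      then obtain q2 where q2: "q2 \<preceq> q1" "forces_mem P q2 \<sigma> (check P omega)"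
        using sub \<sigma>_name q1p unfolding forces_subset_omega_def by blast
      then obtain q3 \<upsilon> u where q3: "q3 \<preceq> q2" "\<langle>\<upsilon>, u\<rangle> \<epsilon> check P omega" "forces_eq P q3 \<sigma> \<upsilon>"
        using stronger_refl[OF stronger_cond(1)[OF q2(1)]]
        unfolding forces_mem_def dense_below_iff by blast
      then obtain n where n: "n \<epsilon> omega" "\<upsilon> = check P n"
        using pair_mem_check[OF mem_succ_reals(2)] by auto
      have n_name: "is_name P (check P n)" using is_name_check mem_succ_reals(1) n by blast
      have q3P: "q3 \<epsilon> first P" using q3(1) by (rule stronger_cond)
      have q3q1: "q3 \<preceq> q1" using q3(1) q2(1) by (rule stronger_trans)
      have q3p: "q3 \<preceq> p" using q3q1 q1p by (rule stronger_trans)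
      have q3s: "q3 \<preceq> s" using q3q1 q1(2) by (rule stronger_trans)
      have eq: "forces_eq P q3 (check P n) \<sigma>"
        using forces_eq_sym[OF \<sigma>_name n_name q3P] q3(3) n(2) by simp
      have "forces_mem P q3 (check P n) \<tau>"
        unfolding forces_mem_def dense_below_iff
        using \<sigma> stronger_trans[OF _ q3s] forces_eq_stronger[OF n_name \<sigma>_name eq]
          stronger_refl stronger_cond(1)
        by meson
      then have "n \<epsilon> x" using dec[OF n(1)] q3p n(1) x by blast
      then have "\<langle>check P n, q3\<rangle> \<epsilon> check P x" using pair_mem_check[OF xr] q3P by blast
      moreover have "q3 \<preceq> q" using q3q1 q1(1) by (rule stronger_trans)
      ultimately show ?thesis using q3(3) n(2) stronger_refl[OF q3P] by blast
    qed
  qed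
  have half2: "forces_half (\<lambda>q \<tau> \<sigma>. forces_eq P q \<sigma> \<tau>) p (check P x) \<tau>"
    unfolding forces_half_def dense_below_iff
  proof (intro allI impI)
    fix \<sigma> s q assume \<sigma>: "\<langle>\<sigma>, s\<rangle> \<epsilon> check P x" and q: "q \<preceq> p"
    then obtain n where n: "n \<epsilon> x" "\<sigma> = check P n" using pair_mem_check[OF xr] by auto
    have \<sigma>_name: "is_name P \<sigma>" using is_name_component[OF is_name_check[OF xr] \<sigma>] .
    obtain r \<upsilon> u where r: "r \<preceq> q" "\<langle>\<upsilon>, u\<rangle> \<epsilon> \<tau>" "r \<preceq> u" "forces_eq P r \<sigma> \<upsilon>"
      using x n q unfolding forces_mem_def dense_below_iff by blast
    then have "forces_eq P r \<upsilon> \<sigma>"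
      using forces_eq_sym[OF \<sigma>_name is_name_component[OF \<tau> r(2)]] stronger_cond(1) by blast
    then show "\<exists>r. r \<preceq> q \<and> (r \<preceq> s \<longrightarrow> (\<exists>\<upsilon> u. \<langle>\<upsilon>, u\<rangle> \<epsilon> \<tau> \<and> r \<preceq> u \<and> forces_eq P r \<upsilon> \<sigma>))"
      using r by blast
  qed
  show ?thesis
    unfolding forces_eq_unfold[OF \<tau> is_name_check[OF xr] p] forces_both_def
    using half1 half2 by (rule conjI)
qed

section \<open>From distributivity to no new reals\<close>

lemma distributive_imp_no_new_reals:
  assumes dist: "distributive omega omega (ro P)"
  shows "no_new_reals P"
proof (rule no_new_realsI)
  fix \<tau> p assume \<tau>: "is_name P \<tau>" and p: "p \<epsilon> first P" and sub: "forces_subset_omega p \<tau>"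
  obtain R where R: "definable (\<lambda>\<rho>. R (\<rho> 0) (\<rho> (Suc 0)))"
    and R_iff: "\<And>p n. p \<epsilon> first P \<Longrightarrow> n \<epsilon> omega \<Longrightarrow> R p n \<longleftrightarrow> forces_mem P p (check P n) \<tau>"
    using definable_forces_mem_check[OF \<tau>] by blast
  define yes where "yes n = {p \<in> cond. R p n}" for n
  define no where "no n = {p \<in> cond. \<forall>q. q \<preceq> p \<longrightarrow> \<not> R q n}" for n
  have yes_iff: "yes n = {p \<in> cond. forces_mem P p (check P n) \<tau>}" if "n \<epsilon> omega" for n
    unfolding yes_def using R_iff[OF _ that] by auto
  have no_iff: "no n = {p \<in> cond. \<forall>q. q \<preceq> p \<longrightarrow> q \<notin> yes n}" for n
    unfolding no_def yes_def using stronger_cond(1) by auto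
  have yes_regular: "regular_open (yes n)" if "n \<epsilon> omega" for n
    unfolding yes_iff[OF that] forces_mem_def by (rule regular_open_dense_below)
  have no_regular: "regular_open (no n)" if "n \<epsilon> omega" for n
    unfolding no_iff
    using regular_open_incompatible regular_open_stronger[OF yes_regular[OF that]] by blast
  have yes_set: "isset (yes n)" and no_set: "isset (no n)" for n
    unfolding yes_def no_def
    by (intro isset_sep isset_el definable_comp2[OF R] definable_intros definable_stronger)+
  \<comment> \<open>The members of the partition for \<open>n\<close> are described by formulas in
    \<open>R\<close>, as definability of the sequence requires. The zero element is left out: if one
    of the two truth values is zero, the partition has a single member.\<close>
  define dec where "dec n u \<longleftrightarrow> u \<in> el (regular_opens P) \<and> u \<noteq> empty \<and>
      ((\<forall>p. p \<epsilon> u \<longleftrightarrow> p \<epsilon> first P \<and> R p n) \<or>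
       (\<forall>p. p \<epsilon> u \<longleftrightarrow> p \<epsilon> first P \<and> (\<forall>q. q \<preceq> p \<longrightarrow> \<not> R q n)))" for n u
  have dec_iff: "dec n u \<longleftrightarrow> u \<epsilon> regular_opens P \<and> u \<noteq> empty \<and> (el u = yes n \<or> el u = no n)" for n u
    unfolding dec_def yes_def no_def set_eq_iff by simp
  have dec_set: "isset {u. dec n u}" for n
  proof -
    have "isset {u \<in> el (regular_opens P). u \<noteq> empty \<and>
        ((\<forall>p. p \<epsilon> u \<longleftrightarrow> p \<epsilon> first P \<and> R p n) \<or>
         (\<forall>p. p \<epsilon> u \<longleftrightarrow> p \<epsilon> first P \<and> (\<forall>q. q \<preceq> p \<longrightarrow> \<not> R q n)))}"
      by (intro isset_sep isset_el definable_intros definable_stronger definable_comp2[OF R])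
    then show ?thesis unfolding dec_def by simp
  qed
  define W where "W n = setof {u. dec n u}" for n
  have W: "u \<epsilon> W n \<longleftrightarrow> dec n u" for u n
    unfolding W_def by (simp add: mem_setof[OF dec_set])
  have "\<exists>f. fun_on f omega \<and> (\<forall>n\<in>el omega. app f n = W n)"
  proof (rule ex_fun)
    show "isset {w. el w \<subseteq> el (regular_opens P)}" by (intro isset_Pow isset_el)
    show "W n \<in> {w. el w \<subseteq> el (regular_opens P)}" for n
      unfolding mem_Collect_eq W dec_iff by blast
    show "definable (\<lambda>\<rho>. \<forall>u. u \<epsilon> \<rho> (Suc 0) \<longleftrightarrow> dec (\<rho> 0) u)"
      unfolding dec_def mem_Collect_eq
      by (intro definable_intros definable_stronger definable_comp2[OF R])
    show "(\<forall>u. u \<epsilon> w \<longleftrightarrow> dec n u) \<longleftrightarrow> w = W n" for n w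
      unfolding W_def eq_setof_iff[OF dec_set] by simp
  qed
  then obtain f where f: "fun_on f omega" "\<And>n. n \<epsilon> omega \<Longrightarrow> app f n = W n" by blast
  have partition: "is_partition (ro P) (W n)" if n: "n \<epsilon> omega" for n
    unfolding is_partition_ro_iff
  proof (intro conjI ballI impI)
    fix u assume u: "u \<in> el (W n)"
    show "regular_open (el u)" using u unfolding mem_Collect_eq W dec_iff mem_regular_opens by blast
    show "el u \<noteq> {}" using u unfolding mem_Collect_eq W dec_iff by (auto simp: eq_empty_iff)
  next
    fix u v assume uv: "u \<in> el (W n)" "v \<in> el (W n)" "u \<noteq> v"
    have "el u \<noteq> el v" using uv(3) extensionality by blast
    then have "el u = yes n \<and> el v = no n \<or> el u = no n \<and> el v = yes n"
      using uv(1,2) unfolding mem_Collect_eq W dec_iff by auto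
    moreover have "yes n \<inter> no n = {}" unfolding no_iff using stronger_refl by blast
    ultimately show "el u \<inter> el v = {}" by blast
  next
    show "predense (el (W n))"
      unfolding predense_def
    proof
      fix p assume p: "p \<in> cond"
      obtain q U where q: "q \<preceq> p" "q \<in> U" "U = yes n \<or> U = no n"
      proof (cases "\<exists>q. q \<preceq> p \<and> q \<in> yes n")
        case True
        then show ?thesis using that by blast
      next
        case False
        then have "p \<in> no n" using p unfolding no_iff by blast
        then show ?thesis using that[of p "no n"] p by simp
      qed
      have "isset U" using q(3) yes_set no_set by blast
      then obtain u where u: "el u = U" unfolding isset_def by blast
      have "u \<epsilon> W n"
        unfolding W dec_iff mem_regular_opens u
        using q(2,3) yes_regular[OF n] no_regular[OF n] u by (auto simp: eq_empty_iff)
      then show "\<exists>q w. q \<preceq> p \<and> w \<in> el (W n) \<and> q \<epsilon> w" using q u by blast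
    qed
  qed
  have "card_le (W n) omega" for n
  proof (rule card_le_omega_pair)
    show "el (W n) \<subseteq> {setof (yes n), setof (no n)}"
    proof
      fix u assume "u \<in> el (W n)"
      then have "el u = yes n \<or> el u = no n" unfolding mem_Collect_eq W dec_iff by blast
      then have "setof (el u) = setof (yes n) \<or> setof (el u) = setof (no n)" by fastforce
      then show "u \<in> {setof (yes n), setof (no n)}" by simp
    qed
  qed
  then obtain V where V: "is_partition (ro P) V" "\<And>n. n \<epsilon> omega \<Longrightarrow> refines (ro P) V (W n)"
    using dist f partition unfolding distributive_def by (metis mem_Collect_eq)
  \<comment> \<open>The member \<open>v\<close> of the refinement is contained in a member of each
    partition, so the single condition \<open>r\<close> decides all \<open>n\<close> at
    once.\<close>
  then obtain r v where r: "r \<preceq> p" "v \<epsilon> V" "r \<epsilon> v"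
    using p unfolding is_partition_ro_iff predense_def by blast
  have rP: "r \<epsilon> first P" using r(1) by (rule stronger_cond)
  have decided: "r \<in> yes n \<or> r \<in> no n" if n: "n \<epsilon> omega" for n
  proof -
    obtain w where "w \<epsilon> W n" "el v \<subseteq> el w"
      using V(2)[OF n] r(2) unfolding refines_def le_ro by blast
    then show ?thesis using r(3) unfolding W dec_iff by blast
  qed
  have "isset {n \<in> el omega. R r n}"
    by (intro isset_sep isset_el definable_comp2[OF R] definable_intros)
  then obtain x where x: "\<And>n. n \<epsilon> x \<longleftrightarrow> n \<epsilon> omega \<and> R r n"
    by (rule issetE) (rule that, simp)
  have "forces_eq P r \<tau> (check P x)"
  proof (rule forces_eq_decided[OF \<tau> rP])
    show "forces_subset_omega r \<tau>"
      using sub r(1) stronger_trans unfolding forces_subset_omega_def by meson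
    show "forces_mem P r (check P n) \<tau> \<or> (\<forall>q. q \<preceq> r \<longrightarrow> \<not> forces_mem P q (check P n) \<tau>)"
      if "n \<epsilon> omega" for n
      using decided[OF that] stronger_cond(1) unfolding no_iff yes_iff[OF that] by blast
    show "n \<epsilon> x \<longleftrightarrow> n \<epsilon> omega \<and> forces_mem P r (check P n) \<tau>" for n
      unfolding x using R_iff[OF rP] by blast
  qed
  moreover have "el x \<subseteq> el omega" using x by blast
  ultimately show "\<exists>r x. r \<preceq> p \<and> el x \<subseteq> el omega \<and> forces_eq P r \<tau> (check P x)"
    using r(1) by blast
qed

section \<open>From no new reals to distributivity\<close>

lemma forces_eq_both:
  assumes "is_name P x" "is_name P y" "p \<epsilon> first P" "forces_eq P p x y"
  shows "forces_half (forces_eq P) p x y" "forces_half (\<lambda>q \<tau> \<sigma>. forces_eq P q \<sigma> \<tau>) p y x"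
  using assms forces_eq_unfold unfolding forces_both_def by blast+

text \<open>The name \<tau> built from \<open>B\<close> denotes the set of all \<open>i\<close>
  whose regular open set meets the generic filter. A condition that identifies it with a ground
  model set \<open>x\<close> decides every \<open>i\<close> according to membership in
  \<open>x\<close>.\<close>

lemma no_new_reals_decides:
  assumes no_new: "no_new_reals P" and B: "definable (\<lambda>\<rho>. B (\<rho> 0) (\<rho> (Suc 0)))"
    and regular: "\<And>i. i \<epsilon> omega \<Longrightarrow> regular_open {p \<in> cond. B i p}" and p: "p \<epsilon> first P"
  shows "\<exists>r. r \<preceq> p \<and> (\<forall>i. i \<epsilon> omega \<longrightarrow> B i r \<or> (\<forall>q. q \<preceq> r \<longrightarrow> \<not> B i q))"
proof -
  obtain f where f: "\<And>x c. \<langle>x, c\<rangle> \<epsilon> f \<longleftrightarrow> x \<epsilon> succ reals \<and> c = check P x"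
    using ex_check_set by blast
  \<comment> \<open>The name of \<open>omega\<close> bounds the pairs, and \<open>f\<close>
    expresses \<open>check\<close> inside the formula.\<close>
  have "isset {z \<in> el (check P omega). \<exists>i c p. z = \<langle>c, p\<rangle> \<and> i \<epsilon> omega \<and> \<langle>i, c\<rangle> \<epsilon> f \<and> B i p}"
    by (intro isset_sep isset_el definable_intros definable_opair definable_comp2[OF B])
  then obtain \<tau> where \<tau>0: "\<And>z. z \<epsilon> \<tau> \<longleftrightarrow> z \<epsilon> check P omega \<and>
      (\<exists>i c p. z = \<langle>c, p\<rangle> \<and> i \<epsilon> omega \<and> \<langle>i, c\<rangle> \<epsilon> f \<and> B i p)"
    by (rule issetE) (rule that, simp)
  have \<tau>: "z \<epsilon> \<tau> \<longleftrightarrow> (\<exists>i p. z = \<langle>check P i, p\<rangle> \<and> i \<epsilon> omega \<and> p \<epsilon> first P \<and> B i p)" for z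
    unfolding \<tau>0 mem_check[OF mem_succ_reals(2)] f
    using mem_succ_reals(1) by (auto simp del: mem_succ) metis+
  have sub: "el \<tau> \<subseteq> el (check P omega)"
    unfolding Collect_mono_iff \<tau> mem_check[OF mem_succ_reals(2)] by blast
  have \<tau>_name: "is_name P \<tau>" using sub by (rule is_name_subset_check_omega)
  have pair: "\<langle>\<sigma>, s\<rangle> \<epsilon> \<tau> \<longleftrightarrow> (\<exists>i. \<sigma> = check P i \<and> i \<epsilon> omega \<and> s \<epsilon> first P \<and> B i s)" for \<sigma> s
    unfolding \<tau> by simp
  have B_stronger: "B i r" if "B i q" "r \<preceq> q" "i \<epsilon> omega" for i q r
    using regular_open_stronger[OF regular[OF \<open>i \<epsilon> omega\<close>], of q r] that stronger_cond(2)
    by simp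
  have "forces_subset_omega p \<tau>"
    unfolding forces_subset_omega_def
  proof (intro allI impI)
    fix \<sigma> q assume "is_name P \<sigma>" "q \<preceq> p" and mem: "forces_mem P q \<sigma> \<tau>"
    \<comment> \<open>As a set, \<tau> is contained in the name of \<open>omega\<close>, so the
      inclusion is already forced at \<open>q\<close>.\<close>
    have "forces_mem P q \<sigma> (check P omega)"
      using mem sub unfolding forces_mem_def dense_below_iff by blast
    then show "\<exists>r. r \<preceq> q \<and> forces_mem P r \<sigma> (check P omega)"
      using stronger_refl stronger_cond(1)[OF \<open>q \<preceq> p\<close>] by blast
  qed
  then obtain r where r: "r \<preceq> p" "forces_mem P r \<tau> (check P reals)"
    using no_new \<tau>_name p stronger_refl[OF p] unfolding no_new_reals_iff mem_Collect_eq by blast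
  then obtain r' x where r': "r' \<preceq> r" "el x \<subseteq> el omega" "forces_eq P r' \<tau> (check P x)"
    using forces_mem_reals stronger_cond(1) by blast
  have r'P: "r' \<epsilon> first P" using r'(1) by (rule stronger_cond)
  have x: "x \<epsilon> succ reals" using r'(2) mem_reals by simp
  have half: "forces_half (forces_eq P) r' \<tau> (check P x)"
    "forces_half (\<lambda>q \<tau> \<sigma>. forces_eq P q \<sigma> \<tau>) r' (check P x) \<tau>"
    using forces_eq_both[OF \<tau>_name is_name_check[OF x] r'P r'(3)] by auto
  have "B i r' \<or> (\<forall>q. q \<preceq> r' \<longrightarrow> \<not> B i q)" if i: "i \<epsilon> omega" for i
  proof (cases "i \<epsilon> x")
    case True
    \<comment> \<open>The forced equality yields \<open>B i\<close> only densely below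
      \<open>r'\<close>; regularity then lifts it to \<open>r'\<close> itself.\<close>
    have "dense_below P r' (\<lambda>q. q \<in> {p \<in> cond. B i p})"
      unfolding dense_below_iff
    proof (intro allI impI)
      fix q assume q: "q \<preceq> r'"
      have "\<langle>check P i, r'\<rangle> \<epsilon> check P x" using pair_mem_check[OF x] True r'P by blast
      then obtain s where s: "s \<preceq> q" "s \<preceq> r' \<longrightarrow>
          (\<exists>\<sigma> t. \<langle>\<sigma>, t\<rangle> \<epsilon> \<tau> \<and> s \<preceq> t \<and> forces_eq P s \<sigma> (check P i))"
        using half(2) q unfolding forces_half_def dense_below_iff by blast
      then obtain \<sigma> t where t: "\<langle>\<sigma>, t\<rangle> \<epsilon> \<tau>" "s \<preceq> t" "forces_eq P s \<sigma> (check P i)"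
        using stronger_trans[OF s(1) q] by blast
      then obtain j where j: "\<sigma> = check P j" "j \<epsilon> omega" "B j t" unfolding pair by blast
      \<comment> \<open>A forced equality of canonical names is a true equality, so \<open>t\<close>
        lies in the set with index \<open>i\<close>.\<close>
      have "j = i"
        using forces_eq_check_inject[OF mem_succ_reals(1) mem_succ_reals(1)] j t i s(1) stronger_cond(1)
        by blast
      then have "B i s" using B_stronger j t i by blast
      then show "\<exists>s. s \<preceq> q \<and> s \<in> {p \<in> cond. B i p}" using s(1) stronger_cond(1) by blast
    qed
    then show ?thesis using regular[OF i] r'P unfolding regular_open_def by blast
  next
    case False
    have "\<not> B i q" if q: "q \<preceq> r'" for q
    proof
      assume "B i q"
      have qP: "q \<epsilon> first P" using q by (rule stronger_cond)
      then have "\<langle>check P i, q\<rangle> \<epsilon> \<tau>" unfolding pair using \<open>B i q\<close> i by blast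
      then obtain s where s: "s \<preceq> q" "s \<preceq> q \<longrightarrow>
          (\<exists>\<sigma> t. \<langle>\<sigma>, t\<rangle> \<epsilon> check P x \<and> s \<preceq> t \<and> forces_eq P s (check P i) \<sigma>)"
        using half(1) q unfolding forces_half_def dense_below_iff by blast
      then obtain \<sigma> t where t: "\<langle>\<sigma>, t\<rangle> \<epsilon> check P x" "forces_eq P s (check P i) \<sigma>" by blast
      then obtain j where j: "j \<epsilon> x" "\<sigma> = check P j" using pair_mem_check[OF x] by auto
      have "j \<epsilon> omega" using j(1) r'(2) by blast
      then have "i = j"
        using forces_eq_check_inject[OF mem_succ_reals(1) mem_succ_reals(1)] j t i s(1) stronger_cond(1)
        by blast
      then show False using False j(1) by simp
    qed
    then show ?thesis by blast
  qed
  then show ?thesis using stronger_trans[OF r'(1) r(1)] by blast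
qed

text \<open>Choosing an enumeration of each partition and combining them by an enumeration of pairs
  gives a single sequence that runs through all members of all partitions.\<close>

lemma ex_enumeration_of_partitions:
  assumes W: "fun_on W omega"
    and part: "\<And>n. n \<epsilon> omega \<Longrightarrow> is_partition (ro P) (app W n)"
    and card: "\<And>n. n \<epsilon> omega \<Longrightarrow> card_le (app W n) omega"
  shows "\<exists>B. definable (\<lambda>\<rho>. B (\<rho> 0) (\<rho> (Suc 0))) \<and>
    (\<forall>i. regular_open {p \<in> cond. B i p}) \<and>
    (\<forall>n w. n \<epsilon> omega \<longrightarrow> w \<epsilon> app W n \<longrightarrow> (\<exists>i. i \<epsilon> omega \<and> {p \<in> cond. B i p} = el w))"
proof -
  have regular: "regular_open (el w)" if "n \<epsilon> omega" "w \<epsilon> app W n" for n w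
    using part[OF that(1)] that(2) unfolding is_partition_ro_iff by blast
  define K where "K = {\<langle>w, k\<rangle> | w k. w \<in> el (regular_opens P) \<and> k \<in> el omega}"
  have K: "isset K" unfolding K_def by (intro isset_Times isset_el)
  define numbering where "numbering g a \<longleftrightarrow> (\<forall>w\<in>el a. \<exists>k\<in>el omega. \<langle>w, k\<rangle> \<epsilon> g) \<and>
    (\<forall>v\<in>el a. \<forall>w\<in>el a. \<forall>k. \<langle>v, k\<rangle> \<epsilon> g \<longrightarrow> \<langle>w, k\<rangle> \<epsilon> g \<longrightarrow> v = w)" for g a
  \<comment> \<open>Each partition is countable separately; choice picks their numberings
    simultaneously.\<close>
  have "\<exists>G. fun_on G omega \<and> (\<forall>n\<in>el omega. \<exists>a. \<langle>n, a\<rangle> \<epsilon> W \<and> numbering (app G n) a)"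
  proof (rule choice_function)
    show "isset {g. el g \<subseteq> K}" by (intro isset_Pow K)
    show "definable (\<lambda>\<rho>. \<exists>a. \<langle>\<rho> 0, a\<rangle> \<epsilon> W \<and> numbering (\<rho> (Suc 0)) a)"
      unfolding numbering_def by (intro definable_intros definable_opair)
    fix n assume n: "n \<epsilon> omega"
    then obtain g where g: "fun_on g (app W n)" "app g ` el (app W n) \<subseteq> el omega"
        "inj_on (app g) (el (app W n))"
      using card unfolding card_le_def by blast
    have "el g \<subseteq> K"
    proof
      fix z assume "z \<in> el g"
      then obtain w k where z: "z = \<langle>w, k\<rangle>" using g(1) unfolding fun_on_def by blast
      then have "w \<epsilon> app W n" "k = app g w"
        using \<open>z \<in> el g\<close> fun_on_mem_iff[OF g(1)] by auto
      then show "z \<in> K"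
        unfolding K_def z using g(2) regular[OF n] mem_regular_opens by blast
    qed
    moreover have "numbering g (app W n)"
      unfolding numbering_def fun_on_mem_iff[OF g(1)] using g(2,3) by (auto simp: inj_on_def)
    moreover have "\<langle>n, app W n\<rangle> \<epsilon> W" using fun_on_mem_iff[OF W] n by blast
    ultimately show "\<exists>g\<in>{g. el g \<subseteq> K}. \<exists>a. \<langle>n, a\<rangle> \<epsilon> W \<and> numbering g a" by blast
  qed
  then obtain G where G: "fun_on G omega"
      "\<And>n. n \<epsilon> omega \<Longrightarrow> numbering (app G n) (app W n)"
    using fun_on_mem_iff[OF W] by auto
  obtain Z where Z: "\<And>i n m n' m'. \<langle>i, \<langle>n, m\<rangle>\<rangle> \<epsilon> Z \<Longrightarrow> \<langle>i, \<langle>n', m'\<rangle>\<rangle> \<epsilon> Z \<Longrightarrow> n = n' \<and> m = m'"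
      "\<And>n m. n \<epsilon> omega \<Longrightarrow> m \<epsilon> omega \<Longrightarrow> \<exists>i. i \<epsilon> omega \<and> \<langle>i, \<langle>n, m\<rangle>\<rangle> \<epsilon> Z"
    using ex_enumeration_of_pairs by (elim exE conjE) (rule that, blast+)
  \<comment> \<open>The index \<open>i\<close> codes a pair of numbers \<open>n\<close> and
    \<open>k\<close>, and \<open>w\<close> is the member with number \<open>k\<close> of the
    partition for \<open>n\<close>. There is at most one such \<open>w\<close>, and none if
    \<open>i\<close> codes no pair or \<open>k\<close> numbers no member.\<close>
  define nth where "nth i w \<longleftrightarrow> (\<exists>n k a g. \<langle>i, \<langle>n, k\<rangle>\<rangle> \<epsilon> Z \<and> \<langle>n, a\<rangle> \<epsilon> W \<and> \<langle>n, g\<rangle> \<epsilon> G \<and>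
    w \<epsilon> a \<and> \<langle>w, k\<rangle> \<epsilon> g)" for i w
  have nth_iff: "nth i w \<longleftrightarrow> (\<exists>n k. \<langle>i, \<langle>n, k\<rangle>\<rangle> \<epsilon> Z \<and> n \<epsilon> omega \<and>
    w \<epsilon> app W n \<and> \<langle>w, k\<rangle> \<epsilon> app G n)" for i w
    unfolding nth_def fun_on_mem_iff[OF W] fun_on_mem_iff[OF G(1)] by blast
  have nth_unique: "v = w" if vw: "nth i v" "nth i w" for i v w
  proof -
    obtain n k where v: "\<langle>i, \<langle>n, k\<rangle>\<rangle> \<epsilon> Z" "n \<epsilon> omega" "v \<epsilon> app W n" "\<langle>v, k\<rangle> \<epsilon> app G n"
      using vw(1) unfolding nth_iff by blast
    obtain n' k' where w: "\<langle>i, \<langle>n', k'\<rangle>\<rangle> \<epsilon> Z" "w \<epsilon> app W n'" "\<langle>w, k'\<rangle> \<epsilon> app G n'"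
      using vw(2) unfolding nth_iff by blast
    have "n' = n" "k' = k" using Z(1)[OF w(1) v(1)] by auto
    then show ?thesis using G(2)[OF v(2)] v(3,4) w(2,3) unfolding numbering_def by blast
  qed
  define B where "B i p \<longleftrightarrow> (\<exists>w. nth i w \<and> p \<epsilon> w)" for i p
  have B_eq: "{p \<in> cond. B i p} = el w" if "nth i w" for i w
  proof -
    have "regular_open (el w)" using that regular unfolding nth_iff by blast
    then have "el w \<subseteq> cond" unfolding regular_open_def by blast
    moreover have "B i p \<longleftrightarrow> p \<epsilon> w" for p unfolding B_def using that nth_unique by blast
    ultimately show ?thesis by blast
  qed
  have "definable (\<lambda>\<rho>. B (\<rho> 0) (\<rho> (Suc 0)))"
    unfolding B_def nth_def by (intro definable_intros definable_opair)
  moreover have "regular_open {p \<in> cond. B i p}" for i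
  proof (cases "\<exists>w. nth i w")
    case True
    then obtain w where w: "nth i w" by blast
    then have "regular_open (el w)" using regular unfolding nth_iff by blast
    then show ?thesis unfolding B_eq[OF w] .
  next
    case False
    \<comment> \<open>An index without a member contributes the zero element, so the sequence is
      total on all indices.\<close>
    then have *: "{p \<in> cond. B i p} = el empty" unfolding B_def by simp
    show ?thesis unfolding * using empty_regular_open unfolding mem_regular_opens .
  qed
  moreover have "\<exists>i. i \<epsilon> omega \<and> {p \<in> cond. B i p} = el w" if nw: "n \<epsilon> omega" "w \<epsilon> app W n" for n w
  proof -
    obtain k where k: "k \<epsilon> omega" "\<langle>w, k\<rangle> \<epsilon> app G n"
      using G(2)[OF nw(1)] nw(2) unfolding numbering_def by blast
    then obtain i where i: "i \<epsilon> omega" "\<langle>i, \<langle>n, k\<rangle>\<rangle> \<epsilon> Z" using Z(2) nw(1) by blast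
    then have "nth i w" unfolding nth_iff using k nw by blast
    then show ?thesis using B_eq i(1) by blast
  qed
  ultimately show ?thesis by blast
qed

lemma no_new_reals_imp_distributive:
  assumes no_new: "no_new_reals P"
  shows "distributive omega omega (ro P)"
  unfolding distributive_def
proof (intro allI impI, elim conjE)
  fix W assume W: "fun_on W omega"
    "\<forall>n\<in>el omega. is_partition (ro P) (app W n) \<and> card_le (app W n) omega"
  have part: "is_partition (ro P) (app W n)" if "n \<epsilon> omega" for n using W(2) that by simp
  have regular: "regular_open (el w)" if "n \<epsilon> omega" "w \<epsilon> app W n" for n w
    using part[OF that(1)] that(2) unfolding is_partition_ro_iff by blast
  have disjoint: "v = w" if "n \<epsilon> omega" "v \<epsilon> app W n" "w \<epsilon> app W n" "p \<epsilon> v" "p \<epsilon> w" for n v w p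
    using part[OF that(1)] that(2-5) unfolding is_partition_ro_iff by blast
  have card: "card_le (app W n) omega" if "n \<epsilon> omega" for n using W(2) that by simp
  obtain B where B: "definable (\<lambda>\<rho>. B (\<rho> 0) (\<rho> (Suc 0)))"
      "\<forall>i. regular_open {p \<in> cond. B i p}"
      "\<forall>n w. n \<epsilon> omega \<longrightarrow> w \<epsilon> app W n \<longrightarrow> (\<exists>i. i \<epsilon> omega \<and> {p \<in> cond. B i p} = el w)"
  proof -
    have "\<exists>B. definable (\<lambda>\<rho>. B (\<rho> 0) (\<rho> (Suc 0))) \<and> (\<forall>i. regular_open {p \<in> cond. B i p}) \<and>
        (\<forall>n w. n \<epsilon> omega \<longrightarrow> w \<epsilon> app W n \<longrightarrow> (\<exists>i. i \<epsilon> omega \<and> {p \<in> cond. B i p} = el w))"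
      by (rule ex_enumeration_of_partitions[OF W(1) part card])
    then show ?thesis by (elim exE conjE) (rule that)
  qed
  \<comment> \<open>These are the conditions that lie in some member of each partition; by
    disjointness the members are unique.\<close>
  define selects where "selects p \<longleftrightarrow> p \<epsilon> first P \<and>
    (\<forall>n. n \<epsilon> omega \<longrightarrow> (\<exists>a w. \<langle>n, a\<rangle> \<epsilon> W \<and> w \<epsilon> a \<and> p \<epsilon> w))" for p
  have selects_iff: "selects p \<longleftrightarrow> p \<epsilon> first P \<and>
      (\<forall>n. n \<epsilon> omega \<longrightarrow> (\<exists>w. w \<epsilon> app W n \<and> p \<epsilon> w))" for p
    unfolding selects_def fun_on_mem_iff[OF W(1)] by auto
  have dense: "\<exists>r. r \<preceq> p \<and> selects r" if p: "p \<epsilon> first P" for p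
  proof -
    obtain r where r: "r \<preceq> p" "\<And>i. i \<epsilon> omega \<Longrightarrow> B i r \<or> (\<forall>q. q \<preceq> r \<longrightarrow> \<not> B i q)"
      using no_new_reals_decides[OF no_new B(1) spec[OF B(2)] p] by blast
    have rP: "r \<epsilon> first P" using r(1) by (rule stronger_cond)
    have "\<exists>w. w \<epsilon> app W n \<and> r \<epsilon> w" if n: "n \<epsilon> omega" for n
    proof -
      obtain q w where q: "q \<preceq> r" "w \<epsilon> app W n" "q \<epsilon> w"
        using part[OF n] rP unfolding is_partition_ro_iff predense_def by blast
      obtain i where i: "i \<epsilon> omega" "{p \<in> cond. B i p} = el w" using B(3) n q(2) by blast
      then have "B i q" using q(3) by blast
      \<comment> \<open>Since \<open>q\<close> below \<open>r\<close> belongs to the set with index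
        \<open>i\<close>, the decision made by \<open>r\<close> cannot be negative.\<close>
      then have "B i r" using r(2)[OF i(1)] q(1) by blast
      then show ?thesis using i(2) q(2) rP by blast
    qed
    then show ?thesis using r(1) rP unfolding selects_iff by blast
  qed
  \<comment> \<open>The cell of \<open>p\<close> is the intersection of all partition members that
    contain \<open>p\<close>. The cells of selecting conditions form the common refinement.\<close>
  define cell where "cell p v \<longleftrightarrow> (\<forall>q. q \<epsilon> v \<longleftrightarrow> q \<epsilon> first P \<and>
    (\<forall>n a w. n \<epsilon> omega \<longrightarrow> \<langle>n, a\<rangle> \<epsilon> W \<longrightarrow> w \<epsilon> a \<longrightarrow> p \<epsilon> w \<longrightarrow> q \<epsilon> w))" for p v
  have cell_iff: "cell p v \<longleftrightarrow> (\<forall>q. q \<epsilon> v \<longleftrightarrow> q \<epsilon> first P \<and>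
    (\<forall>n w. n \<epsilon> omega \<longrightarrow> w \<epsilon> app W n \<longrightarrow> p \<epsilon> w \<longrightarrow> q \<epsilon> w))" for p v
    unfolding cell_def fun_on_mem_iff[OF W(1)] by auto
  have ex_cell: "\<exists>v. cell p v" for p
  proof -
    have "isset {q \<in> cond. \<forall>n a w. n \<epsilon> omega \<longrightarrow> \<langle>n, a\<rangle> \<epsilon> W \<longrightarrow> w \<epsilon> a \<longrightarrow> p \<epsilon> w \<longrightarrow> q \<epsilon> w}"
      by (intro isset_sep isset_el definable_intros definable_opair)
    then obtain v where "\<And>q. q \<epsilon> v \<longleftrightarrow> q \<in> {q \<in> cond. \<forall>n a w. n \<epsilon> omega \<longrightarrow> \<langle>n, a\<rangle> \<epsilon> W \<longrightarrow> w \<epsilon> a \<longrightarrow> p \<epsilon> w \<longrightarrow> q \<epsilon> w}"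
      by (rule issetE) (rule that)
    then show ?thesis unfolding cell_def by (intro exI[of _ v]) simp
  qed
  have cell_regular: "regular_open (el v)" if v: "cell p v" for p v
  proof (rule regular_openI)
    have v: "q \<epsilon> v \<longleftrightarrow> q \<epsilon> first P \<and> (\<forall>n w. n \<epsilon> omega \<longrightarrow> w \<epsilon> app W n \<longrightarrow> p \<epsilon> w \<longrightarrow> q \<epsilon> w)" for q
      using v unfolding cell_iff by blast
    show "el v \<subseteq> cond" using v by blast
    show "r \<in> el v" if "q \<in> el v" "r \<preceq> q" for q r
    proof -
      have "r \<epsilon> w" if "n \<epsilon> omega" "w \<epsilon> app W n" "p \<epsilon> w" for n w
        using regular_open_stronger[OF regular[OF that(1,2)] _ \<open>r \<preceq> q\<close>] \<open>q \<in> el v\<close> v that by blast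
      then show ?thesis using v stronger_cond(1)[OF that(2)] by blast
    qed
    show "q \<in> el v" if q: "q \<in> cond" "dense_below P q (\<lambda>r. r \<in> el v)" for q
    proof -
      have "q \<epsilon> w" if w: "n \<epsilon> omega" "w \<epsilon> app W n" "p \<epsilon> w" for n w
      proof -
        have "dense_below P q (\<lambda>r. r \<in> el w)"
          using q(2) v w unfolding dense_below_iff by blast
        then show ?thesis using regular[OF w(1,2)] q(1) unfolding regular_open_def by blast
      qed
      then show ?thesis using v q(1) by blast
    qed
  qed
  have cell_self: "p \<epsilon> v" if "cell p v" "p \<epsilon> first P" for p v
    using that unfolding cell_iff by blast
  \<comment> \<open>A common condition \<open>q\<close> lies in the members chosen by
    \<open>p\<close> and in those chosen by \<open>p'\<close>, so disjointness identifies the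
    choices and with them the cells.\<close>
  have cell_cong: "v = v'" if v: "cell p v" "cell p' v'" and p: "selects p" "selects p'"
    and q: "q \<epsilon> v" "q \<epsilon> v'" for p p' q v v'
  proof -
    have same: "p \<epsilon> w \<longleftrightarrow> p' \<epsilon> w" if w: "n \<epsilon> omega" "w \<epsilon> app W n" for n w
    proof -
      obtain u u' where u: "u \<epsilon> app W n" "p \<epsilon> u" "u' \<epsilon> app W n" "p' \<epsilon> u'"
        using p w(1) unfolding selects_iff by blast
      then have "q \<epsilon> u" "q \<epsilon> u'" using v q w(1) unfolding cell_iff by blast+
      then have "u = u'" using disjoint[OF w(1)] u by blast
      then show ?thesis using disjoint[OF w(1)] u w(2) by blast
    qed
    then show ?thesis using v unfolding cell_iff by (intro extI) blast
  qed
  have "isset {v \<in> el (regular_opens P). \<exists>p. selects p \<and> cell p v}"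
    unfolding selects_def cell_def by (intro isset_sep isset_el definable_intros definable_opair)
  then obtain V where V: "\<And>v. v \<epsilon> V \<longleftrightarrow> v \<epsilon> regular_opens P \<and> (\<exists>p. selects p \<and> cell p v)"
    by (rule issetE) (rule that, simp)
  have "is_partition (ro P) V"
    unfolding is_partition_ro_iff
  proof (intro conjI ballI impI)
    fix v assume "v \<in> el V"
    then obtain p where p: "selects p" "cell p v" using V by blast
    show "regular_open (el v)" using cell_regular p(2) by blast
    have "p \<epsilon> v" using cell_self[OF p(2)] p(1) unfolding selects_def by blast
    then show "el v \<noteq> {}" by blast
  next
    fix v v' assume v: "v \<in> el V" "v' \<in> el V" "v \<noteq> v'"
    then obtain p p' where "selects p" "cell p v" "selects p'" "cell p' v'"
      unfolding mem_Collect_eq V by blast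
    then show "el v \<inter> el v' = {}" using cell_cong v(3) by blast
  next
    show "predense (el V)"
      unfolding predense_def
    proof
      fix p assume "p \<in> cond"
      then obtain r where r: "r \<preceq> p" "selects r" using dense by blast
      obtain v where v: "cell r v" using ex_cell by blast
      have "v \<epsilon> V" using V r(2) v cell_regular mem_regular_opens by blast
      moreover have "r \<epsilon> v" using cell_self[OF v stronger_cond(1)[OF r(1)]] .
      ultimately show "\<exists>q w. q \<preceq> p \<and> w \<in> el V \<and> q \<epsilon> w" using r(1) by blast
    qed
  qed
  moreover have "refines (ro P) V (app W n)" if n: "n \<epsilon> omega" for n
    unfolding refines_def
  proof
    fix v assume "v \<in> el V"
    then obtain p where p: "selects p" "cell p v" "v \<epsilon> regular_opens P" using V by blast
    then obtain w where w: "w \<epsilon> app W n" "p \<epsilon> w" using n unfolding selects_iff by blast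
    then have "el v \<subseteq> el w" using p(2) n unfolding cell_iff by blast
    then have "le (ro P) v w"
      unfolding le_ro using p(3) regular[OF n w(1)] mem_regular_opens by blast
    then show "\<exists>w\<in>el (app W n). le (ro P) v w" using w(1) by blast
  qed
  ultimately show "\<exists>V. is_partition (ro P) V \<and> (\<forall>n\<in>el omega. refines (ro P) V (app W n))"
    by blast
qed

end

theorem theorem9:
  fixes E :: "'v \<Rightarrow> 'v \<Rightarrow> bool"
  assumes "set_structure.ZFC E"
  shows "set_structure.IFS_LR E \<longleftrightarrow>
    (\<forall>P. set_structure.partial_order E P \<and> set_structure.definable_LR E P \<and>
         set_structure.distributive E (set_structure.omega E) (set_structure.omega E)
           (set_structure.ro E P) \<longrightarrow>
         (\<exists>G. set_structure.LR_generic E P G))"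
proof -
  interpret zfc E
    using assms by unfold_locales
  \<comment> \<open>Both sides of the theorem quantify over partial orders of the model, so it
    suffices to compare the two conditions for each order separately.\<close>
  have "no_new_reals P \<longleftrightarrow> distributive omega omega (ro P)" if "partial_order P" for P
  proof -
    interpret forcing_order E P
      using that by unfold_locales
    show ?thesis
      using no_new_reals_imp_distributive distributive_imp_no_new_reals by blast
  qed
  then show ?thesis
    unfolding IFS_LR_def by blast
qed

end
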